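(* Let $\Omega_\infty$ denote the set of transcendentally normal real numbers. Then: (i) $\Omega_\infty$ has full Lebesgue measure, i.e. $\mu(\mathbb{R}\setminus\Omega_\infty)=0$. (ii) For every $r\in(0,1]$ the Sierpinski number $\xi_{\mathcal{P}}(r):=\inf\{x\in[0,1]\,:\,x\notin U_{\mathcal{P}}(r)\}$ exists and is transcendentally normal. (iii) There is an algorithm which computes, digit by digit and simultaneously in all integer bases $b\ge 2$, the expansion of a transcendentally normal number $\nu\in(0,1)$. In particular, there exists a computable transcendentally normal number $\nu\in(0,1)$.
   Context: $\mu$ denotes Lebesgue measure. A real number $x$ is (absolutely) normal if for every integer base $b\ge2$ and every finite word $w$ over $\{0,\dots,b-1\}$, $w$ occurs in the base-$b$ expansion of $x$ with asymptotic frequency $b^{-|w|}$. A real $x$ is transcendentally normal if $p(x)$ is normal for every non-constant polynomial $p\in\mathbb{Z}[X]$. Sierpinski cover: for integers $b\ge2$, $m,n\ge1$, $d\in\{0,\dots,b-1\}$ and $(q_1,\dots,q_n)\in\{0,\dots,b-1\}^n$ put $C_d(q_1,\dots,q_n):=\#\{j: q_j=d\}$ and $U_{b,m,n,d}:=\bigcup\big(\sum_{j=1}^n q_jb^{-j}+b^{-n},\ \sum_{j=1}^n q_jb^{-j}+2b^{-n}\big)$, the union over all $(q_1,\dots,q_n)\in\{0,\dots,b-1\}^n$ with $|C_d(q_1,\dots,q_n)/n-1/b|\ge 1/m$. Let $n_{m,b}(r):=\lfloor 24m^6b^2/r\rfloor+2$ and $U(r):=\bigcup_{b\ge2}\bigcup_{m\ge1}\bigcup_{n\ge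 n_{m,b}(r)}\bigcup_{d=0}^{b-1}U_{b,m,n,d}$, and $U^+(r):=\bigcup_{z\in\mathbb{Z}}\big(z+U(r/2^{|z|+2})\big)$. Polynomial family: $\mathcal{P}:=\{p\in\mathbb{Z}[X]\setminus\{0\}: p(0)=0\}$. For $p=\sum_{k=1}^d a_kx^k$ set $\|p\|_{\mathcal{P}}:=\sum_{k=1}^d2^k|a_k|$. Order $\mathcal{P}$ totally by: $p=\sum a_kx^k\preceq q=\sum b_kx^k$ iff $\|p\|_{\mathcal{P}}<\|q\|_{\mathcal{P}}$, or $\|p\|_{\mathcal{P}}=\|q\|_{\mathcal{P}}$ and $a_{k_0}>b_{k_0}$ where $k_0=\min\{k:a_k\ne b_k\}$ (or $p=q$). Let $p_1,p_2,\dots$ be the resulting increasing enumeration of $\mathcal{P}$ (so $p_1=x$), $d_{p_k}$ the degree of $p_k$, and $K_d:=4d^4(d+1)^{d+1}$. Define $U_{\mathcal{P}}(r):=\bigcup_{k\ge1}p_k^{-1}\Big(U^+\big((2^{-k}r/K_{d_{p_k}})^{1/d_{p_k}}\big)\Big)$.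
   Formalization: The intervals of U_{b,m,n,d} are taken with left endpoint sum q_j b^{-j} − b^{-n} instead of the printed + b^{-n}; with the plus sign no integer is ever covered, so 0 is not in U_P(r), the Sierpinski number is 0 and (ii) fails. *)

theory Defs
  imports "HOL-Analysis.Analysis" "HOL-Computational_Algebra.Polynomial"
begin

section \<open>Normal and transcendentally normal numbers\<close>

text \<open>
  The digit at position \<open>k \<ge> 1\<close> after the radix point.  A negative number has the digits of its
  absolute value; a number with two expansions gets the terminating one.
\<close>
definition digit :: "nat \<Rightarrow> real \<Rightarrow> nat \<Rightarrow> nat" where
  "digit b x k = nat \<lfloor>\<bar>x\<bar> * real b ^ k\<rfloor> mod b"

definition occurrences :: "nat \<Rightarrow> real \<Rightarrow> nat list \<Rightarrow> nat \<Rightarrow> nat" where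
  "occurrences b x w n =
     card {i \<in> {1..n}. \<forall>j < length w. digit b x (i + j) = w ! j}"

definition normal_number :: "real \<Rightarrow> bool" where
  "normal_number x \<longleftrightarrow>
     (\<forall>b\<ge>2. \<forall>w. set w \<subseteq> {0..<b} \<longrightarrow>
        (\<lambda>n. real (occurrences b x w n) / real n) \<longlonglongrightarrow> 1 / real b ^ length w)"

definition int_poly_eval :: "int poly \<Rightarrow> real \<Rightarrow> real" where
  "int_poly_eval p x = poly (map_poly real_of_int p) x"

definition transcendentally_normal :: "real \<Rightarrow> bool" where
  "transcendentally_normal x \<longleftrightarrow>
     (\<forall>p :: int poly. degree p > 0 \<longrightarrow> normal_number (int_poly_eval p x))"

definition Omega_infty :: "real set" where
  "Omega_infty = {x. transcendentally_normal x}"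

section \<open>The Sierpinski cover\<close>

definition digit_count :: "nat \<Rightarrow> nat \<Rightarrow> (nat \<Rightarrow> nat) \<Rightarrow> nat" where
  "digit_count d n q = card {j \<in> {1..n}. q j = d}"

definition digit_value :: "nat \<Rightarrow> nat \<Rightarrow> (nat \<Rightarrow> nat) \<Rightarrow> real" where
  "digit_value b n q = (\<Sum>j = 1..n. real (q j) / real b ^ j)"

text \<open>
  As in Sierpinski's construction, the interval belonging to a word of length \<open>n\<close> is its
  \<open>b\<close>-adic cell enlarged by \<open>1 / b ^ n\<close> on either side, so the left endpoint carries a minus sign.
  With a plus sign the intervals would be open cells of the \<open>b\<close>-adic grid; these contain no
  integer, so \<open>0\<close> would never be covered and every Sierpinski number would be \<open>0\<close>.
\<close>
definition U_cell :: "nat \<Rightarrow> nat \<Rightarrow> nat \<Rightarrow> nat \<Rightarrow> real set" where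
  "U_cell b m n d =
     (\<Union>q \<in> {q \<in> {1..n} \<rightarrow>\<^sub>E {0..<b}.
               \<bar>real (digit_count d n q) / real n - 1 / real b\<bar> \<ge> 1 / real m}.
        {digit_value b n q - 1 / real b ^ n <..< digit_value b n q + 2 / real b ^ n})"

definition n_start :: "nat \<Rightarrow> nat \<Rightarrow> real \<Rightarrow> nat" where
  "n_start m b r = nat \<lfloor>24 * real m ^ 6 * real b ^ 2 / r\<rfloor> + 2"

definition U_cover :: "real \<Rightarrow> real set" where
  "U_cover r =
     (\<Union>b \<in> {2..}. \<Union>m \<in> {1..}. \<Union>n \<in> {n_start m b r..}. \<Union>d \<in> {0..<b}. U_cell b m n d)"

definition U_plus :: "real \<Rightarrow> real set" where
  "U_plus r = (\<Union>z :: int. (\<lambda>y. of_int z + y) ` U_cover (r / 2 ^ (nat \<bar>z\<bar> + 2)))"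

section \<open>The polynomial family\<close>

definition poly_family :: "int poly set" where
  "poly_family = {p. p \<noteq> 0 \<and> poly p 0 = 0}"

definition family_norm :: "int poly \<Rightarrow> int" where
  "family_norm p = (\<Sum>k = 1..degree p. 2 ^ k * \<bar>coeff p k\<bar>)"

definition family_le :: "int poly \<Rightarrow> int poly \<Rightarrow> bool" where
  "family_le p q \<longleftrightarrow>
     p = q \<or> family_norm p < family_norm q \<or>
     (family_norm p = family_norm q \<and>
      (let k\<^sub>0 = (LEAST k. coeff p k \<noteq> coeff q k) in coeff p k\<^sub>0 > coeff q k\<^sub>0))"

text \<open>
  The increasing enumeration, for indices \<open>k \<ge> 1\<close>: its \<open>k\<close>-th member is the one with exactly
  \<open>k\<close> members below or equal to it.  (Only finitely many members have norm below a given bound.)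
\<close>
definition family_enum :: "nat \<Rightarrow> int poly" where
  "family_enum k = (THE p. p \<in> poly_family \<and> card {q \<in> poly_family. family_le q p} = k)"

definition K_const :: "nat \<Rightarrow> real" where
  "K_const d = 4 * real d ^ 4 * real (d + 1) ^ (d + 1)"

definition U_family :: "real \<Rightarrow> real set" where
  "U_family r =
     (\<Union>k \<in> {1..}.
        let p = family_enum k; d = degree p in
          int_poly_eval p -` U_plus ((r / 2 ^ k / K_const d) powr (1 / real d)))"

definition sierpinski_candidates :: "real \<Rightarrow> real set" where
  "sierpinski_candidates r = {x \<in> {0..1}. x \<notin> U_family r}"

definition sierpinski_number :: "real \<Rightarrow> real" where
  "sierpinski_number r = Inf (sierpinski_candidates r)"

section \<open>Computability\<close>

text \<open>
  Programs for partial recursive functions on tuples of natural numbers.  Primitive recursion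
  and minimisation run over the first component of the tuple.
\<close>
datatype program =
    Zero
  | Succ
  | Proj nat
  | Comp program "program list"
  | PrimRec program program
  | Minimise program

inductive evaluates :: "program \<Rightarrow> nat list \<Rightarrow> nat \<Rightarrow> bool" where
  Zero: "evaluates Zero xs 0"
| Succ: "evaluates Succ [x] (Suc x)"
| Proj: "i < length xs \<Longrightarrow> evaluates (Proj i) xs (xs ! i)"
| Comp: "\<lbrakk>length ys = length gs; \<forall>i < length gs. evaluates (gs ! i) xs (ys ! i);
          evaluates f ys z\<rbrakk> \<Longrightarrow> evaluates (Comp f gs) xs z"
| PrimRec_0: "evaluates f xs y \<Longrightarrow> evaluates (PrimRec f g) (0 # xs) y"
| PrimRec_Suc: "\<lbrakk>evaluates (PrimRec f g) (n # xs) y; evaluates g (n # y # xs) z\<rbrakk>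
    \<Longrightarrow> evaluates (PrimRec f g) (Suc n # xs) z"
| Minimise: "\<lbrakk>evaluates f (n # xs) 0; \<forall>i < n. \<exists>y. evaluates f (i # xs) (Suc y)\<rbrakk>
    \<Longrightarrow> evaluates (Minimise f) xs n"

lemma evaluates_deterministic:
  assumes "evaluates e xs y" "evaluates e xs z"
  shows "y = z"
  using assms
proof (induction arbitrary: z rule: evaluates.induct)
  case (Zero xs)
  then show ?case by (auto elim: evaluates.cases)
next
  case (Succ x)
  then show ?case by (auto elim: evaluates.cases)
next
  case (Proj i xs)
  from Proj.prems show ?case by (auto elim: evaluates.cases)
next
  case (Comp ys gs xs f z')
  from Comp.prems obtain ys' where ys':
    "length ys' = length gs" "\<forall>i < length gs. evaluates (gs ! i) xs (ys' ! i)" "evaluates f ys' z"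
    by (auto elim: evaluates.cases)
  have "ys = ys'"
    using Comp.hyps(1) Comp.IH(1) ys'(1,2) by (intro nth_equalityI) auto
  with Comp.IH(2) ys'(3) show ?case by blast
next
  case (PrimRec_0 f xs y g)
  from PrimRec_0.prems have "evaluates f xs z" by (auto elim: evaluates.cases)
  with PrimRec_0.IH show ?case by blast
next
  case (PrimRec_Suc f g n xs y z')
  from PrimRec_Suc.prems obtain y' where
    "evaluates (PrimRec f g) (n # xs) y'" "evaluates g (n # y' # xs) z"
    by (auto elim: evaluates.cases)
  with PrimRec_Suc.IH show ?case by blast
next
  case (Minimise f n xs)
  from Minimise.prems have z: "evaluates f (z # xs) 0" "\<forall>i < z. \<exists>y. evaluates f (i # xs) (Suc y)"
    by (auto elim: evaluates.cases)
  show ?case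
  proof (cases n z rule: linorder_cases)
    case less
    with z(2) Minimise.IH(1) show ?thesis by blast
  next
    case greater
    with z(1) Minimise.IH(2) show ?thesis by blast
  qed
qed

definition computes_all_expansions :: "program \<Rightarrow> real \<Rightarrow> bool" where
  "computes_all_expansions e x \<longleftrightarrow> (\<forall>b\<ge>2. \<forall>k\<ge>1. evaluates e [b, k] (digit b x k))"

definition computable_fun :: "(nat \<Rightarrow> nat) \<Rightarrow> bool" where
  "computable_fun f \<longleftrightarrow> (\<exists>e. \<forall>n. evaluates e [n] (f n))"

text \<open>
  A real is computable if it is the limit of a computable sequence of rationals with error at most
  \<open>1 / 2 ^ n\<close>; signed rationals are coded by three natural numbers.
\<close>
definition computable_real :: "real \<Rightarrow> bool" where
  "computable_real x \<longleftrightarrow>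
     (\<exists>f g h. computable_fun f \<and> computable_fun g \<and> computable_fun h \<and>
        (\<forall>n. \<bar>x - (real (f n) - real (g n)) / (real (h n) + 1)\<bar> \<le> 1 / 2 ^ n))"

end

theory Submission
  imports Defs
    "HOL-Computational_Algebra.Fundamental_Theorem_Algebra"
    "HOL-Real_Asymp.Real_Asymp"
begin

text \<open>
  An exponential moment bound shows that words of length \<open>n\<close> with unbalanced digit frequencies are
  exponentially rare; since the cover only uses lengths \<open>n \<ge> 24 m\<^sup>6 b\<^sup>2 / r\<close>, the set \<open>U_plus r\<close> has measure
  at most \<open>exp (- 48 / r)\<close>.  A polynomial \<open>p\<close> of degree \<open>d\<close> with leading coefficient of modulus at
  least \<open>1\<close> pulls a set of measure \<open>L\<close> back to one of measure at most \<open>4 d L powr (1 / d)\<close>, because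
  \<open>p'\<close> is small only near the real parts of its \<open>d - 1\<close> complex zeros.  The \<open>k\<close>-th polynomial of the
  family has degree at most \<open>1 + log\<^sub>2 k\<close>, and so \<open>U_family r\<close> has measure less than \<open>1\<close> even though its
  radii involve a \<open>d\<close>-th root.  A number that avoids the cover has values \<open>p(x)\<close> that are simply normal
  to all bases for all \<open>p\<close>; using \<open>b ^ r * p\<close> and the base \<open>b ^ l\<close> this gives normality.

  For a computable number, stage \<open>t\<close> tests the lengths \<open>n\<close> in \<open>[t\<^sup>2, (t + 1)\<^sup>2)\<close> for finitely many
  polynomials, bases and precisions, on a dyadic grid so fine that every test is integer arithmetic
  at grid points.  The failing cells have total measure at most \<open>1 / 8 ^ (t + 1)\<close>, and bisecting always
  towards the half in which the tests seen so far fail less often computes a number that passes all.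
\<close>

section \<open>Computable functions\<close>

text \<open>Two \<open>d\<close>-th roots occur: one in the radii of \<open>U_family\<close>, one in
  the measure of a preimage. An estimate exponential in \<open>1 / r\<close> absorbs both. The
  second root only divides the exponent by \<open>d\<close>; the first leaves
  \<open>1 / \<epsilon>\<close> at least \<open>2 powr (k / d) * (d + 1)\<close>, and
  \<open>d\<^sup>2 \<le> 3 * k\<close> makes the remaining exponent at least linear in
  \<open>k\<close>.

  The Sierpinski number is the least point outside an infinite union, which gives normality but no
  algorithm; the computable number is therefore built from finite tests of its own. Stage
  \<open>t\<close> works near length \<open>t\<^sup>2\<close> rather than \<open>t\<close> because
  its failure measure has to beat \<open>8 ^ t\<close>, and the decay in the length is slowed down
  by the precision and the degree.

  The tests look at grid points, while the number lies anywhere in a grid cell. The enlargement of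
  each \<open>b\<close>-adic cell by one cell on either side is exactly what absorbs this rounding
  error: a failing test still places every interior point of its grid cell in the preimage of an
  unbalanced enlarged cell.\<close>

definition computable :: "nat \<Rightarrow> ((nat \<Rightarrow> nat) \<Rightarrow> nat) \<Rightarrow> bool" where
  "computable n F \<longleftrightarrow> (\<exists>e. \<forall>xs. length xs = n \<longrightarrow> evaluates e xs (F (nth xs)))"

text \<open>Truth is coded by \<open>0\<close> because that is the value \<open>Minimise\<close>
  searches for.\<close>

definition decidable :: "nat \<Rightarrow> ((nat \<Rightarrow> nat) \<Rightarrow> bool) \<Rightarrow> bool" where
  "decidable n P \<longleftrightarrow> computable n (\<lambda>v. if P v then 0 else 1)"

text \<open>Arguments form a valuation \<open>v\<close> instead of a list, so that closure rules
  follow the syntax of a term; a bound variable (summation index, search variable) becomes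
  \<open>v 0\<close> and shifts the parameters by \<open>Suc\<close>.\<close>

named_theorems computable_intros

section \<open>Closure under recursion, search and composition\<close>

lemma computable_var [computable_intros]: "i < n \<Longrightarrow> computable n (\<lambda>v. v i)"
  unfolding computable_def by (rule exI[of _ "Proj i"]) (auto intro: evaluates.Proj)

lemma computable_zero: "computable n (\<lambda>v. 0)"
  unfolding computable_def by (rule exI[of _ "Zero"]) (auto intro: evaluates.Zero)

lemma computable_Suc [computable_intros]:
  assumes "computable n F" shows "computable n (\<lambda>v. Suc (F v))"
proof -
  obtain e where "\<forall>xs. length xs = n \<longrightarrow> evaluates e xs (F (nth xs))"
    using assms by (auto simp: computable_def)
  then have "\<forall>xs. length xs = n \<longrightarrow> evaluates (Comp Succ [e]) xs (Suc (F (nth xs)))"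
    by (auto intro!: evaluates.Comp[where ys = "[F (nth _)]"] evaluates.Succ)
  then show ?thesis unfolding computable_def by blast
qed

lemma computable_const [computable_intros]: "computable n (\<lambda>v. c)"
  by (induction c) (simp_all add: computable_zero computable_Suc)

lemma computable_rec_nat [computable_intros]:
  assumes "computable n A" "computable (Suc (Suc n)) (\<lambda>v. G (v 0) (v 1) (\<lambda>i. v (Suc (Suc i))))"
    and "computable n N"
  shows "computable n (\<lambda>v. rec_nat (A v) (\<lambda>i y. G i y v) (N v))"
proof -
  obtain a where a: "\<And>xs. length xs = n \<Longrightarrow> evaluates a xs (A (nth xs))"
    using assms(1) by (auto simp: computable_def)
  obtain g where g: "\<And>i y xs. length xs = n \<Longrightarrow> evaluates g (i # y # xs) (G i y (nth xs))"
  proof -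
    obtain g where "\<And>xs. length xs = Suc (Suc n) \<Longrightarrow>
        evaluates g xs (G (xs ! 0) (xs ! 1) (\<lambda>i. xs ! Suc (Suc i)))"
      using assms(2) by (auto simp: computable_def)
    from this[of "_ # _ # _"] show ?thesis by (intro that) simp
  qed
  obtain k where k: "\<And>xs. length xs = n \<Longrightarrow> evaluates k xs (N (nth xs))"
    using assms(3) by (auto simp: computable_def)
  have rec: "evaluates (PrimRec a g) (m # xs) (rec_nat (A (nth xs)) (\<lambda>i y. G i y (nth xs)) m)"
    if "length xs = n" for m xs
    by (induction m) (auto intro: evaluates.PrimRec_0 evaluates.PrimRec_Suc a g that)
  \<comment> \<open>\<open>PrimRec\<close> recurses on the first component, so the bound is computed
    there and the parameters are copied behind it by projections.\<close>
  have "evaluates (Comp (PrimRec a g) (k # map Proj [0..<n])) xs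
          (rec_nat (A (nth xs)) (\<lambda>i y. G i y (nth xs)) (N (nth xs)))" if "length xs = n" for xs
  proof (rule evaluates.Comp[where ys = "N (nth xs) # xs"])
    show "\<forall>i<length (k # map Proj [0..<n]).
            evaluates ((k # map Proj [0..<n]) ! i) xs ((N (nth xs) # xs) ! i)"
      using that k by (auto simp: nth_Cons split: nat.split intro: evaluates.Proj)
  qed (use that rec in auto)
  then show ?thesis unfolding computable_def by blast
qed

text \<open>Existence is demanded for every valuation because the program must be total; where a
  search could fail, the caller adds a disjunct that stops it.\<close>

lemma computable_Least [computable_intros]:
  assumes "decidable (Suc n) (\<lambda>v. P (v 0) (\<lambda>i. v (Suc i)))" "\<And>v. \<exists>k. P k v"
  shows "computable n (\<lambda>v. LEAST k. P k v)"
proof -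
  obtain e where e: "\<And>k xs. length xs = n \<Longrightarrow> evaluates e (k # xs) (if P k (nth xs) then 0 else 1)"
  proof -
    obtain e where "\<And>xs. length xs = Suc n \<Longrightarrow>
        evaluates e xs (if P (xs ! 0) (\<lambda>i. xs ! Suc i) then 0 else 1)"
      using assms(1) by (auto simp: decidable_def computable_def)
    from this[of "_ # _"] show ?thesis by (intro that[of e]) (simp del: if_split)
  qed
  have "evaluates (Minimise e) xs (LEAST k. P k (nth xs))" if len: "length xs = n" for xs
  proof (rule evaluates.Minimise)
    show "evaluates e ((LEAST k. P k (nth xs)) # xs) 0"
      using e[OF len, of "LEAST k. P k (nth xs)"] LeastI_ex[OF assms(2)[of "nth xs"]] by simp
    show "\<forall>i<(LEAST k. P k (nth xs)). \<exists>y. evaluates e (i # xs) (Suc y)"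
    proof (intro allI impI)
      fix i assume "i < (LEAST k. P k (nth xs))"
      then have "\<not> P i (nth xs)" by (rule not_less_Least)
      with e[OF len, of i] show "\<exists>y. evaluates e (i # xs) (Suc y)" by auto
    qed
  qed
  then show ?thesis unfolding computable_def by blast
qed

lemma computable_compose1:
  assumes "computable 1 (\<lambda>v. f (v 0))" "computable n F"
  shows "computable n (\<lambda>v. f (F v))"
proof -
  obtain e where e: "\<And>xs. length xs = 1 \<Longrightarrow> evaluates e xs (f (xs ! 0))"
    using assms(1) by (auto simp: computable_def)
  obtain g where g: "\<And>xs. length xs = n \<Longrightarrow> evaluates g xs (F (nth xs))"
    using assms(2) by (auto simp: computable_def)
  have "evaluates (Comp e [g]) xs (f (F (nth xs)))" if "length xs = n" for xs
    by (rule evaluates.Comp[where ys = "[F (nth xs)]"]) (use e[of "[_]"] g that in auto)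
  then show ?thesis unfolding computable_def by blast
qed

lemma computable_compose2:
  assumes "computable 2 (\<lambda>v. f (v 0) (v 1))" "computable n F" "computable n G"
  shows "computable n (\<lambda>v. f (F v) (G v))"
proof -
  obtain e where e: "\<And>xs. length xs = 2 \<Longrightarrow> evaluates e xs (f (xs ! 0) (xs ! 1))"
    using assms(1) by (auto simp: computable_def)
  obtain g where g: "\<And>xs. length xs = n \<Longrightarrow> evaluates g xs (F (nth xs))"
    using assms(2) by (auto simp: computable_def)
  obtain h where h: "\<And>xs. length xs = n \<Longrightarrow> evaluates h xs (G (nth xs))"
    using assms(3) by (auto simp: computable_def)
  have "evaluates (Comp e [g, h]) xs (f (F (nth xs)) (G (nth xs)))" if "length xs = n" for xs
    by (rule evaluates.Comp[where ys = "[F (nth xs), G (nth xs)]"])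
      (use e[of "[_, _]"] g h that in \<open>auto simp: less_Suc_eq\<close>)
  then show ?thesis unfolding computable_def by blast
qed

lemma decidable_compose2:
  assumes "decidable 2 (\<lambda>v. P (v 0) (v 1))" "computable n F" "computable n G"
  shows "decidable n (\<lambda>v. P (F v) (G v))"
  using computable_compose2[of "\<lambda>x y. if P x y then 0 else 1"] assms by (simp add: decidable_def)

text \<open>A recursion step receives the accumulated value at position \<open>1\<close>; this lets
  a summand that knows only the index and the parameters be used there.\<close>

lemma computable_skip:
  assumes "computable (Suc n) (\<lambda>v. F (v 0) (\<lambda>i. v (Suc i)))"
  shows "computable (Suc (Suc n)) (\<lambda>v. F (v 0) (\<lambda>i. v (Suc (Suc i))))"
proof -
  obtain e where e: "\<And>xs. length xs = Suc n \<Longrightarrow> evaluates e xs (F (xs ! 0) (\<lambda>i. xs ! Suc i))"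
    using assms by (auto simp: computable_def)
  have "evaluates (Comp e (Proj 0 # map Proj [2..<n + 2])) xs (F (xs ! 0) (\<lambda>i. xs ! Suc (Suc i)))"
    if len2: "length xs = Suc (Suc n)" for xs
  proof -
    obtain a b ys where xs: "xs = a # b # ys" and len: "length ys = n"
      using len2 by (cases xs; cases "tl xs") auto
    have "evaluates ((Proj 0 # map Proj [2..<n + 2]) ! i) xs ((a # ys) ! i)" if "i < Suc n" for i
      using that evaluates.Proj[of i xs] evaluates.Proj[of "Suc i" xs]
      by (cases i) (auto simp: xs len simp del: upt_Suc intro: evaluates.Proj)
    then show ?thesis
      using e[of "a # ys"] len by (intro evaluates.Comp[where ys = "a # ys"]) (auto simp: xs simp del: upt_Suc)
  qed
  then show ?thesis unfolding computable_def by blast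
qed

section \<open>Arithmetic operations and decidable predicates\<close>

lemma computable_add [computable_intros]:
  assumes "computable n F" "computable n G" shows "computable n (\<lambda>v. F v + G v)"
proof -
  have "rec_nat a (\<lambda>_ y. Suc y) b = a + b" for a b by (induction b) auto
  moreover have "computable n (\<lambda>v. rec_nat (F v) (\<lambda>_ y. Suc y) (G v))"
    by (intro computable_intros assms) simp
  ultimately show ?thesis by simp
qed

lemma computable_mult [computable_intros]:
  assumes "computable n F" "computable n G" shows "computable n (\<lambda>v. F v * G v)"
proof (rule computable_compose2[OF _ assms])
  have "rec_nat 0 (\<lambda>_ y. y + a) b = a * b" for a b :: nat by (induction b) auto
  moreover have "computable 2 (\<lambda>v. rec_nat 0 (\<lambda>_ y. y + v 0) (v 1))"
    by (intro computable_intros) auto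
  ultimately show "computable 2 (\<lambda>v. v 0 * v 1)" by simp
qed

lemma computable_diff [computable_intros]:
  assumes "computable n F" "computable n G" shows "computable n (\<lambda>v. F v - G v)"
proof (rule computable_compose2[OF _ assms])
  have pred: "computable 1 (\<lambda>v. v 0 - Suc 0)"
  proof -
    \<comment> \<open>The predecessor is the recursion whose step returns its counter; subtraction
      iterates it.\<close>
    have "rec_nat 0 (\<lambda>i _. i) b = b - Suc 0" for b by (induction b) auto
    moreover have "computable 1 (\<lambda>v. rec_nat 0 (\<lambda>i _. i) (v 0))"
      by (intro computable_intros) auto
    ultimately show ?thesis by simp
  qed
  have "rec_nat a (\<lambda>_ y. y - Suc 0) b = a - b" for a b by (induction b) auto
  moreover have "computable 2 (\<lambda>v. rec_nat (v 0) (\<lambda>_ y. y - Suc 0) (v 1))"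
    by (intro computable_intros computable_compose1[OF pred]) auto
  ultimately show "computable 2 (\<lambda>v. v 0 - v 1)" by simp
qed

lemma computable_power [computable_intros]:
  assumes "computable n F" "computable n G" shows "computable n (\<lambda>v. F v ^ G v)"
proof (rule computable_compose2[OF _ assms])
  have "rec_nat 1 (\<lambda>_ y. y * a) b = a ^ b" for a b :: nat by (induction b) auto
  moreover have "computable 2 (\<lambda>v. rec_nat 1 (\<lambda>_ y. y * v 0) (v 1))"
    by (intro computable_intros) auto
  ultimately show "computable 2 (\<lambda>v. v 0 ^ v 1)" by simp
qed

lemma computable_sum [computable_intros]:
  assumes "computable (Suc n) (\<lambda>v. F (v 0) (\<lambda>i. v (Suc i)))" "computable n N"
  shows "computable n (\<lambda>v. \<Sum>i<N v. F i v)"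
proof -
  have "rec_nat 0 (\<lambda>i y. y + f i) b = (\<Sum>i<b. f i)" for f :: "nat \<Rightarrow> nat" and b
    by (induction b) auto
  moreover have "computable n (\<lambda>v. rec_nat 0 (\<lambda>i y. y + F i v) (N v))"
    by (intro computable_intros computable_skip assms) auto
  ultimately show ?thesis by simp
qed

lemma decidable_le [computable_intros]:
  assumes "computable n F" "computable n G" shows "decidable n (\<lambda>v. F v \<le> G v)"
proof -
  have "computable n (\<lambda>v. 1 - (1 - (F v - G v)))" by (intro computable_intros assms)
  moreover have "1 - (1 - (x - y)) = (if x \<le> y then 0 else 1)" for x y :: nat by auto
  ultimately show ?thesis unfolding decidable_def by simp
qed

lemma decidable_less [computable_intros]:
  assumes "computable n F" "computable n G" shows "decidable n (\<lambda>v. F v < G v)"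
  using decidable_le[OF computable_Suc[OF assms(1)] assms(2)] by (simp add: Suc_le_eq)

lemma computable_if [computable_intros]:
  assumes "decidable n P" "computable n F" "computable n G"
  shows "computable n (\<lambda>v. if P v then F v else G v)"
proof -
  have "computable n (\<lambda>v. (1 - (if P v then 0 else 1)) * F v + (if P v then 0 else 1) * G v)"
    using assms(1) unfolding decidable_def by (intro computable_intros assms)
  moreover have "(1 - (if p then 0 else 1)) * x + (if p then 0 else 1) * y = (if p then x else y)"
    for p and x y :: nat by auto
  ultimately show ?thesis by simp
qed

lemma decidable_not [computable_intros]:
  assumes "decidable n P" shows "decidable n (\<lambda>v. \<not> P v)"
proof -
  have "computable n (\<lambda>v. if P v then 1 else 0)" by (intro computable_intros assms)
  moreover have "(if p then 1 else 0) = (if \<not> p then 0 else 1 :: nat)" for p by simp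
  ultimately show ?thesis unfolding decidable_def by (simp only:)
qed

lemma decidable_conj [computable_intros]:
  assumes "decidable n P" "decidable n Q" shows "decidable n (\<lambda>v. P v \<and> Q v)"
proof -
  have "computable n (\<lambda>v. if P v then (if Q v then 0 else 1) else 1)"
    by (intro computable_intros assms)
  moreover have "(if p then (if q then 0 else 1) else 1) = (if p \<and> q then 0 else 1 :: nat)" for p q
    by auto
  ultimately show ?thesis unfolding decidable_def by simp
qed

lemma decidable_disj [computable_intros]:
  assumes "decidable n P" "decidable n Q" shows "decidable n (\<lambda>v. P v \<or> Q v)"
  using decidable_not[OF decidable_conj[OF assms[THEN decidable_not]]] by simp

lemma decidable_eq [computable_intros]:
  assumes "computable n F" "computable n G" shows "decidable n (\<lambda>v. F v = G v)"
proof -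
  have "(\<lambda>v. F v = G v) = (\<lambda>v. F v \<le> G v \<and> G v \<le> F v)" by auto
  then show ?thesis using decidable_conj[OF decidable_le[OF assms] decidable_le[OF assms(2,1)]] by simp
qed

lemma decidable_bex [computable_intros]:
  assumes "decidable (Suc n) (\<lambda>v. P (v 0) (\<lambda>i. v (Suc i)))" "computable n N"
  shows "decidable n (\<lambda>v. \<exists>i<N v. P i v)"
proof -
  have "decidable n (\<lambda>v. 0 < (\<Sum>i<N v. if P i v then 1 else 0 :: nat))"
    by (intro computable_intros assms)
  moreover have "0 < (\<Sum>i<b. if p i then 1 else 0 :: nat) \<longleftrightarrow> (\<exists>i<b. p i)" for p and b :: nat
    by (auto simp flip: neq0_conv)
  ultimately show ?thesis by simp
qed

lemma computable_div [computable_intros]: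
  assumes "computable n F" "computable n G" shows "computable n (\<lambda>v. F v div G v)"
proof (rule computable_compose2[OF _ assms])
  \<comment> \<open>The quotient counts the positive multiples of \<open>v 1\<close> up to
    \<open>v 0\<close>; the case \<open>v 1 = 0\<close> reproduces HOL's division by zero.\<close>
  have "computable 2 (\<lambda>v. if v 1 = 0 then 0 else \<Sum>k<v 0. if Suc k * v 1 \<le> v 0 then 1 else 0)"
    by (intro computable_intros) auto
  moreover have "(if b = 0 then 0 else \<Sum>k<a. if Suc k * b \<le> a then 1 else 0) = a div b" for a b :: nat
  proof (cases "b = 0")
    case False
    then have "Suc k * b \<le> a \<longleftrightarrow> k < a div b" for k
      using less_eq_div_iff_mult_less_eq[of b "Suc k" a] by (simp add: Suc_le_eq)
    moreover have "{k. k < a \<and> k < a div b} = {..<a div b}"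
      using div_le_dividend[of a b] by (auto simp del: div_le_dividend)
    ultimately show ?thesis using False by (simp add: sum.If_cases Int_def del: mult_Suc)
  qed simp
  ultimately show "computable 2 (\<lambda>v. v 0 div v 1)" by (simp only:)
qed

lemma computable_mod [computable_intros]:
  assumes "computable n F" "computable n G" shows "computable n (\<lambda>v. F v mod G v)"
  using computable_diff[OF assms(1) computable_mult[OF computable_div[OF assms] assms(2)]]
  by (simp add: minus_div_mult_eq_mod)

section \<open>Effective avoidance of dyadic tests\<close>

lemma sum_lessThan_double:
  "(\<Sum>k<2 * m. f k) = (\<Sum>k<m. f k) + (\<Sum>k<m. f (m + k))" for f :: "nat \<Rightarrow> 'a::comm_monoid_add"
proof -
  have "(\<Sum>k<2 * m. f k) = sum f ({0..<m} \<union> {m..<m + m})"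
    by (rule arg_cong[where f = "sum f"]) auto
  also have "\<dots> = sum f {0..<m} + sum f {m..<m + m}"
    by (rule sum.union_disjoint) auto
  also have "sum f {m..<m + m} = (\<Sum>k<m. f (m + k))"
    using sum.shift_bounds_nat_ivl[of f 0 m m] by (simp add: lessThan_atLeast0 add.commute)
  finally show ?thesis by (simp add: lessThan_atLeast0)
qed

text \<open>
  A test \<open>s\<close> marks dyadic cells of level \<open>e s\<close>.  If the marked proportions are summable with
  weights \<open>2 ^ s\<close>, then always descending into the half in which the tests seen so far mark the
  smaller proportion keeps the total marked proportion below \<open>1\<close>.
\<close>
locale dyadic_tests =
  fixes e :: "nat \<Rightarrow> nat" and fl :: "nat \<Rightarrow> nat \<Rightarrow> bool"
  assumes e_comp: "computable 1 (\<lambda>v. e (v 0))"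
    and fl_dec: "decidable 2 (\<lambda>v. fl (v 0) (v 1))"
    and small: "\<And>s. real (card {i. i < 2 ^ e s \<and> fl s i}) \<le> 2 ^ e s / 8 ^ Suc s"
begin

text \<open>Truncated subtraction joins two cases. For \<open>l < e s\<close> the marked subcells of
  cell \<open>i\<close> of level \<open>l\<close> are counted; for \<open>l \<ge> e s\<close> there
  is a single summand, the ancestor of \<open>i\<close> at level \<open>e s\<close>.\<close>

definition marked :: "nat \<Rightarrow> nat \<Rightarrow> nat \<Rightarrow> nat" where
  "marked s l i = (\<Sum>k<2 ^ (e s - l). if fl s (i * 2 ^ (e s - l) div 2 ^ (l - e s) + k) then 1 else 0)"

definition proportion :: "nat \<Rightarrow> nat \<Rightarrow> nat \<Rightarrow> real" where
  "proportion s l i = real (marked s l i) / 2 ^ (e s - l)"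

text \<open>The total of the proportions cleared of its denominators, so that the two halves are
  compared within the natural numbers.\<close>

definition weight :: "nat \<Rightarrow> nat \<Rightarrow> nat" where
  "weight t i = (\<Sum>s<Suc t. marked s (Suc t) i * 2 ^ ((\<Sum>r<Suc t. e r) - (e s - Suc t)))"

definition walk :: "nat \<Rightarrow> nat" where
  "walk = rec_nat 0 (\<lambda>t y. 2 * y + (if weight t (2 * y + 1) < weight t (2 * y) then 1 else 0))"

lemma walk_0 [simp]: "walk 0 = 0"
  by (simp add: walk_def)

lemma walk_Suc: "walk (Suc t) =
    2 * walk t + (if weight t (2 * walk t + 1) < weight t (2 * walk t) then 1 else 0)"
  by (simp add: walk_def)

lemma walk_computable: "computable 1 (\<lambda>v. walk (v 0))"
  unfolding walk_def weight_def marked_def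
  by (intro computable_intros computable_compose1[OF e_comp] decidable_compose2[OF fl_dec]) auto

text \<open>The martingale property. From level \<open>e s\<close> on both halves inherit the value
  of the same ancestor; before that the marked subcells split between the halves.\<close>

lemma proportion_halves: "proportion s l i = (proportion s (Suc l) (2 * i) + proportion s (Suc l) (2 * i + 1)) / 2"
proof (cases "e s \<le> l")
  case True
  have "(2 * i) div 2 ^ (Suc l - e s) = i div 2 ^ (l - e s)"
       "(2 * i + 1) div 2 ^ (Suc l - e s) = i div 2 ^ (l - e s)"
    using True by (simp_all add: Suc_diff_le div_mult2_eq)
  with True show ?thesis by (simp add: proportion_def marked_def)
next
  case False
  then obtain r where r: "e s - l = Suc r" "e s - Suc l = r" "l - e s = 0" "Suc l - e s = 0"
    by (metis Suc_diff_Suc Suc_leI diff_is_0_eq' nat_le_linear not_le)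
  show ?thesis
    using sum_lessThan_double[of "\<lambda>k. if fl s (i * 2 ^ Suc r + k) then 1 else 0 :: nat" "2 ^ r"]
    by (simp add: proportion_def marked_def r add_divide_distrib algebra_simps)
qed

lemma proportion_nonneg: "0 \<le> proportion s l i"
  by (simp add: proportion_def)

text \<open>Halving at most doubles a proportion, as the other half contributes nonnegatively. This
  bounds the cost of a test at the moment it enters the bisection.\<close>

lemma proportion_le: "proportion s l i \<le> 2 ^ l * proportion s 0 0" if "i < 2 ^ l"
  using that
proof (induction l arbitrary: i)
  case (Suc l)
  have "proportion s (Suc l) i \<le> 2 * proportion s l (i div 2)"
    using proportion_halves[of s l "i div 2"] proportion_nonneg[of s "Suc l" "2 * (i div 2)"]
      proportion_nonneg[of s "Suc l" "2 * (i div 2) + 1"]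
    by (cases "even i") auto
  also have "\<dots> \<le> 2 * (2 ^ l * proportion s 0 0)"
    using Suc.IH[of "i div 2"] Suc.prems by simp
  finally show ?case by simp
qed simp

lemma proportion_0: "proportion s 0 0 \<le> 1 / 8 ^ Suc s"
proof -
  have "marked s 0 0 = card {i. i < 2 ^ e s \<and> fl s i}"
    by (simp add: marked_def sum.If_cases Int_def)
  with small[of s] show ?thesis by (simp add: proportion_def field_simps)
qed

lemma walk_less: "walk t < 2 ^ t"
  by (induction t) (auto simp: walk_Suc)

lemma weight_eq: "real (weight t i) = 2 ^ (\<Sum>r<Suc t. e r) * (\<Sum>s<Suc t. proportion s (Suc t) i)"
proof -
  have "e s - Suc t \<le> (\<Sum>r<Suc t. e r)" if "s < Suc t" for s
    using member_le_sum[of s "{..<Suc t}" e] that by simp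
  then show ?thesis
    unfolding weight_def proportion_def of_nat_sum sum_distrib_left
    by (intro sum.cong) (auto simp: power_diff[of "2::real"] of_nat_power simp del: sum.lessThan_Suc)
qed

text \<open>The chosen half has the smaller total, hence at most the average of the two, which is
  the total of the parent.\<close>

lemma proportion_walk_step:
  "(\<Sum>s<Suc t. proportion s (Suc t) (walk (Suc t))) \<le> (\<Sum>s<Suc t. proportion s t (walk t))"
proof -
  let ?d = "\<lambda>i. \<Sum>s<Suc t. proportion s (Suc t) i"
  have "weight t i < weight t j \<longleftrightarrow> ?d i < ?d j" for i j
  proof -
    have "weight t i < weight t j \<longleftrightarrow> real (weight t i) < real (weight t j)" by simp
    also have "\<dots> \<longleftrightarrow> ?d i < ?d j" unfolding weight_eq by (rule mult_less_cancel_left_pos) simp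
    finally show ?thesis .
  qed
  then have "?d (walk (Suc t)) \<le> ?d (2 * walk t)" "?d (walk (Suc t)) \<le> ?d (2 * walk t + 1)"
    by (simp_all only: walk_Suc split: if_split) auto
  moreover have "a \<le> (x + y) / 2" if "a \<le> x" "a \<le> y" for a x y :: real using that by simp
  ultimately have "?d (walk (Suc t)) \<le> (?d (2 * walk t) + ?d (2 * walk t + 1)) / 2" by blast
  also have "\<dots> = (\<Sum>s<Suc t. proportion s t (walk t))"
    unfolding proportion_halves[of _ t "walk t"] by (simp only: sum.distrib add_divide_distrib sum_divide_distrib)
  finally show ?thesis .
qed

text \<open>Test \<open>t\<close> enters at level \<open>t\<close>, where a single cell may hold all
  that it marks. The factor \<open>2 ^ t\<close> lost there is the reason for the base
  \<open>8\<close> in \<open>small\<close>: \<open>2 ^ t / 8 ^ Suc t\<close> is still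
  summable.\<close>

lemma proportion_walk: "(\<Sum>s<t. proportion s t (walk t)) \<le> (\<Sum>s<t. 1 / 4 ^ Suc s)"
proof (induction t)
  case (Suc t)
  have "proportion t t (walk t) \<le> 2 ^ t * (1 / 8 ^ Suc t)"
    using proportion_le[OF walk_less, of t t] mult_left_mono[OF proportion_0[of t], of "2 ^ t"] by simp
  also have "\<dots> \<le> 1 / 4 ^ Suc t"
    using power_mult_distrib[of "2::real" 4 t] by (simp add: field_simps)
  finally show ?case using proportion_walk_step[of t] Suc by simp
qed simp

text \<open>A walk cell inside a cell marked by \<open>s\<close> would have proportion
  \<open>1\<close> for \<open>s\<close> alone, while the total stays below
  \<open>1 / 3\<close>.\<close>

lemma walk_avoids:
  assumes "e s \<le> t" "s < t" shows "\<not> fl s (walk t div 2 ^ (t - e s))"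
proof
  assume "fl s (walk t div 2 ^ (t - e s))"
  then have "proportion s t (walk t) = 1"
    using assms by (simp add: proportion_def marked_def)
  moreover have "proportion s t (walk t) \<le> (\<Sum>s<t. proportion s t (walk t))"
    using assms by (intro member_le_sum) (auto simp: proportion_nonneg)
  moreover have "(\<Sum>s<t. 1 / 4 ^ Suc s) = (1 - 1 / 4 ^ t) / (3 :: real)"
  proof (induction t)
    case (Suc t)
    show ?case unfolding sum.lessThan_Suc Suc.IH by (simp add: field_simps)
  qed simp
  moreover have "(1 - 1 / 4 ^ t) / (3 :: real) < 1"
    using zero_le_divide_1_iff[of "4 ^ t :: real"] by (simp add: diff_less_eq add_pos_nonneg)
  ultimately show False using proportion_walk[of t] by simp
qed

section \<open>The limit point and its expansions\<close>

definition point :: real where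
  "point = (SUP t. real (walk t) / 2 ^ t)"

lemma point_bounds: "real (walk t) / 2 ^ t \<le> point" "point \<le> (real (walk t) + 1) / 2 ^ t"
proof -
  have step: "real (walk t) / 2 ^ t \<le> real (walk (t + k)) / 2 ^ (t + k)" for t k
  proof (induction k)
    case (Suc k)
    have "real (walk (t + k)) / 2 ^ (t + k) \<le> real (walk (Suc (t + k))) / 2 ^ Suc (t + k)"
      by (simp add: walk_Suc divide_simps)
    with Suc show ?case by simp
  qed simp
  have step': "(real (walk (t + k)) + 1) / 2 ^ (t + k) \<le> (real (walk t) + 1) / 2 ^ t" for t k
  proof (induction k)
    case (Suc k)
    have "(real (walk (Suc (t + k))) + 1) / 2 ^ Suc (t + k) \<le> (real (walk (t + k)) + 1) / 2 ^ (t + k)"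
      by (simp add: walk_Suc divide_simps)
    with Suc show ?case by simp
  qed simp
  have upper: "real (walk u) / 2 ^ u \<le> (real (walk t) + 1) / 2 ^ t" for u
  proof -
    have "real (walk u) / 2 ^ u \<le> real (walk (u + t)) / 2 ^ (u + t)" by (rule step)
    also have "\<dots> \<le> (real (walk (t + u)) + 1) / 2 ^ (t + u)"
      by (simp add: add.commute divide_right_mono)
    also have "\<dots> \<le> (real (walk t) + 1) / 2 ^ t" by (rule step')
    finally show ?thesis .
  qed
  then have bdd: "bdd_above (range (\<lambda>u. real (walk u) / 2 ^ u))" by (auto intro!: bdd_aboveI)
  show "real (walk t) / 2 ^ t \<le> point" unfolding point_def by (intro cSUP_upper bdd) simp
  show "point \<le> (real (walk t) + 1) / 2 ^ t" unfolding point_def by (intro cSUP_least upper) simp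
qed

lemma point_in_unit: "point \<in> {0..1}"
  using point_bounds[of 0] by simp

text \<open>The cell comes from the walk and not from a floor: \<open>point\<close> may be a common
  endpoint of two dyadic cells, and only the one that the walk passes through is known to be
  unmarked.\<close>

lemma point_avoids:
  obtains i where "\<not> fl s i" "real i / 2 ^ e s \<le> point" "point \<le> (real i + 1) / 2 ^ e s"
proof -
  define t where "t = Suc (max (e s) s)"
  have t: "e s \<le> t" "s < t" by (auto simp: t_def)
  let ?i = "walk t div 2 ^ (t - e s)"
  have pow: "(2::real) ^ t = 2 ^ (t - e s) * 2 ^ e s"
    using t by (simp flip: power_add)
  have "?i * 2 ^ (t - e s) \<le> walk t" by (rule div_times_less_eq_dividend)
  from of_nat_mono[OF this, where 'a = real]
  have "real ?i * 2 ^ (t - e s) \<le> real (walk t)" by simp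
  then have "real ?i / 2 ^ e s \<le> real (walk t) / 2 ^ t"
    by (simp add: pow field_simps)
  moreover have "walk t + 1 \<le> (?i + 1) * 2 ^ (t - e s)"
    using dividend_less_div_times[of "2 ^ (t - e s)" "walk t"] by simp
  from of_nat_mono[OF this, where 'a = real]
  have "real (walk t) + 1 \<le> (real ?i + 1) * 2 ^ (t - e s)" by (simp add: algebra_simps)
  from divide_right_mono[OF this, of "2 ^ t"]
  have "(real (walk t) + 1) / 2 ^ t \<le> (real ?i + 1) / 2 ^ e s" by (simp add: pow)
  ultimately show thesis
    using that[of ?i] walk_avoids[OF t] point_bounds[of t] by linarith
qed

lemma point_computable: "computable_real point"
  unfolding computable_real_def
proof (intro exI conjI allI)
  have comp_fun: "computable_fun f" if comp: "computable 1 (\<lambda>v. f (v 0))" for f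
  proof -
    obtain p where "\<And>xs. length xs = 1 \<Longrightarrow> evaluates p xs (f (xs ! 0))"
      using comp by (auto simp: computable_def)
    from this[of "[_]"] show ?thesis by (auto simp: computable_fun_def)
  qed
  \<comment> \<open>\<open>computable_real\<close> adds \<open>1\<close> to the denominator, hence
    \<open>2 ^ n - 1\<close>.\<close>
  show "computable_fun walk" "computable_fun (\<lambda>_. 0)" "computable_fun (\<lambda>n. 2 ^ n - 1)"
    by (intro comp_fun walk_computable computable_intros; simp)+
  show "\<bar>point - (real (walk n) - real 0) / (real (2 ^ n - 1) + 1)\<bar> \<le> 1 / 2 ^ n" for n
  proof -
    have "real (2 ^ n - 1) + 1 = 2 ^ n" by (simp add: of_nat_diff)
    then show ?thesis using point_bounds[of n] by (auto simp: add_divide_distrib)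
  qed
qed

text \<open>The search for a sufficient precision stops because the number is not \<open>b\<close>-adic rational.\<close>
lemma point_expansions_computable:
  assumes irrational: "point \<notin> \<rat>"
  shows "\<exists>p. computes_all_expansions p point"
proof -
  \<comment> \<open>Both ends of the level-\<open>t\<close> cell have the same integer part after
    scaling by \<open>b ^ k\<close>, so \<open>point\<close> has it too.\<close>
  define fits where "fits t b k \<longleftrightarrow> walk t * b ^ k div 2 ^ t = (walk t + 1) * b ^ k div 2 ^ t" for t b k
  have floor_eq: "\<lfloor>real (a * b ^ k) / 2 ^ t\<rfloor> = int (a * b ^ k div 2 ^ t)" for a b k t
    using floor_divide_of_nat_eq[of "a * b ^ k" "2 ^ t", where 'a = real] by simp
  \<comment> \<open>The disjunct \<open>b < 2\<close> makes the search end for every argument, as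
    \<open>computable_Least\<close> demands.\<close>
  have fits_ex: "\<exists>t. b < 2 \<or> fits t b k" for b k
  proof (cases "b < 2")
    case False
    define y where "y = point * real b ^ k"
    have notint: "y \<noteq> of_int z" for z
    proof
      assume "y = of_int z"
      then have "point = of_int z / of_nat (b ^ k)" using False by (simp add: y_def field_simps)
      then show False using irrational by (metis Rats_divide Rats_of_int Rats_of_nat)
    qed
    \<comment> \<open>Once the scaled cell is shorter than the distance from \<open>y\<close> to the
      nearest integer, both of its ends have the integer part of \<open>y\<close>.\<close>
    define \<epsilon> where "\<epsilon> = min (y - of_int \<lfloor>y\<rfloor>) (of_int \<lfloor>y\<rfloor> + 1 - y)"
    have "of_int \<lfloor>y\<rfloor> < y" using notint[of "\<lfloor>y\<rfloor>"] of_int_floor_le[of y] by linarith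
    then have "\<epsilon> > 0" by (simp add: \<epsilon>_def)
    then obtain t where t: "(1 / 2) ^ t < \<epsilon> / real b ^ k"
      using real_arch_pow_inv[of "\<epsilon> / real b ^ k" "1 / 2"] False by auto
    have lo: "real (walk t * b ^ k) / 2 ^ t \<le> y" and up: "y \<le> real ((walk t + 1) * b ^ k) / 2 ^ t"
      using point_bounds[of t, THEN mult_right_mono, of "real b ^ k"] by (auto simp: y_def algebra_simps)
    have gap: "real ((walk t + 1) * b ^ k) / 2 ^ t = real (walk t * b ^ k) / 2 ^ t + (1 / 2) ^ t * real b ^ k"
      by (simp add: field_simps power_divide)
    have "(1 / 2) ^ t * real b ^ k < \<epsilon>" using t False by (simp add: field_simps)
    then have "\<lfloor>real (walk t * b ^ k) / 2 ^ t\<rfloor> = \<lfloor>y\<rfloor>" "\<lfloor>real ((walk t + 1) * b ^ k) / 2 ^ t\<rfloor> = \<lfloor>y\<rfloor>"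
      using lo up gap unfolding \<epsilon>_def by (intro floor_unique; linarith)+
    then have "fits t b k" unfolding fits_def floor_eq by simp
    then show ?thesis by blast
  qed auto
  define f where "f b k = walk (LEAST t. b < 2 \<or> fits t b k) * b ^ k div 2 ^ (LEAST t. b < 2 \<or> fits t b k) mod b"
    for b k
  have "computable 2 (\<lambda>v. f (v 0) (v 1))"
    unfolding f_def fits_def
    by (intro computable_intros computable_compose1[OF walk_computable] fits_ex[unfolded fits_def]) auto
  then obtain p where p: "\<And>xs. length xs = 2 \<Longrightarrow> evaluates p xs (f (xs ! 0) (xs ! 1))"
    by (auto simp: computable_def)
  have "f b k = digit b point k" if "b \<ge> 2" for b k
  proof -
    define t where "t = (LEAST t. b < 2 \<or> fits t b k)"
    have fits: "fits t b k" using LeastI_ex[OF fits_ex[of b k]] that by (auto simp: t_def)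
    have lo: "real (walk t * b ^ k) / 2 ^ t \<le> point * real b ^ k"
      and up: "point * real b ^ k \<le> real ((walk t + 1) * b ^ k) / 2 ^ t"
      using point_bounds[of t, THEN mult_right_mono, of "real b ^ k"] by (auto simp: algebra_simps)
    have "\<lfloor>point * real b ^ k\<rfloor> = int (walk t * b ^ k div 2 ^ t)"
      using floor_mono[OF lo] floor_mono[OF up] fits unfolding fits_def floor_eq by linarith
    then show ?thesis using point_in_unit by (simp add: f_def digit_def t_def)
  qed
  moreover have "evaluates p [b, k] (f b k)" for b k using p[of "[b, k]"] by simp
  ultimately have "computes_all_expansions p point" by (metis computes_all_expansions_def)
  then show ?thesis ..
qed

end

section \<open>Digits and normality\<close>

lemma nat_floor_power_div:
  fixes a :: real assumes "a \<ge> 0" "b > 0"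
  shows "nat \<lfloor>a * real b ^ (q + s)\<rfloor> div b ^ s = nat \<lfloor>a * real b ^ q\<rfloor>"
proof -
  have "\<lfloor>a * real b ^ q\<rfloor> = \<lfloor>a * real b ^ (q + s) / real_of_int (int b ^ s)\<rfloor>"
    using assms by (simp add: power_add)
  also have "\<dots> = \<lfloor>a * real b ^ (q + s)\<rfloor> div int b ^ s"
    by (rule floor_divide_real_eq_div) simp
  finally show ?thesis using assms by (simp add: nat_div_distrib nat_power_eq)
qed

lemma digit_less: "b > 0 \<Longrightarrow> digit b x k < b"
  by (simp add: digit_def)

lemma digit_frac:
  assumes "y \<ge> 0" "b > 0" "k \<ge> 1" shows "digit b y k = digit b (frac y) k"
proof -
  define z where "z = nat \<lfloor>y\<rfloor>"
  have y: "y = real z + frac y" using assms by (simp add: z_def frac_def)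
  have "\<lfloor>y * real b ^ k\<rfloor> = \<lfloor>frac y * real b ^ k + real_of_int (int (z * b ^ k))\<rfloor>"
    by (subst y) (simp add: algebra_simps)
  also have "\<dots> = \<lfloor>frac y * real b ^ k\<rfloor> + int (z * b ^ k)" by (rule floor_add_int[symmetric])
  finally have "nat \<lfloor>y * real b ^ k\<rfloor> = nat \<lfloor>frac y * real b ^ k\<rfloor> + z * b ^ k"
    by (simp add: nat_add_distrib nat_mult_distrib nat_power_eq)
  moreover have "b dvd z * b ^ k" using assms by (simp add: dvd_mult dvd_power)
  ultimately show ?thesis using assms by (simp add: digit_def mod_add_right_eq dvd_imp_mod_0 flip: mod_add_eq)
qed

lemma digit_value_digits:
  assumes "0 \<le> f" "f < 1" "b > 0"
  shows "digit_value b n (digit b f) = real (nat \<lfloor>f * real b ^ n\<rfloor>) / real b ^ n"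
proof (induction n)
  case 0
  have "\<lfloor>f\<rfloor> = 0" using assms by (simp add: floor_eq_iff)
  then show ?case by (simp add: digit_value_def)
next
  case (Suc n)
  let ?N = "nat \<lfloor>f * real b ^ Suc n\<rfloor>"
  have "?N = b * nat \<lfloor>f * real b ^ n\<rfloor> + digit b f (Suc n)"
    using nat_floor_power_div[of f b n 1] assms
      mult_div_mod_eq[of b ?N] by (simp add: digit_def)
  then have "real ?N = real b * real (nat \<lfloor>f * real b ^ n\<rfloor>) + real (digit b f (Suc n))"
    by (metis of_nat_add of_nat_mult)
  moreover have "digit_value b (Suc n) (digit b f) = digit_value b n (digit b f) + real (digit b f (Suc n)) / real b ^ Suc n"
    by (simp add: digit_value_def)
  ultimately show ?case using Suc assms by (simp add: field_simps)
qed

definition balanced :: "nat \<Rightarrow> nat \<Rightarrow> nat \<Rightarrow> nat \<Rightarrow> real \<Rightarrow> bool" where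
  "balanced b m n d y \<longleftrightarrow>
     \<bar>real (card {j \<in> {1..n}. digit b y j = d}) / real n - 1 / real b\<bar> < 1 / real m"

text \<open>The whole enlarged interval is recorded, not just the point \<open>f\<close>, because
  the later grid tests locate a value only up to a neighbouring cell. Words of the cover are
  extensional functions, hence the \<open>restrict\<close>.\<close>

lemma unbalanced_cell_subset_U_cell:
  assumes "0 \<le> f" "f < 1" "b > 0" "\<not> balanced b m n d f"
  defines "v \<equiv> real (nat \<lfloor>f * real b ^ n\<rfloor>) / real b ^ n"
  shows "{v - 1 / real b ^ n <..< v + 2 / real b ^ n} \<subseteq> U_cell b m n d"
proof -
  let ?q = "restrict (digit b f) {1..n}"
  have cong: "{j \<in> {1..n}. ?q j = d} = {j \<in> {1..n}. digit b f j = d}" by auto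
  have "digit_value b n ?q = digit_value b n (digit b f)" by (simp add: digit_value_def)
  then have "digit_value b n ?q = v" using digit_value_digits assms by simp
  moreover have "?q \<in> {1..n} \<rightarrow>\<^sub>E {0..<b}" using assms(3) by (auto simp: digit_less)
  moreover have "\<bar>real (digit_count d n ?q) / real n - 1 / real b\<bar> \<ge> 1 / real m"
    using assms(4) unfolding balanced_def digit_count_def cong by simp
  ultimately show ?thesis unfolding U_cell_def by blast
qed

lemma unbalanced_in_U_cell:
  assumes "0 \<le> f" "f < 1" "b > 0" "\<not> balanced b m n d f"
  shows "f \<in> U_cell b m n d"
proof -
  let ?N = "nat \<lfloor>f * real b ^ n\<rfloor>"
  have "real ?N \<le> f * real b ^ n" "f * real b ^ n < real ?N + 1"
    using assms by (simp_all add: of_nat_nat)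
  then have "real ?N - 1 < f * real b ^ n" "f * real b ^ n < real ?N + 2" by linarith+
  then have "f \<in> {real ?N / real b ^ n - 1 / real b ^ n <..< real ?N / real b ^ n + 2 / real b ^ n}"
    using assms unfolding greaterThanLessThan_iff by (simp add: field_simps del: of_nat_nat)
  then show ?thesis using unbalanced_cell_subset_U_cell[OF assms] by blast
qed

text \<open>The translate by \<open>\<lfloor>y\<rfloor>\<close> is the relevant one, and
  \<open>\<epsilon>\<close> only decides from which length on balance is guaranteed.\<close>

lemma balanced_if_notin_U_plus:
  assumes "y \<notin> U_plus \<epsilon>" "b \<ge> 2" "m \<ge> 1" "d < b"
  shows "eventually (\<lambda>n. balanced b m n d (frac y)) sequentially"
proof -
  define \<delta> where "\<delta> = \<epsilon> / 2 ^ (nat \<bar>\<lfloor>y\<rfloor>\<bar> + 2)"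
  have notin: "frac y \<notin> U_cover \<delta>"
  proof
    assume "frac y \<in> U_cover \<delta>"
    then have "of_int \<lfloor>y\<rfloor> + frac y \<in> U_plus \<epsilon>" unfolding U_plus_def \<delta>_def by blast
    with assms(1) show False by (simp add: frac_def)
  qed
  have "balanced b m n d (frac y)" if "n \<ge> n_start m b \<delta>" for n
  proof (rule ccontr)
    assume "\<not> ?thesis"
    then have "frac y \<in> U_cell b m n d" using assms by (intro unbalanced_in_U_cell) (auto simp: frac_lt_1)
    with that assms notin show False unfolding U_cover_def by auto
  qed
  then show ?thesis unfolding eventually_sequentially by blast
qed

section \<open>From simple normality to normality\<close>

lemma int_poly_eval_diff: "int_poly_eval (p - q) x = int_poly_eval p x - int_poly_eval q x"
  unfolding int_poly_eval_def poly_diff[symmetric]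
  by (rule arg_cong[where f = "\<lambda>p. poly p x"]) (simp add: poly_eq_iff coeff_map_poly)

lemma int_poly_eval_smult: "int_poly_eval (smult c p) x = of_int c * int_poly_eval p x"
  unfolding int_poly_eval_def poly_smult[symmetric]
  by (rule arg_cong[where f = "\<lambda>p. poly p x"]) (simp add: poly_eq_iff coeff_map_poly)

definition simply_normal :: "nat \<Rightarrow> real \<Rightarrow> bool" where
  "simply_normal b x \<longleftrightarrow>
     (\<forall>d<b. (\<lambda>n. real (card {j \<in> {1..n}. digit b x j = d}) / real n) \<longlonglongrightarrow> 1 / real b)"

lemma simply_normal_if_balanced:
  assumes "\<And>m d. m \<ge> 1 \<Longrightarrow> d < b \<Longrightarrow> eventually (\<lambda>n. balanced b m n d y) sequentially"
  shows "simply_normal b y"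
  unfolding simply_normal_def
proof (intro allI impI tendstoI)
  fix d and \<epsilon> :: real assume "d < b" "\<epsilon> > 0"
  obtain m where m: "inverse (real (Suc m)) < \<epsilon>" using reals_Archimedean \<open>\<epsilon> > 0\<close> by blast
  show "\<forall>\<^sub>F n in sequentially. dist (real (card {j \<in> {1..n}. digit b y j = d}) / real n) (1 / real b) < \<epsilon>"
  proof (rule eventually_mono)
    show "\<forall>\<^sub>F n in sequentially. balanced b (Suc m) n d y" using assms \<open>d < b\<close> by simp
  qed (use m in \<open>auto simp: balanced_def dist_real_def inverse_eq_divide\<close>)
qed

text \<open>The digits of a block, read together, form one digit in base
  \<open>b ^ length w\<close>; the induction removes the last letter because \<open>N mod b\<close>
  is the last digit.\<close>

lemma word_match_iff_mod:
  fixes N b :: nat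
  assumes "set w \<subseteq> {0..<b}"
  shows "(\<forall>j<length w. N div b ^ (length w - 1 - j) mod b = w ! j) \<longleftrightarrow>
     N mod b ^ length w = foldl (\<lambda>v a. b * v + a) 0 w"
  using assms
proof (induction w arbitrary: N rule: rev_induct)
  case Nil
  then show ?case by simp
next
  case (snoc a w)
  let ?l = "length w"
  from snoc.prems have ab: "a < b" by simp
  have "N div b ^ (?l - j) = N div b div b ^ (?l - 1 - j)" if "j < ?l" for j
  proof -
    have "?l - j = Suc (?l - 1 - j)" using that by simp
    then show ?thesis by (simp add: div_mult2_eq)
  qed
  then have "(\<forall>j<length (w @ [a]). N div b ^ (length (w @ [a]) - 1 - j) mod b = (w @ [a]) ! j) \<longleftrightarrow>
      (\<forall>j<?l. N div b div b ^ (?l - 1 - j) mod b = w ! j) \<and> N mod b = a"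
    by (auto simp: less_Suc_eq nth_append)
  also have "\<dots> \<longleftrightarrow> N div b mod b ^ ?l = foldl (\<lambda>v a. b * v + a) 0 w \<and> N mod b = a"
    using snoc by simp
  also have "\<dots> \<longleftrightarrow> b * (N div b mod b ^ ?l) + N mod b = b * foldl (\<lambda>v a. b * v + a) 0 w + a"
  proof
    assume eq: "b * (N div b mod b ^ ?l) + N mod b = b * foldl (\<lambda>v a. b * v + a) 0 w + a"
    have "N mod b = a" using arg_cong[OF eq, of "\<lambda>n. n mod b"] ab by simp
    with eq ab show "N div b mod b ^ ?l = foldl (\<lambda>v a. b * v + a) 0 w \<and> N mod b = a" by simp
  qed simp
  finally show ?case by (simp add: mod_mult2_eq)
qed

lemma foldl_horner_less:
  fixes b :: nat
  assumes "set w \<subseteq> {0..<b}" shows "foldl (\<lambda>v a. b * v + a) 0 w < b ^ length w"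
  using assms
proof (induction w rule: rev_induct)
  case (snoc a w)
  then have "foldl (\<lambda>v a. b * v + a) 0 w + 1 \<le> b ^ length w" by simp
  then have "b * (foldl (\<lambda>v a. b * v + a) 0 w + 1) \<le> b * b ^ length w" by (rule mult_le_mono2)
  then show ?case using snoc.prems by simp
qed simp

text \<open>
  The occurrences of a word of length \<open>l\<close> at positions \<open>\<equiv> r + 1 (mod l)\<close> in base \<open>b\<close> are the
  occurrences of a single digit of \<open>b ^ r * y\<close> in base \<open>b ^ l\<close>.
\<close>
lemma normal_number_if_multiples_simply_normal:
  assumes simple: "\<And>B M. B \<ge> 2 \<Longrightarrow> M \<ge> 1 \<Longrightarrow> simply_normal B (real M * y)"
  shows "normal_number y"
  unfolding normal_number_def
proof (intro allI impI)
  fix b :: nat and w assume b: "b \<ge> 2" and w: "set w \<subseteq> {0..<b}"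
  define l where "l = length w"
  show "(\<lambda>n. real (occurrences b y w n) / real n) \<longlonglongrightarrow> 1 / real b ^ length w"
  proof (cases "l = 0")
    case True
    then have "occurrences b y w n = card {1..n}" for n
      unfolding occurrences_def by (intro arg_cong[where f = card]) (auto simp: l_def)
    then have "eventually (\<lambda>n. 1 = real (occurrences b y w n) / real n) sequentially"
      by (intro eventually_mono[OF eventually_gt_at_top[of 0]]) simp
    then show ?thesis using True by (intro Lim_transform_eventually[OF tendsto_const]) (auto simp: l_def)
  next
    case False
    define V where "V = foldl (\<lambda>v a. b * v + a) 0 w"
    define c where "c r N = card {k \<in> {1..N}. digit (b ^ l) (real (b ^ r) * y) k = V}" for r N
    \<comment> \<open>Every position is \<open>k * l + r + 1 - l\<close> for a unique
      \<open>k \<ge> 1\<close> and \<open>r < l\<close>, and it is at most \<open>n\<close> iff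
      \<open>k \<le> N r n\<close>.\<close>
    define N where "N r n = (n + l - 1 - r) div l" for r n
    have "V < b ^ l" unfolding V_def l_def by (rule foldl_horner_less[OF w])
    moreover have "b ^ l \<ge> 2" using b False self_le_power[of b l] by simp
    ultimately have lim_c: "(\<lambda>n. real (c r n) / real n) \<longlonglongrightarrow> 1 / real (b ^ l)" for r
      using simple[of "b ^ l" "b ^ r"] b unfolding simply_normal_def c_def by simp
    have match: "(\<forall>j<l. digit b y (k * l + r + 1 - l + j) = w ! j) \<longleftrightarrow> digit (b ^ l) (real (b ^ r) * y) k = V"
      if "k \<ge> 1" for k r
    proof -
      define T where "T = nat \<lfloor>\<bar>y\<bar> * real b ^ (k * l + r)\<rfloor>"
      have "digit b y (k * l + r + 1 - l + j) = T div b ^ (l - 1 - j) mod b" if "j < l" for j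
      proof -
        have "k * l + r = (k * l + r + 1 - l + j) + (l - 1 - j)"
          using \<open>k \<ge> 1\<close> that by (cases k) auto
        then show ?thesis
          using nat_floor_power_div[of "\<bar>y\<bar>" b "k * l + r + 1 - l + j" "l - 1 - j"] b
          by (simp add: digit_def T_def)
      qed
      then have "(\<forall>j<l. digit b y (k * l + r + 1 - l + j) = w ! j) \<longleftrightarrow> T mod b ^ l = V"
        using word_match_iff_mod[OF w, of T] by (simp add: l_def V_def)
      moreover have "T = nat \<lfloor>\<bar>real (b ^ r) * y\<bar> * real (b ^ l) ^ k\<rfloor>"
        by (simp add: T_def abs_mult power_add mult_ac flip: power_mult)
      ultimately show ?thesis by (simp add: digit_def)
    qed
    have occ: "occurrences b y w n = (\<Sum>r<l. c r (N r n))" for n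
    proof -
      let ?K = "\<lambda>r. {k \<in> {1..N r n}. digit (b ^ l) (real (b ^ r) * y) k = V}"
      have le_N: "k \<le> N r n \<longleftrightarrow> k * l + r + 1 - l \<le> n" if "r < l" for k r
        using False that less_eq_div_iff_mult_less_eq[of l k "n + l - 1 - r"] by (auto simp: N_def)
      have "{i \<in> {1..n}. \<forall>j<l. digit b y (i + j) = w ! j} = (\<Union>r<l. (\<lambda>k. k * l + r + 1 - l) ` ?K r)"
      proof (intro equalityI subsetI)
        fix i assume i: "i \<in> {i \<in> {1..n}. \<forall>j<l. digit b y (i + j) = w ! j}"
        define k r where "k = Suc ((i - 1) div l)" and "r = (i - 1) mod l"
        have "i = (i - 1) div l * l + (i - 1) mod l + 1" using i by simp
        then have ieq: "i = k * l + r + 1 - l" by (simp add: k_def r_def)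
        have r: "r < l" using False by (simp add: r_def)
        have k1: "k \<ge> 1" by (simp add: k_def)
        have "k \<in> ?K r" using i ieq le_N[OF r, of k] match[OF k1, of r] k1 by auto
        then show "i \<in> (\<Union>r<l. (\<lambda>k. k * l + r + 1 - l) ` ?K r)" using ieq r by blast
      next
        fix i assume "i \<in> (\<Union>r<l. (\<lambda>k. k * l + r + 1 - l) ` ?K r)"
        then obtain r k where rk: "r < l" "k \<in> ?K r" "i = k * l + r + 1 - l" by blast
        then have k1: "k \<ge> 1" by simp
        then have "i \<ge> 1" using rk(3) by (cases k) auto
        moreover have "i \<le> n" using rk le_N by simp
        ultimately show "i \<in> {i \<in> {1..n}. \<forall>j<l. digit b y (i + j) = w ! j}"
          using match[OF k1, of r] rk by simp
      qed
      moreover have "card (\<Union>r<l. (\<lambda>k. k * l + r + 1 - l) ` ?K r) = (\<Sum>r<l. card ((\<lambda>k. k * l + r + 1 - l) ` ?K r))"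
      proof (intro card_UN_disjoint ballI impI)
        fix r r' assume rr: "r \<in> {..<l}" "r' \<in> {..<l}" "r \<noteq> r'"
        have "k * l + r + 1 - l \<noteq> k' * l + r' + 1 - l" if "k \<ge> 1" "k' \<ge> 1" for k k'
        proof
          assume eq: "k * l + r + 1 - l = k' * l + r' + 1 - l"
          with that have "k * l + r = k' * l + r'" by (cases k; cases k') auto
          then have "(k * l + r) mod l = (k' * l + r') mod l" by simp
          with rr show False by simp
        qed
        then show "(\<lambda>k. k * l + r + 1 - l) ` ?K r \<inter> (\<lambda>k. k * l + r' + 1 - l) ` ?K r' = {}"
          by force
      qed auto
      moreover have "card ((\<lambda>k. k * l + r + 1 - l) ` ?K r) = c r (N r n)" for r
        unfolding c_def
      proof (intro card_image inj_onI)
        fix k k' assume "k \<in> ?K r" "k' \<in> ?K r" and eq: "k * l + r + 1 - l = k' * l + r + 1 - l"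
        then have "k * l = k' * l" by (cases k; cases k') auto
        with False show "k = k'" by simp
      qed
      ultimately show ?thesis by (simp add: occurrences_def l_def)
    qed
    have lim_N: "(\<lambda>n. real (N r n) / real n) \<longlonglongrightarrow> 1 / real l" if "r < l" for r
    proof -
      have bound: "norm (real (N r n) / real n - 1 / real l) \<le> 2 / real n" if "n > 0" for n
      proof -
        have "l * N r n \<le> n + l" "n \<le> l * N r n + l"
          using mult_div_mod_eq[of l "n + l - 1 - r"] mod_less_divisor[of l "n + l - 1 - r"] \<open>r < l\<close>
          unfolding N_def by linarith+
        then have "real l * real (N r n) \<le> real n + real l" "real n \<le> real l * real (N r n) + real l"
          by (metis of_nat_add of_nat_le_iff of_nat_mult)+
        then have "\<bar>real l * real (N r n) - real n\<bar> \<le> real l" by linarith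
        moreover have "real (N r n) / real n - 1 / real l = (real l * real (N r n) - real n) / (real l * real n)"
          using that False by (simp add: field_simps)
        ultimately show ?thesis using that False by (simp add: abs_mult field_simps)
      qed
      have "\<forall>\<^sub>F n in sequentially. norm (real (N r n) / real n - 1 / real l) \<le> 2 / real n"
        using eventually_gt_at_top[of 0] bound by (rule eventually_mono)
      then show ?thesis
        by (rule LIM_zero_cancel[OF Lim_null_comparison[OF _ lim_const_over_n]])
    qed
    have "(\<lambda>n. real (c r (N r n)) / real n) \<longlonglongrightarrow> 1 / real (b ^ l) * (1 / real l)" if "r < l" for r
    proof -
      have "filterlim (N r) at_top sequentially"
        unfolding filterlim_at_top
      proof
        fix Z
        have "Z \<le> N r n" if "n \<ge> Z * l" for n
          using that False \<open>r < l\<close> less_eq_div_iff_mult_less_eq[of l Z "n + l - 1 - r"] by (simp add: N_def)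
        then show "\<forall>\<^sub>F n in sequentially. Z \<le> N r n" unfolding eventually_sequentially by blast
      qed
      from filterlim_compose[OF lim_c this]
      have "(\<lambda>n. real (c r (N r n)) / real (N r n) * (real (N r n) / real n)) \<longlonglongrightarrow> 1 / real (b ^ l) * (1 / real l)"
        by (intro tendsto_mult lim_N that)
      \<comment> \<open>For \<open>N r n = 0\<close> the count runs over an empty range, so both
        sides vanish.\<close>
      moreover have "real (c r (N r n)) / real (N r n) * (real (N r n) / real n) = real (c r (N r n)) / real n" for n
        by (cases "N r n = 0") (auto simp: c_def)
      ultimately show ?thesis by (simp only:)
    qed
    then have "(\<lambda>n. \<Sum>r<l. real (c r (N r n)) / real n) \<longlonglongrightarrow> (\<Sum>r<l. 1 / real (b ^ l) * (1 / real l))"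
      by (intro tendsto_sum) simp
    then show ?thesis using False by (simp add: occ sum_divide_distrib l_def[symmetric])
  qed
qed

text \<open>
  Replacing \<open>p\<close> by \<open>\<plusminus> M * p\<close> makes the value nonnegative, and its integer constant term does not
  change the fractional digits.
\<close>
lemma transcendentally_normal_if_balanced:
  assumes bal: "\<And>p b m d. p \<in> poly_family \<Longrightarrow> b \<ge> 2 \<Longrightarrow> m \<ge> 1 \<Longrightarrow> d < b \<Longrightarrow>
     eventually (\<lambda>n. balanced b m n d (frac (int_poly_eval p x))) sequentially"
  shows "transcendentally_normal x"
  unfolding transcendentally_normal_def
proof (intro allI impI normal_number_if_multiples_simply_normal simply_normal_if_balanced)
  fix p :: "int poly" and B M m d :: nat
  assume deg: "degree p > 0" and B: "B \<ge> 2" and M: "M \<ge> 1" and m: "m \<ge> 1" and d: "d < B"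
  define s :: int where "s = (if int_poly_eval p x \<ge> 0 then int M else - int M)"
  define P where "P = smult s p - [:s * poly p 0:]"
  have "s \<noteq> 0" using M by (simp add: s_def)
  have "degree (smult s p) = degree p" using \<open>s \<noteq> 0\<close> by simp
  then have "degree P = degree p" unfolding P_def
    using deg degree_add_eq_left[of "- [:s * poly p 0:]" "smult s p"] by (simp only: diff_conv_add_uminus) simp
  then have "P \<noteq> 0" using deg by auto
  then have fam: "P \<in> poly_family" by (simp add: poly_family_def P_def)
  have "int_poly_eval P x = real_of_int s * int_poly_eval p x - real_of_int (s * poly p 0)"
    unfolding P_def int_poly_eval_diff int_poly_eval_smult by (simp add: int_poly_eval_def map_poly_pCons)
  moreover have "real_of_int s * int_poly_eval p x = \<bar>real M * int_poly_eval p x\<bar>"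
    by (simp add: s_def abs_mult)
  ultimately have "\<bar>real M * int_poly_eval p x\<bar> = int_poly_eval P x + real_of_int (s * poly p 0)" by simp
  moreover have "frac (a + real_of_int z) = frac a" for a z by (simp add: frac_def)
  ultimately have fr: "frac \<bar>real M * int_poly_eval p x\<bar> = frac (int_poly_eval P x)"
    by (simp only:)
  have "digit B (real M * int_poly_eval p x) j = digit B (frac (int_poly_eval P x)) j" if "j \<ge> 1" for j
    using digit_frac[of "\<bar>real M * int_poly_eval p x\<bar>" B j] B that by (simp add: fr digit_def)
  then have "{j \<in> {1..n}. digit B (real M * int_poly_eval p x) j = d} =
      {j \<in> {1..n}. digit B (frac (int_poly_eval P x)) j = d}" for n by auto
  then show "\<forall>\<^sub>F n in sequentially. balanced B m n d (real M * int_poly_eval p x)"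
    using bal[OF fam B m d] by (simp add: balanced_def)
qed

section \<open>Unbalanced words\<close>

lemma exp_le_quadratic:
  fixes y :: real assumes "\<bar>y\<bar> \<le> 1" shows "exp y \<le> 1 + y + y\<^sup>2"
proof (cases "y \<ge> 0")
  case True
  then show ?thesis using exp_bound[of y] assms by simp
next
  case False
  define x where "x = - y"
  have x: "x \<ge> 0" using False by (simp add: x_def)
  have pos: "1 + x + x\<^sup>2 / 2 > 0" using x by (simp add: add_pos_nonneg)
  \<comment> \<open>For a negative argument the Taylor lower bound of \<open>exp x\<close> is
    inverted; this expansion shows that \<open>1 - x + x\<^sup>2\<close> dominates its
    inverse.\<close>
  have "(1 - x + x\<^sup>2) * (1 + x + x\<^sup>2 / 2) = 1 + x\<^sup>2 / 2 + x ^ 3 / 2 + x ^ 4 / 2"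
    by (simp add: field_simps power2_eq_square power3_eq_cube power4_eq_xxxx)
  then have "1 \<le> (1 - x + x\<^sup>2) * (1 + x + x\<^sup>2 / 2)" using x by simp
  then have "inverse (1 + x + x\<^sup>2 / 2) \<le> 1 - x + x\<^sup>2"
    using pos by (simp add: field_simps)
  moreover have "inverse (exp x) \<le> inverse (1 + x + x\<^sup>2 / 2)"
    using exp_lower_Taylor_quadratic[OF x] pos by (rule le_imp_inverse_le)
  ultimately show ?thesis by (simp add: x_def exp_minus)
qed

text \<open>The letters of a random word are independent, so the moment factorises. A centred letter
  indicator has mean \<open>0\<close> and variance \<open>(1 / b) * (1 - 1 / b) \<le> 1 / 4\<close>;
  the quadratic bound on \<open>exp\<close> turns this into \<open>exp (u\<^sup>2 / 4)\<close> per
  letter.\<close>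

lemma card_words_exp_moment:
  fixes b n d :: nat and u :: real
  assumes b: "b \<ge> 2" and d: "d < b" and u: "\<bar>u\<bar> \<le> 1"
  shows "(\<Sum>q \<in> {1..n} \<rightarrow>\<^sub>E {0..<b}. exp (u * (real (digit_count d n q) - real n / real b)))
           \<le> real b ^ n * exp (real n * u\<^sup>2 / 4)"
proof -
  define f where "f a = exp (u * ((if a = d then 1 else 0) - 1 / real b))" for a
  have "exp (u * (real (digit_count d n q) - real n / real b)) = (\<Prod>j = 1..n. f (q j))" for q
  proof -
    have "real (digit_count d n q) = (\<Sum>j = 1..n. if q j = d then 1 else 0)"
      by (simp add: digit_count_def sum.If_cases Int_def)
    then have "real (digit_count d n q) - real n / real b = (\<Sum>j = 1..n. (if q j = d then 1 else 0) - 1 / real b)"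
      by (simp add: sum_subtractf)
    then show ?thesis by (simp add: f_def exp_sum sum_distrib_left)
  qed
  then have "(\<Sum>q \<in> {1..n} \<rightarrow>\<^sub>E {0..<b}. exp (u * (real (digit_count d n q) - real n / real b)))
      = (\<Prod>j = 1..n. \<Sum>a = 0..<b. f a)"
    using prod_sum_PiE[of "{1..n}" "\<lambda>_. {0..<b}" "\<lambda>_. f"] by simp
  also have "\<dots> = (\<Sum>a = 0..<b. f a) ^ n" by simp
  also have "\<dots> \<le> (real b * exp (u\<^sup>2 / 4)) ^ n"
  proof (intro power_mono)
    let ?y = "\<lambda>a. u * ((if a = d then 1 else 0) - 1 / real b)"
    have "f a \<le> 1 + ?y a + (?y a)\<^sup>2" for a
    proof -
      have "\<bar>(if a = d then 1 else 0) - 1 / real b\<bar> \<le> 1" using b by auto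
      then have "\<bar>?y a\<bar> \<le> 1" unfolding abs_mult using u by (metis abs_ge_zero mult_le_one)
      then show ?thesis unfolding f_def by (rule exp_le_quadratic)
    qed
    then have "(\<Sum>a = 0..<b. f a) \<le> (\<Sum>a = 0..<b. 1 + ?y a + (?y a)\<^sup>2)" by (rule sum_mono)
    also have "\<dots> = real b + (\<Sum>a = 0..<b. ?y a) + (\<Sum>a = 0..<b. (?y a)\<^sup>2)"
      by (simp add: sum.distrib)
    also have "(\<Sum>a = 0..<b. ?y a) = 0"
      using b d by (simp add: sum_subtractf flip: sum_distrib_left)
    also have "(\<Sum>a = 0..<b. (?y a)\<^sup>2) = u\<^sup>2 * (\<Sum>a = 0..<b. (if a = d then 1 - 2 / real b else 0) + 1 / (real b)\<^sup>2)"
      unfolding sum_distrib_left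
      by (intro sum.cong refl) (auto simp: power_mult_distrib power2_diff power_divide)
    also have "(\<Sum>a = 0..<b. (if a = d then 1 - 2 / real b else 0) + 1 / (real b)\<^sup>2) = 1 - 1 / real b"
      using b d by (simp add: sum.distrib power2_eq_square)
    also have "u\<^sup>2 * (1 - 1 / real b) \<le> real b * (u\<^sup>2 / 4)"
    proof -
      have "0 \<le> (real b - 2)\<^sup>2" by simp
      then have "1 - 1 / real b \<le> real b / 4" using b by (simp add: field_simps power2_eq_square)
      then have "u\<^sup>2 * (1 - 1 / real b) \<le> u\<^sup>2 * (real b / 4)" by (rule mult_left_mono) simp
      then show ?thesis by (simp add: mult_ac)
    qed
    also have "real b + 0 + real b * (u\<^sup>2 / 4) = real b * (1 + u\<^sup>2 / 4)" by (simp add: algebra_simps)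
    also have "\<dots> \<le> real b * exp (u\<^sup>2 / 4)" by (intro mult_left_mono exp_ge_add_one_self) simp
    finally show "(\<Sum>a = 0..<b. f a) \<le> real b * exp (u\<^sup>2 / 4)" by simp
  qed (simp add: f_def sum_nonneg)
  also have "\<dots> = real b ^ n * exp (real n * u\<^sup>2 / 4)"
    by (simp add: power_mult_distrib flip: exp_of_nat_mult)
  finally show ?thesis .
qed

text \<open>Chernoff's bound with \<open>u = 1 / m\<close> and \<open>u = - 1 / m\<close>. The
  threshold yields the exponent \<open>n / m\<^sup>2\<close>, the moment costs a quarter of it, and
  the remaining \<open>3 / 4\<close> is weakened to \<open>1 / 2\<close>; the factor
  \<open>2\<close> counts the tails.\<close>

lemma card_unbalanced_words_le:
  fixes b m n d :: nat
  assumes b: "b \<ge> 2" and m: "m \<ge> 1" and d: "d < b"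
  shows "real (card {q \<in> {1..n} \<rightarrow>\<^sub>E {0..<b}. \<bar>real (digit_count d n q) / real n - 1 / real b\<bar> \<ge> 1 / real m})
           \<le> 2 * real b ^ n * exp (- real n / (2 * (real m)\<^sup>2))"
proof (cases "n = 0")
  case True
  have "card {q \<in> {1..n} \<rightarrow>\<^sub>E {0..<b}. \<bar>real (digit_count d n q) / real n - 1 / real b\<bar> \<ge> 1 / real m}
      \<le> card ({1..n} \<rightarrow>\<^sub>E {0..<b})" by (intro card_mono finite_PiE) auto
  then show ?thesis using True by simp
next
  case False
  let ?W = "{1..n} \<rightarrow>\<^sub>E {0..<b}"
  let ?D = "\<lambda>q. real (digit_count d n q) - real n / real b"
  let ?E = "exp (- real n / (2 * (real m)\<^sup>2))"
  have fin: "finite ?W" by (intro finite_PiE) auto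
  have tail: "real (card {q \<in> ?W. s * ?D q \<ge> real n / real m}) \<le> real b ^ n * ?E" if s: "\<bar>s\<bar> = 1" for s :: real
  proof -
    have "real (card {q \<in> ?W. s * ?D q \<ge> real n / real m}) * exp (real n / (real m)\<^sup>2)
        = (\<Sum>q \<in> {q \<in> ?W. s * ?D q \<ge> real n / real m}. exp (real n / (real m)\<^sup>2))" by simp
    also have "\<dots> \<le> (\<Sum>q \<in> {q \<in> ?W. s * ?D q \<ge> real n / real m}. exp (s / real m * ?D q))"
    proof (intro sum_mono)
      fix q assume "q \<in> {q \<in> ?W. s * ?D q \<ge> real n / real m}"
      then have "real n / real m / real m \<le> s * ?D q / real m" by (intro divide_right_mono) auto
      then show "exp (real n / (real m)\<^sup>2) \<le> exp (s / real m * ?D q)"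
        by (simp add: power2_eq_square)
    qed
    also have "\<dots> \<le> (\<Sum>q \<in> ?W. exp (s / real m * ?D q))" by (intro sum_mono2 fin) auto
    also have "\<dots> \<le> real b ^ n * exp (real n * (s / real m)\<^sup>2 / 4)"
      using s m by (intro card_words_exp_moment b d) (auto simp: abs_mult)
    also have "(s / real m)\<^sup>2 = 1 / (real m)\<^sup>2"
      using s by (simp add: power_divide flip: abs_square_eq_1)
    finally have "real (card {q \<in> ?W. s * ?D q \<ge> real n / real m}) \<le>
        real b ^ n * exp (real n * (1 / (real m)\<^sup>2) / 4) / exp (real n / (real m)\<^sup>2)"
      by (simp add: pos_le_divide_eq)
    also have "\<dots> = real b ^ n * exp (- (3 * real n / (4 * (real m)\<^sup>2)))"
      unfolding times_divide_eq_right[symmetric] exp_diff[symmetric]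
      using m by (simp add: field_simps)
    also have "\<dots> \<le> real b ^ n * ?E"
      by (intro mult_left_mono) (use m in \<open>auto simp: field_simps\<close>)
    finally show ?thesis .
  qed
  have "{q \<in> ?W. \<bar>real (digit_count d n q) / real n - 1 / real b\<bar> \<ge> 1 / real m}
      \<subseteq> {q \<in> ?W. 1 * ?D q \<ge> real n / real m} \<union> {q \<in> ?W. (-1) * ?D q \<ge> real n / real m}"
  proof
    fix q assume q: "q \<in> {q \<in> ?W. \<bar>real (digit_count d n q) / real n - 1 / real b\<bar> \<ge> 1 / real m}"
    have "?D q = real n * (real (digit_count d n q) / real n - 1 / real b)"
      using False by (simp add: right_diff_distrib)
    then have "real n * \<bar>real (digit_count d n q) / real n - 1 / real b\<bar> = \<bar>?D q\<bar>"
      by (simp add: abs_mult)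
    moreover have "real n * (1 / real m) \<le> real n * \<bar>real (digit_count d n q) / real n - 1 / real b\<bar>"
      using q by (intro mult_left_mono) auto
    ultimately show "q \<in> {q \<in> ?W. 1 * ?D q \<ge> real n / real m} \<union> {q \<in> ?W. (-1) * ?D q \<ge> real n / real m}"
      using q by auto
  qed
  then have "card {q \<in> ?W. \<bar>real (digit_count d n q) / real n - 1 / real b\<bar> \<ge> 1 / real m}
      \<le> card ({q \<in> ?W. 1 * ?D q \<ge> real n / real m} \<union> {q \<in> ?W. (-1) * ?D q \<ge> real n / real m})"
    using fin by (intro card_mono) auto
  also have "\<dots> \<le> card {q \<in> ?W. 1 * ?D q \<ge> real n / real m} + card {q \<in> ?W. (-1) * ?D q \<ge> real n / real m}"
    by (rule card_Un_le)
  finally show ?thesis using tail[of 1] tail[of "-1"] by (simp add: mult_ac)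
qed

section \<open>Measure of the Sierpinski cover\<close>

lemma inverse_one_minus_exp_le:
  fixes x :: real assumes "x > 0" shows "1 / (1 - exp (- x)) \<le> 1 + 1 / x"
proof -
  have "1 + x \<le> exp x" by (rule exp_ge_add_one_self)
  then have "exp (- x) \<le> 1 / (1 + x)"
    using assms le_imp_inverse_le[of "1 + x" "exp x"] by (simp add: exp_minus inverse_eq_divide)
  then have "x / (1 + x) \<le> 1 - exp (- x)" using assms by (simp add: field_simps)
  moreover have "x / (1 + x) > 0" using assms by simp
  ultimately have "1 / (1 - exp (- x)) \<le> 1 / (x / (1 + x))"
    by (intro frac_le) auto
  then show ?thesis using assms by (simp add: field_simps)
qed

text \<open>A geometric series of ratio \<open>exp (- x)\<close>. It serves for the lengths,
  precisions, bases, integer translates and members of the family in turn.\<close>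

lemma emeasure_UN_exp_le:
  fixes A :: "nat \<Rightarrow> 'a set"
  assumes "\<And>i. A i \<in> sets M" "\<And>i. emeasure M (A i) \<le> ennreal (C * exp (- x * real i))" "C \<ge> 0" "x > 0"
  shows "emeasure M (\<Union>i. A i) \<le> ennreal (C * (1 + 1 / x))"
proof -
  have eq: "exp (- x * real i) = exp (- x) ^ i" for i
    by (simp add: mult.commute flip: exp_of_nat_mult)
  have geo: "(\<lambda>i. C * exp (- x * real i)) sums (C * (1 / (1 - exp (- x))))"
    unfolding eq using assms by (intro sums_mult geometric_sums) simp
  have "emeasure M (\<Union>i. A i) \<le> (\<Sum>i. emeasure M (A i))"
    using assms(1) by (intro emeasure_subadditive_countably) auto
  also have "\<dots> \<le> (\<Sum>i. ennreal (C * exp (- x * real i)))"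
    by (intro suminf_le assms summableI)
  also have "\<dots> = ennreal (C * (1 / (1 - exp (- x))))"
    using geo assms by (intro suminf_ennreal_eq) auto
  also have "\<dots> \<le> ennreal (C * (1 + 1 / x))"
    using assms by (intro ennreal_leI mult_left_mono inverse_one_minus_exp_le)
  finally show ?thesis .
qed

text \<open>
  The sets of the Sierpinski cover are measured by an arbitrary measure with bounded density, so
  that the same estimate applies to push-forwards of Lebesgue measure under polynomials.
\<close>
definition interval_bounded :: "real measure \<Rightarrow> real \<Rightarrow> bool" where
  "interval_bounded M c \<longleftrightarrow> sets M = sets borel \<and> c \<ge> 0 \<and>
     (\<forall>a b. a \<le> b \<longrightarrow> emeasure M {a<..<b} \<le> ennreal (c * (b - a)))"

lemma interval_bounded_shift:
  assumes "interval_bounded M c"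
  shows "interval_bounded (distr M borel (\<lambda>y. y - z)) c"
proof -
  have [measurable_cong]: "sets M = sets borel" using assms by (simp add: interval_bounded_def)
  have "emeasure (distr M borel (\<lambda>y. y - z)) {a<..<b} \<le> ennreal (c * (b - a))" if "a \<le> b" for a b
  proof -
    have "(\<lambda>y. y - z) -` {a<..<b} \<inter> space M = {a + z<..<b + z}"
      by (auto simp: sets_eq_imp_space_eq[OF \<open>sets M = sets borel\<close>])
    then have "emeasure (distr M borel (\<lambda>y. y - z)) {a<..<b} = emeasure M {a + z<..<b + z}"
      by (subst emeasure_distr) auto
    also have "\<dots> \<le> ennreal (c * ((b + z) - (a + z)))"
      using assms that unfolding interval_bounded_def by (meson add_right_mono)
    finally show ?thesis by simp
  qed
  with assms show ?thesis by (simp add: interval_bounded_def)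
qed

lemma emeasure_translation:
  fixes M :: "real measure"
  assumes "sets M = sets borel" "open S"
  shows "emeasure M ((\<lambda>y. a + y) ` S) = emeasure (distr M borel (\<lambda>y. y - a)) S"
proof -
  have [measurable_cong]: "sets M = sets borel" by fact
  have "(\<lambda>y. y - a) -` S \<inter> space M = (\<lambda>y. a + y) ` S"
    by (auto simp: sets_eq_imp_space_eq[OF assms(1)] intro!: image_eqI[of _ _ "_ - a"])
  then show ?thesis using assms(2) by (subst emeasure_distr) auto
qed

lemma open_U_cell: "open (U_cell b m n d)"
  unfolding U_cell_def by (intro open_UN ballI open_greaterThanLessThan)

lemma open_U_cover: "open (U_cover r)"
  unfolding U_cover_def by (intro open_UN ballI open_U_cell)

lemma open_U_plus: "open (U_plus r)"
  unfolding U_plus_def by (intro open_UN ballI open_translation open_U_cover)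

lemma emeasure_U_cell_le:
  assumes M: "interval_bounded M c" and b: "b \<ge> 2" and m: "m \<ge> 1" and d: "d < b"
  shows "emeasure M (U_cell b m n d) \<le> ennreal (6 * c * exp (- real n / (2 * (real m)\<^sup>2)))"
proof -
  let ?W = "{q \<in> {1..n} \<rightarrow>\<^sub>E {0..<b}. \<bar>real (digit_count d n q) / real n - 1 / real b\<bar> \<ge> 1 / real m}"
  let ?I = "\<lambda>q. {digit_value b n q - 1 / real b ^ n <..< digit_value b n q + 2 / real b ^ n}"
  have [simp]: "sets M = sets borel" and c: "c \<ge> 0" using M by (auto simp: interval_bounded_def)
  have "finite ({1..n} \<rightarrow>\<^sub>E {0..<b})" by (intro finite_PiE) auto
  then have fin: "finite ?W" by simp
  have "emeasure M (U_cell b m n d) \<le> (\<Sum>q\<in>?W. emeasure M (?I q))"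
    unfolding U_cell_def by (intro emeasure_subadditive_finite fin) auto
  also have "\<dots> \<le> (\<Sum>q\<in>?W. ennreal (c * (3 / real b ^ n)))"
  proof (rule sum_mono)
    fix q
    have "digit_value b n q - 1 / real b ^ n \<le> digit_value b n q + 2 / real b ^ n"
      by (simp add: field_simps add_nonneg_nonneg)
    then have "emeasure M (?I q) \<le> ennreal (c * (digit_value b n q + 2 / real b ^ n - (digit_value b n q - 1 / real b ^ n)))"
      using M unfolding interval_bounded_def by blast
    then show "emeasure M (?I q) \<le> ennreal (c * (3 / real b ^ n))" by (simp add: add_divide_distrib[symmetric])
  qed
  also have "\<dots> = ennreal (real (card ?W) * (c * (3 / real b ^ n)))"
    unfolding sum_constant ennreal_of_nat_eq_real_of_nat using c by (intro ennreal_mult[symmetric]) auto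
  also have "\<dots> \<le> ennreal ((2 * real b ^ n * exp (- real n / (2 * (real m)\<^sup>2))) * (c * (3 / real b ^ n)))"
    using c by (intro ennreal_leI mult_right_mono card_unbalanced_words_le b m d) auto
  \<comment> \<open>\<open>6\<close> is the \<open>2\<close> of the word count times the length
    \<open>3\<close> of an enlarged cell in units of \<open>1 / b ^ n\<close>.\<close>
  also have "(2 * real b ^ n * exp (- real n / (2 * (real m)\<^sup>2))) * (c * (3 / real b ^ n)) =
      6 * c * exp (- real n / (2 * (real m)\<^sup>2))" using b by simp
  finally show ?thesis .
qed

text \<open>Turns the product \<open>m ^ 6 * b\<^sup>2 / r\<close> in the starting length into a
  sum, so that the exponential splits into separate decay in \<open>m\<close>, \<open>b\<close> and
  \<open>1 / r\<close>.\<close>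

lemma sum3_le_prod3:
  fixes x y z :: real assumes "x \<ge> 1" "y \<ge> 1" "z \<ge> 1" shows "x + y + z \<le> 3 * (x * y * z)"
proof -
  have "x \<le> x * (y * z)" "y \<le> y * (x * z)" "z \<le> z * (x * y)"
    using assms mult_mono[of 1 y 1 z] mult_mono[of 1 x 1 z] mult_mono[of 1 x 1 y]
    by (auto simp: mult_le_cancel_left1)
  then show ?thesis by (simp add: mult_ac)
qed

lemma emeasure_U_cover_le:
  assumes M: "interval_bounded M c" and r: "0 < r" "r \<le> 1"
  shows "emeasure M (U_cover r) \<le> ennreal (c * exp (- 16 / r))"
proof -
  have sets: "sets M = sets borel" and c: "c \<ge> 0" using M by (auto simp: interval_bounded_def)
  have opM: "S \<in> sets M" if "open S" for S using that sets by simp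
  have digits: "emeasure M (\<Union>d\<in>{0..<b}. U_cell b m n d) \<le>
      ennreal (6 * c * real b * exp (- real n / (2 * (real m)\<^sup>2)))" if "b \<ge> 2" "m \<ge> 1" for b m n
  proof -
    have "emeasure M (\<Union>d\<in>{0..<b}. U_cell b m n d) \<le> (\<Sum>d\<in>{0..<b}. emeasure M (U_cell b m n d))"
      using opM open_U_cell by (intro emeasure_subadditive_finite) auto
    also have "\<dots> \<le> (\<Sum>d\<in>{0..<b}. ennreal (6 * c * exp (- real n / (2 * (real m)\<^sup>2))))"
      using that by (intro sum_mono emeasure_U_cell_le M) auto
    also have "\<dots> = ennreal (6 * c * real b * exp (- real n / (2 * (real m)\<^sup>2)))"
      using c by (simp add: ennreal_of_nat_eq_real_of_nat ennreal_mult[symmetric] mult_ac)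
    finally show ?thesis .
  qed
  have lengths: "emeasure M (\<Union>n\<in>{n_start m b r..}. \<Union>d\<in>{0..<b}. U_cell b m n d) \<le>
      ennreal (c * exp (- 16 / r) * exp (- 5 * real b) * exp (- 14 * real m))" if bm: "b \<ge> 2" "m \<ge> 1" for b m
  proof -
    define N where "N = n_start m b r"
    define x where "x = 1 / (2 * (real m)\<^sup>2)"
    have x: "x > 0" using bm by (simp add: x_def)
    have "\<Union> ((\<lambda>n. \<Union>d\<in>{0..<b}. U_cell b m n d) ` {N..}) = (\<Union>i. \<Union>d\<in>{0..<b}. U_cell b m (N + i) d)"
    proof -
      have "{N..} = range (\<lambda>i. N + i)" by (auto simp: le_iff_add)
      then show ?thesis by (simp add: image_image)
    qed
    also have "emeasure M \<dots> \<le> ennreal ((6 * c * real b * exp (- x * real N)) * (1 + 1 / x))"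
    proof (rule emeasure_UN_exp_le)
      show "(\<Union>d\<in>{0..<b}. U_cell b m (N + i) d) \<in> sets M" for i
        by (intro opM open_UN ballI open_U_cell)
      show "emeasure M (\<Union>d\<in>{0..<b}. U_cell b m (N + i) d) \<le>
          ennreal (6 * c * real b * exp (- x * real N) * exp (- x * real i))" for i
        using digits[OF bm, of "N + i"]
        by (simp add: x_def diff_divide_distrib distrib_left mult.assoc flip: exp_add)
    qed (use c x in auto)
    also have "\<dots> \<le> ennreal (c * exp (- 16 / r) * exp (- 5 * real b) * exp (- 14 * real m))"
    proof (rule ennreal_leI)
      define X where "X = (real m)\<^sup>2"
      have "real m \<ge> 1" using bm by simp
      then have X: "X \<ge> 1" "X \<ge> real m"
        using mult_mono[of 1 "real m" 1 "real m"] mult_left_mono[of 1 "real m" "real m"]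
        by (auto simp: X_def power2_eq_square)
      have b4: "(real b)\<^sup>2 / 4 \<ge> 1" using bm power_mono[of 2 "real b" 2] by simp
      have b2: "2 * real b \<le> (real b)\<^sup>2" using bm by (simp add: power2_eq_square)
      have T: "1 / r \<ge> 1" using r by simp
      have "24 * real m ^ 6 * real b ^ 2 / r \<le> real N"
        unfolding N_def n_start_def using r by linarith
      then have Nx: "24 * real m ^ 6 * real b ^ 2 / r * x \<le> real N * x"
        using x by (intro mult_right_mono) auto
      have "16 * (X + (real b)\<^sup>2 / 4 + 1 / r) \<le> 48 * (X * ((real b)\<^sup>2 / 4) * (1 / r))"
        using mult_left_mono[OF sum3_le_prod3[OF X(1) b4 T], of 16] by (simp add: mult_ac)
      also have "\<dots> = 12 * (X * 1) * (real b)\<^sup>2 * (1 / r)" by simp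
      also have "\<dots> \<le> 12 * (X * X) * (real b)\<^sup>2 * (1 / r)"
        using X r by (intro mult_right_mono mult_left_mono) auto
      also have "\<dots> = 24 * real m ^ 6 * real b ^ 2 / r * x"
        using bm by (simp add: x_def X_def field_simps power2_eq_square power_numeral_reduce)
      also note Nx
      \<comment> \<open>Of this exponent \<open>2 * X\<close> pays for the sum over the lengths and
        \<open>3 * b\<close> for the factor \<open>6 * b\<close>. Since
        \<open>4 * b\<^sup>2 \<ge> 8 * b\<close> and \<open>X \<ge> m\<close>, the shares
        \<open>14 * m\<close>, \<open>5 * b\<close> and \<open>16 / r\<close> remain.\<close>
      finally have Nx: "16 * X + 4 * (real b)\<^sup>2 + 16 / r \<le> real N * x" by simp
      have "1 + 1 / x = 1 + 2 * X" using bm by (simp add: x_def X_def)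
      also have "\<dots> \<le> exp (2 * X)" by (rule exp_ge_add_one_self)
      finally have 1: "1 + 1 / x \<le> exp (2 * X)" .
      have "6 * real b \<le> exp (3 * real b)"
      proof -
        have "1 + 3 * real b + (3 * real b)\<^sup>2 / 2 \<le> exp (3 * real b)"
          by (rule exp_lower_Taylor_quadratic) simp
        moreover have "6 * real b \<le> (3 * real b)\<^sup>2 / 2" using b2 by (simp add: power_mult_distrib)
        ultimately show ?thesis by simp
      qed
      then have "(6 * real b) * exp (- x * real N) * (1 + 1 / x) \<le> exp (3 * real b) * exp (- x * real N) * exp (2 * X)"
        using 1 x by (intro mult_mono) auto
      also have "\<dots> = exp (3 * real b - x * real N + 2 * X)" by (simp add: exp_add exp_diff exp_minus field_simps)
      also have "\<dots> \<le> exp (- 16 / r + - 5 * real b + - 14 * real m)"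
        using Nx X b2 by (simp add: mult.commute)
      also have "\<dots> = exp (- 16 / r) * exp (- 5 * real b) * exp (- 14 * real m)" by (simp only: exp_add)
      finally have "c * ((6 * real b) * exp (- x * real N) * (1 + 1 / x)) \<le>
          c * (exp (- 16 / r) * exp (- 5 * real b) * exp (- 14 * real m))" using c by (rule mult_left_mono)
      then show "6 * c * real b * exp (- x * real N) * (1 + 1 / x) \<le>
          c * exp (- 16 / r) * exp (- 5 * real b) * exp (- 14 * real m)" by (simp add: mult_ac)
    qed
    finally show ?thesis unfolding N_def .
  qed
  have "U_cover r = (\<Union>i. \<Union>j. \<Union>n\<in>{n_start (Suc j) (i + 2) r..}. \<Union>d\<in>{0..<i + 2}. U_cell (i + 2) (Suc j) n d)"
  proof -
    have "{2..} = range (\<lambda>i. i + 2 :: nat)" "{1..} = range Suc"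
      by (auto simp: image_iff le_iff_add add.commute Suc_le_eq gr0_conv_Suc)
    then show ?thesis unfolding U_cover_def by (simp only: image_image)
  qed
  also have "emeasure M \<dots> \<le> ennreal ((2 * c * exp (- 16 / r) * exp (- 10)) * (1 + 1 / 5))"
  proof (rule emeasure_UN_exp_le)
    fix i
    let ?S = "\<lambda>j. \<Union>n\<in>{n_start (Suc j) (i + 2) r..}. \<Union>d\<in>{0..<i + 2}. U_cell (i + 2) (Suc j) n d"
    show "(\<Union>j. ?S j) \<in> sets M" by (intro opM open_UN ballI open_U_cell)
    have "emeasure M (\<Union>j. ?S j) \<le> ennreal ((c * exp (- 16 / r) * exp (- 5 * real (i + 2))) * (1 + 1 / 14))"
    proof (rule emeasure_UN_exp_le)
      fix j
      show "?S j \<in> sets M" by (intro opM open_UN ballI open_U_cell)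
      have "emeasure M (?S j) \<le> ennreal (c * exp (- 16 / r) * exp (- 5 * real (i + 2)) * exp (- 14 * real (Suc j)))"
        by (rule lengths) auto
      also have "\<dots> \<le> ennreal (c * exp (- 16 / r) * exp (- 5 * real (i + 2)) * exp (- 14 * real j))"
        using c by (intro ennreal_leI mult_left_mono) auto
      finally show "emeasure M (?S j) \<le> ennreal (c * exp (- 16 / r) * exp (- 5 * real (i + 2)) * exp (- 14 * real j))" .
    qed (use c in auto)
    also have "\<dots> \<le> ennreal (2 * c * exp (- 16 / r) * exp (- 10) * exp (- 5 * real i))"
    proof (rule ennreal_leI)
      \<comment> \<open>Starting the bases at \<open>2\<close> leaves a factor
        \<open>exp (- 10)\<close>, which finally absorbs the constants of both series.\<close>
      have "exp (- 5 * real (i + 2)) = exp (- 10) * exp (- 5 * real i)" by (simp flip: exp_add)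
      moreover have "0 \<le> c * exp (- 16 / r) * exp (- 10) * exp (- 5 * real i)" using c by simp
      ultimately show "c * exp (- 16 / r) * exp (- 5 * real (i + 2)) * (1 + 1 / 14) \<le>
          2 * c * exp (- 16 / r) * exp (- 10) * exp (- 5 * real i)" by (simp add: mult_ac)
    qed
    finally show "emeasure M (\<Union>j. ?S j) \<le> ennreal (2 * c * exp (- 16 / r) * exp (- 10) * exp (- 5 * real i))" .
  qed (use c in auto)
  also have "\<dots> \<le> ennreal (c * exp (- 16 / r))"
  proof (rule ennreal_leI)
    have "1 + 10 \<le> exp (10 :: real)" by (rule exp_ge_add_one_self)
    then have "exp (- 10 :: real) \<le> 1 / 3" by (simp add: exp_minus field_simps)
    then have "(c * exp (- 16 / r)) * (2 * exp (- 10) * (1 + 1 / 5)) \<le> (c * exp (- 16 / r)) * 1"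
      using c by (intro mult_left_mono) auto
    then show "2 * c * exp (- 16 / r) * exp (- 10) * (1 + 1 / 5) \<le> c * exp (- 16 / r)" by (simp add: mult_ac)
  qed
  finally show ?thesis .
qed

text \<open>The radius for \<open>z\<close> gives the exponent
  \<open>64 * 2 ^ nat \<bar>z\<bar> / r\<close>, which is at least
  \<open>64 / r + 64 * \<bar>z\<bar>\<close>, so the translates form a geometric series. Lowering
  \<open>64\<close> to \<open>48\<close> leaves \<open>exp (- 16 / r)\<close> to absorb its
  constant.\<close>

lemma emeasure_U_plus_le:
  assumes M: "interval_bounded M c" and r: "0 < r" "r \<le> 1"
  shows "emeasure M (U_plus r) \<le> ennreal (c * exp (- 48 / r))"
proof -
  have sets [measurable_cong]: "sets M = sets borel" and c: "c \<ge> 0" using M by (auto simp: interval_bounded_def)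
  let ?S = "\<lambda>z::int. (\<lambda>y. of_int z + y) ` U_cover (r / 2 ^ (nat \<bar>z\<bar> + 2))"
  have opn: "?S z \<in> sets M" for z using open_translation[OF open_U_cover] sets by simp
  have cell: "emeasure M (?S z) \<le> ennreal (c * exp (- 64 / r) * exp (- 64 * real (nat \<bar>z\<bar>)))" for z
  proof -
    define i where "i = nat \<bar>z\<bar>"
    define \<delta> where "\<delta> = r / 2 ^ (i + 2)"
    have "r / 2 ^ (i + 2) \<le> 1 / 1" using r one_le_power[of "2::real" "i + 2"] by (intro frac_le) simp_all
    then have \<delta>: "0 < \<delta>" "\<delta> \<le> 1" using r by (auto simp: \<delta>_def)
    have "emeasure M (?S z) = emeasure (distr M borel (\<lambda>y. y - of_int z)) (U_cover \<delta>)"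
      using emeasure_translation[OF sets open_U_cover] by (simp add: \<delta>_def i_def)
    also have "\<dots> \<le> ennreal (c * exp (- 16 / \<delta>))"
      by (intro emeasure_U_cover_le interval_bounded_shift M \<delta>)
    also have "\<dots> \<le> ennreal (c * exp (- 64 / r - 64 * real i))"
    proof (intro ennreal_leI mult_left_mono c)
      have "real (Suc i) \<le> 2 ^ i"
        by (metis Suc_leI less_exp of_nat_le_iff of_nat_numeral of_nat_power)
      then have "64 / r * real (Suc i) \<le> 64 / r * 2 ^ i" using r by (intro mult_left_mono) auto
      moreover have "64 * real i \<le> 64 / r * real i" using r by (intro mult_right_mono) (auto simp: field_simps)
      moreover have "64 / r * real (Suc i) = 64 / r + 64 / r * real i" by (simp add: algebra_simps add_divide_distrib)
      moreover have "16 / \<delta> = 64 / r * 2 ^ i" by (simp add: \<delta>_def)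
      ultimately have "64 / r + 64 * real i \<le> 16 / \<delta>" by linarith
      then show "exp (- 16 / \<delta>) \<le> exp (- 64 / r - 64 * real i)" by simp
    qed
    also have "\<dots> = ennreal (c * exp (- 64 / r) * exp (- 64 * real i))"
      by (simp add: mult.assoc flip: exp_add)
    finally show ?thesis unfolding i_def .
  qed
  have "(\<Union>z. S z) = (\<Union>i::nat. S (int i) \<union> S (- int i))" for S :: "int \<Rightarrow> real set"
  proof (intro equalityI subsetI)
    fix x assume "x \<in> (\<Union>z. S z)"
    then obtain z where "x \<in> S z" by blast
    then show "x \<in> (\<Union>i::nat. S (int i) \<union> S (- int i))" by (cases z rule: int_cases2) auto
  qed blast
  then have "U_plus r = (\<Union>i::nat. ?S (int i) \<union> ?S (- int i))" unfolding U_plus_def .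
  also have "emeasure M \<dots> \<le> ennreal ((2 * c * exp (- 64 / r)) * (1 + 1 / 64))"
  proof (rule emeasure_UN_exp_le)
    fix i
    show "?S (int i) \<union> ?S (- int i) \<in> sets M" using opn by blast
    have "emeasure M (?S (int i) \<union> ?S (- int i)) \<le> emeasure M (?S (int i)) + emeasure M (?S (- int i))"
      by (intro emeasure_subadditive opn)
    also have "\<dots> \<le> ennreal (c * exp (- 64 / r) * exp (- 64 * real i)) + ennreal (c * exp (- 64 / r) * exp (- 64 * real i))"
      using cell[of "int i"] cell[of "- int i"] by (intro add_mono) auto
    also have "\<dots> = ennreal (2 * c * exp (- 64 / r) * exp (- 64 * real i))"
      using c by (simp flip: ennreal_plus)
    finally show "emeasure M (?S (int i) \<union> ?S (- int i)) \<le> ennreal (2 * c * exp (- 64 / r) * exp (- 64 * real i))" .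
  qed (use c in auto)
  also have "\<dots> \<le> ennreal (c * exp (- 48 / r))"
  proof (rule ennreal_leI)
    have "exp (- 64 / r) = exp (- 48 / r) * exp (- 16 / r)" by (simp add: field_simps flip: exp_add)
    moreover have "exp (- 16 / r) \<le> 1 / 3"
    proof -
      have "exp (- 16 / r) \<le> exp (- 16)" using r by (simp add: field_simps)
      also have "1 + 16 \<le> exp (16 :: real)" by (rule exp_ge_add_one_self)
      then have "exp (- 16 :: real) \<le> 1 / 3" by (simp add: exp_minus field_simps)
      finally show ?thesis .
    qed
    ultimately have "exp (- 64 / r) \<le> exp (- 48 / r) * (1 / 3)" by (simp add: field_simps)
    then have "c * (exp (- 64 / r) * 3) \<le> c * exp (- 48 / r)" using c by (intro mult_left_mono) auto
    moreover have "c * exp (- 64 / r) * (2 * (1 + 1 / 64)) \<le> c * exp (- 64 / r) * 3" using c by (intro mult_left_mono) auto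
    ultimately show "2 * c * exp (- 64 / r) * (1 + 1 / 64) \<le> c * exp (- 48 / r)" by (simp add: mult_ac)
  qed
  finally show ?thesis .
qed

section \<open>Preimages under polynomials\<close>

lemma card_set_mset_le_size: "card (set_mset A) \<le> size A"
  by (induction A) (auto intro: card_insert_le_m1 le_SucI simp: card_insert_if)

text \<open>For real \<open>x\<close> each complex linear factor \<open>x - z\<close> has modulus at
  least the distance from \<open>x\<close> to the real part of \<open>z\<close>.\<close>

lemma poly_lower_bound_off_roots:
  fixes q :: "real poly"
  assumes "q \<noteq> 0" "\<bar>lead_coeff q\<bar> \<ge> 1"
  obtains R where "finite R" "card R \<le> degree q"
    "\<And>x \<eta>. \<eta> \<ge> 0 \<Longrightarrow> (\<And>\<rho>. \<rho> \<in> R \<Longrightarrow> \<eta> \<le> \<bar>x - \<rho>\<bar>) \<Longrightarrow> \<eta> ^ degree q \<le> \<bar>poly q x\<bar>"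
proof -
  define Q where "Q = map_poly complex_of_real q"
  have deg: "degree Q = degree q" by (simp add: Q_def degree_map_poly)
  have lead: "lead_coeff Q = complex_of_real (lead_coeff q)" by (simp add: deg) (simp add: Q_def coeff_map_poly)
  have "Q \<noteq> 0" using assms(2) lead by auto
  then obtain A where A: "size A = degree Q" "Q = smult (lead_coeff Q) (\<Prod>x\<in>#A. [:- x, 1:])"
    using alg_closed_imp_factorization by blast
  show thesis
  proof
    show "finite (Re ` set_mset A)" by simp
    show "card (Re ` set_mset A) \<le> degree q"
      using card_image_le[of "set_mset A" Re] card_set_mset_le_size[of A] A(1) deg by simp
    fix x \<eta> :: real assume \<eta>: "\<eta> \<ge> 0" and far: "\<And>\<rho>. \<rho> \<in> Re ` set_mset A \<Longrightarrow> \<eta> \<le> \<bar>x - \<rho>\<bar>"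
    have "\<eta> ^ size B \<le> norm (\<Prod>z\<in>#B. complex_of_real x - z)" if "set_mset B \<subseteq> set_mset A" for B
      using that
    proof (induction B)
      case (add z B)
      have "\<eta> \<le> \<bar>Re (complex_of_real x - z)\<bar>" using far[of "Re z"] add.prems by simp
      also have "\<dots> \<le> norm (complex_of_real x - z)" by (rule abs_Re_le_cmod)
      finally show ?case using add \<eta> by (auto simp: norm_mult intro!: mult_mono)
    qed simp
    then have "\<eta> ^ degree q \<le> norm (\<Prod>z\<in>#A. complex_of_real x - z)" using A(1) deg by (metis order_refl)
    also have "\<dots> = 1 * norm (\<Prod>z\<in>#A. complex_of_real x - z)" by simp
    also have "\<dots> \<le> norm (lead_coeff Q) * norm (\<Prod>z\<in>#A. complex_of_real x - z)"
      using assms(2) lead by (intro mult_right_mono) auto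
    also have "\<dots> = norm (poly Q (complex_of_real x))"
      by (subst (2) A(2)) (simp add: norm_mult poly_prod_mset image_mset.compositionality o_def)
    also have "poly Q (complex_of_real x) = complex_of_real (poly q x)"
      unfolding Q_def by (induction q) (auto simp: map_poly_pCons)
    finally show "\<eta> ^ degree q \<le> \<bar>poly q x\<bar>" by simp
  qed
qed

text \<open>
  Away from the \<open>\<eta>\<close>-neighbourhood of the real parts of the zeros of \<open>p'\<close> the map \<open>p\<close> expands
  distances by \<open>\<eta> ^ (d - 1)\<close> on each of at most \<open>d\<close> intervals; the choice \<open>\<eta> ^ d = L\<close> balances
  this against the size of the neighbourhood.
\<close>
lemma emeasure_poly_vimage_le:
  fixes p :: "real poly"
  assumes d: "degree p = d" "d \<ge> 1" and lead: "\<bar>lead_coeff p\<bar> \<ge> 1" and U: "open U" and L: "L > 0"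
    and UL: "\<And>M c. interval_bounded M c \<Longrightarrow> emeasure M U \<le> ennreal (c * L)"
  shows "emeasure lborel (poly p -` U) \<le> ennreal (4 * real d * L powr (1 / real d))"
proof -
  define \<eta> where "\<eta> = L powr (1 / real d)"
  have \<eta>: "\<eta> > 0" using L by (simp add: \<eta>_def)
  have "\<eta> ^ d = L" using L d by (simp add: \<eta>_def powr_powr flip: powr_realpow)
  then have \<eta>L: "\<eta> ^ (d - 1) * \<eta> = L" using d by (metis Suc_pred' less_eq_Suc_le One_nat_def power_Suc2)
  have degp': "degree (pderiv p) = d - 1" using d by (simp add: degree_pderiv)
  have "lead_coeff (pderiv p) = real d * lead_coeff p" using d by (simp add: degp' coeff_pderiv)
  then have "\<bar>lead_coeff (pderiv p)\<bar> = real d * \<bar>lead_coeff p\<bar>" by (simp add: abs_mult)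
  also have "\<dots> \<ge> 1 * 1" using d lead by (intro mult_mono) auto
  finally have lead': "\<bar>lead_coeff (pderiv p)\<bar> \<ge> 1" by simp
  then have "pderiv p \<noteq> 0" by auto
  then obtain R where R: "finite R" "card R \<le> d - 1"
    "\<And>x. (\<And>\<rho>. \<rho> \<in> R \<Longrightarrow> \<eta> \<le> \<bar>x - \<rho>\<bar>) \<Longrightarrow> \<eta> ^ (d - 1) \<le> \<bar>poly (pderiv p) x\<bar>"
    using poly_lower_bound_off_roots[OF _ lead'] \<eta> degp' by (metis less_imp_le)
  define B where "B = (\<Union>\<rho>\<in>R. {\<rho> - \<eta>..\<rho> + \<eta>})"
  have Bmeas [measurable]: "B \<in> sets borel" unfolding B_def using R(1) by (intro borel_closed closed_UN) auto
  have [measurable]: "poly p \<in> borel_measurable borel" by (intro borel_measurable_continuous_onI continuous_intros)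
  have [measurable]: "U \<in> sets borel" using U by simp
  have emB: "emeasure lborel B \<le> ennreal (2 * real (d - 1) * \<eta>)"
  proof -
    have "emeasure lborel B \<le> (\<Sum>\<rho>\<in>R. emeasure lborel {\<rho> - \<eta>..\<rho> + \<eta>})"
      unfolding B_def using R(1) by (intro emeasure_subadditive_finite) auto
    also have "\<dots> = (\<Sum>\<rho>\<in>R. ennreal (2 * \<eta>))" using \<eta> by (intro sum.cong) auto
    also have "\<dots> = ennreal (real (card R) * (2 * \<eta>))"
      unfolding sum_constant ennreal_of_nat_eq_real_of_nat using \<eta> by (intro ennreal_mult[symmetric]) auto
    also have "\<dots> \<le> ennreal (real (d - 1) * (2 * \<eta>))" using R(2) \<eta> by (intro ennreal_leI mult_right_mono) auto
    finally show ?thesis by (simp add: mult_ac)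
  qed
  \<comment> \<open>The push-forward of Lebesgue measure outside \<open>B\<close> is the measure to
    which \<open>UL\<close> is applied.\<close>
  define M where "M = distr (density lborel (indicator (- B))) borel (poly p)"
  have emM: "emeasure M E = emeasure lborel (- B \<inter> poly p -` E)" if [measurable]: "E \<in> sets borel" for E
  proof -
    have "poly p -` E \<in> sets borel" using measurable_sets[of "poly p" borel borel E] by simp
    then show ?thesis unfolding M_def by (subst emeasure_distr) (auto simp: emeasure_restricted)
  qed
  define c where "c = 2 * real d / \<eta> ^ (d - 1)"
  have "interval_bounded M c"
    unfolding interval_bounded_def
  proof (intro conjI allI impI)
    show "sets M = sets borel" by (simp add: M_def)
    show "c \<ge> 0" using \<eta> by (simp add: c_def)
    fix a b :: real assume ab: "a \<le> b"
    define D where "D = (b - a) / \<eta> ^ (d - 1)"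
    have D: "D \<ge> 0" using ab \<eta> by (simp add: D_def)
    let ?S = "- B \<inter> poly p -` {a<..<b}"
    \<comment> \<open>The number of points of \<open>R\<close> below \<open>x\<close> names the gap
      that contains \<open>x\<close>. Two points outside \<open>B\<close> in the same gap have only
      points far from \<open>R\<close> between them, so the mean value theorem meets a large
      derivative.\<close>
    let ?cls = "\<lambda>x. card {\<rho>\<in>R. \<rho> < x}"
    have near: "y - x \<le> D" if xy: "x \<in> ?S" "y \<in> ?S" "x < y" "?cls x = ?cls y" for x y
    proof -
      have same: "{\<rho>\<in>R. \<rho> < x} = {\<rho>\<in>R. \<rho> < y}"
        using xy R(1) by (intro card_subset_eq) auto
      obtain z where z: "x < z" "z < y" "poly p y - poly p x = (y - x) * poly (pderiv p) z"
        using poly_MVT[OF xy(3)] by blast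
      have "\<eta> \<le> \<bar>z - \<rho>\<bar>" if "\<rho> \<in> R" for \<rho>
      proof (cases "\<rho> < x")
        case True
        with xy(1) that z show ?thesis by (force simp: B_def)
      next
        case False
        with same that have "\<not> \<rho> < y" by blast
        with xy(2) that z show ?thesis by (force simp: B_def)
      qed
      then have "(y - x) * \<eta> ^ (d - 1) \<le> (y - x) * \<bar>poly (pderiv p) z\<bar>"
        using xy(3) R(3) by (intro mult_left_mono) auto
      also have "\<dots> = \<bar>poly p y - poly p x\<bar>" using z xy(3) by (simp add: abs_mult)
      also have "\<dots> \<le> b - a" using xy by auto
      finally show ?thesis using \<eta> by (simp add: D_def field_simps)
    qed
    \<comment> \<open>Any representative of a gap: the part of \<open>?S\<close> in that gap lies
      within \<open>D\<close> of it. This costs \<open>2 * D\<close> for each of at most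
      \<open>card R + 1 \<le> d\<close> gaps.\<close>
    define t where "t j = (SOME x. x \<in> ?S \<and> ?cls x = j)" for j
    have "?S \<subseteq> (\<Union>j\<in>{..card R}. {t j - D..t j + D})"
    proof
      fix x assume x: "x \<in> ?S"
      have t: "t (?cls x) \<in> ?S \<and> ?cls (t (?cls x)) = ?cls x"
        unfolding t_def by (rule someI[of _ x]) (use x in auto)
      have "x \<in> {t (?cls x) - D..t (?cls x) + D}"
        using near[of x "t (?cls x)"] near[of "t (?cls x)" x] t x D
        by (cases x "t (?cls x)" rule: linorder_cases) auto
      moreover have "?cls x \<le> card R" using R(1) by (intro card_mono) auto
      ultimately show "x \<in> (\<Union>j\<in>{..card R}. {t j - D..t j + D})" by blast
    qed
    then have "emeasure M {a<..<b} \<le> emeasure lborel (\<Union>j\<in>{..card R}. {t j - D..t j + D})"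
      by (subst emM) (auto intro!: emeasure_mono)
    also have "\<dots> \<le> (\<Sum>j\<in>{..card R}. emeasure lborel {t j - D..t j + D})"
      by (intro emeasure_subadditive_finite) auto
    also have "\<dots> = (\<Sum>j\<in>{..card R}. ennreal (2 * D))" using D by (intro sum.cong) auto
    also have "\<dots> = ennreal (real (Suc (card R)) * (2 * D))"
      unfolding sum_constant ennreal_of_nat_eq_real_of_nat card_atMost using D by (intro ennreal_mult[symmetric]) auto
    also have "\<dots> \<le> ennreal (real d * (2 * D))" using R(2) D d by (intro ennreal_leI mult_right_mono) auto
    also have "real d * (2 * D) = c * (b - a)" by (simp add: c_def D_def)
    finally show "emeasure M {a<..<b} \<le> ennreal (c * (b - a))" .
  qed
  from UL[OF this] have "emeasure lborel (- B \<inter> poly p -` U) \<le> ennreal (c * L)" by (simp add: emM)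
  also have "c * L = 2 * real d * \<eta>" using \<eta> by (simp add: c_def flip: \<eta>L)
  finally have good: "emeasure lborel (- B \<inter> poly p -` U) \<le> ennreal (2 * real d * \<eta>)" .
  have meas: "poly p -` U \<in> sets borel" using measurable_sets[of "poly p" borel borel U] by simp
  have "emeasure lborel (poly p -` U) \<le> emeasure lborel (B \<union> (- B \<inter> poly p -` U))"
    using meas by (intro emeasure_mono) auto
  also have "\<dots> \<le> emeasure lborel B + emeasure lborel (- B \<inter> poly p -` U)"
    using meas by (intro emeasure_subadditive) auto
  also have "\<dots> \<le> ennreal (2 * real (d - 1) * \<eta>) + ennreal (2 * real d * \<eta>)"
    by (intro add_mono emB good)
  also have "\<dots> = ennreal (2 * real (d - 1) * \<eta> + 2 * real d * \<eta>)" using \<eta> by (simp add: ennreal_plus)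
  also have "\<dots> \<le> ennreal (4 * real d * \<eta>)"
    using \<eta> by (intro ennreal_leI) (simp add: algebra_simps of_nat_diff)
  finally show ?thesis by (simp add: \<eta>_def)
qed

lemma emeasure_int_poly_vimage_le:
  assumes "degree p = d" "d \<ge> 1" "open U" "L > 0"
    and "\<And>M c. interval_bounded M c \<Longrightarrow> emeasure M U \<le> ennreal (c * L)"
  shows "emeasure lborel (int_poly_eval p -` U) \<le> ennreal (4 * real d * L powr (1 / real d))"
proof -
  have eval: "int_poly_eval p = poly (map_poly real_of_int p)" by (simp add: fun_eq_iff int_poly_eval_def)
  have deg: "degree (map_poly real_of_int p) = d" using assms(1) by (simp add: degree_map_poly)
  have "lead_coeff p \<noteq> 0" using assms(1,2) by auto
  then have "\<bar>lead_coeff p\<bar> \<ge> 1" by linarith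
  then have "\<bar>lead_coeff (map_poly real_of_int p)\<bar> \<ge> 1"
    using assms(1) by (simp add: deg coeff_map_poly)
  then show ?thesis unfolding eval by (intro emeasure_poly_vimage_le deg assms)
qed

lemma continuous_int_poly_eval: "continuous_on A (int_poly_eval p)"
proof -
  have "int_poly_eval p = poly (map_poly real_of_int p)" by (simp add: fun_eq_iff int_poly_eval_def)
  then show ?thesis by (simp add: continuous_intros)
qed

lemma open_int_poly_vimage: "open U \<Longrightarrow> open (int_poly_eval p -` U)"
  using continuous_open_vimage continuous_int_poly_eval by (metis continuous_on_eq_continuous_at open_UNIV UNIV_I)

section \<open>The polynomial family and the Sierpinski numbers\<close>

text \<open>Justifies the \<open>THE\<close> in \<open>family_enum\<close>. Ranks increase strictly
  and are unbounded on an infinite set. If the least rank \<open>n \<ge> k\<close> exceeded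
  \<open>k\<close>, the largest element strictly below would have rank \<open>n - 1\<close>.\<close>

lemma rank_enumerates:
  fixes le :: "'a \<Rightarrow> 'a \<Rightarrow> bool"
  assumes refl: "\<And>x. x \<in> S \<Longrightarrow> le x x"
    and antisym: "\<And>x y. x \<in> S \<Longrightarrow> y \<in> S \<Longrightarrow> le x y \<Longrightarrow> le y x \<Longrightarrow> x = y"
    and trans: "\<And>x y z. x \<in> S \<Longrightarrow> y \<in> S \<Longrightarrow> z \<in> S \<Longrightarrow> le x y \<Longrightarrow> le y z \<Longrightarrow> le x z"
    and total: "\<And>x y. x \<in> S \<Longrightarrow> y \<in> S \<Longrightarrow> le x y \<or> le y x"
    and fin: "\<And>x. x \<in> S \<Longrightarrow> finite {y \<in> S. le y x}"
    and inf: "infinite S" and k: "k \<ge> 1"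
  shows "\<exists>!x. x \<in> S \<and> card {y \<in> S. le y x} = k"
proof -
  define rank where "rank x = card {y \<in> S. le y x}" for x
  have less: "rank x < rank y" if "x \<in> S" "y \<in> S" "le x y" "x \<noteq> y" for x y
  proof -
    have "{z \<in> S. le z x} \<subset> {z \<in> S. le z y}"
      using that refl[of y] antisym[of x y] trans[of _ x y] by blast
    then show ?thesis unfolding rank_def by (intro psubset_card_mono fin that)
  qed
  have inj: "inj_on rank S"
    by (rule inj_onI) (metis less total nat_neq_iff)
  have "\<exists>n. \<exists>x\<in>S. rank x = n \<and> n \<ge> k"
  proof (rule ccontr)
    assume "\<not> ?thesis"
    then have "rank ` S \<subseteq> {..<k}" by force
    then have "finite (rank ` S)" by (rule finite_subset) simp
    then show False using finite_imageD[OF _ inj] inf by blast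
  qed
  then obtain n where n: "\<exists>x\<in>S. rank x = n \<and> n \<ge> k"
    and least: "\<And>n'. n' < n \<Longrightarrow> \<not> (\<exists>x\<in>S. rank x = n' \<and> n' \<ge> k)"
    using exists_least_iff[of "\<lambda>n. \<exists>x\<in>S. rank x = n \<and> n \<ge> k"] by blast
  then obtain x where x: "x \<in> S" "rank x = n" "n \<ge> k" by blast
  have "n = k"
  proof (rule ccontr)
    assume "n \<noteq> k"
    define A where "A = {y \<in> S. le y x} - {x}"
    have finA: "finite A" using fin[OF x(1)] by (simp add: A_def)
    have "x \<in> {y \<in> S. le y x}" using x refl by simp
    then have cardA: "card A = n - 1" unfolding A_def using x(2) fin[OF x(1)] by (simp add: rank_def)
    then have "A \<noteq> {}" using \<open>n \<noteq> k\<close> x(3) k by auto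
    then obtain y where y: "y \<in> A" "\<And>z. z \<in> A \<Longrightarrow> rank z \<le> rank y"
      using Max_in[of "rank ` A"] Max_ge[of "rank ` A"] finA by (metis (no_types, lifting) finite_imageI image_iff image_is_empty)
    have AS: "A \<subseteq> S" by (auto simp: A_def)
    have "{z \<in> S. le z y} = A"
    proof (intro equalityI subsetI)
      fix z assume z: "z \<in> A"
      have "le z y" using y z AS less[of y z] total[of y z] refl[of y] by (metis leD subsetD)
      then show "z \<in> {z \<in> S. le z y}" using z AS by blast
    next
      fix z assume z: "z \<in> {z \<in> S. le z y}"
      have "le z x" using trans[of z y x] z y(1) x(1) by (auto simp: A_def)
      moreover have "z \<noteq> x" using antisym[of x y] z y(1) x(1) by (auto simp: A_def)
      ultimately show "z \<in> A" using z by (simp add: A_def)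
    qed
    then have "rank y = n - 1" using cardA by (simp add: rank_def)
    moreover have "n - 1 < n" "n - 1 \<ge> k" using \<open>n \<noteq> k\<close> x(3) k by auto
    ultimately show False using least[of "n - 1"] y(1) AS by auto
  qed
  then show ?thesis using x inj unfolding rank_def inj_on_def by (intro ex1I[of _ x]) auto
qed

text \<open>Replacing \<open>LEAST\<close> by an existential first difference makes antisymmetry and
  transitivity first-order arguments.\<close>

lemma family_le_iff:
  "family_le p q \<longleftrightarrow> p = q \<or> family_norm p < family_norm q \<or> (family_norm p = family_norm q \<and>
     (\<exists>k. (\<forall>j<k. coeff p j = coeff q j) \<and> coeff p k > coeff q k))"
proof (cases "p = q")
  case False
  define k0 where "k0 = (LEAST k. coeff p k \<noteq> coeff q k)"
  have ne: "coeff p k0 \<noteq> coeff q k0"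
    using False unfolding k0_def poly_eq_iff by (metis (mono_tags, lifting) LeastI)
  have below: "coeff p j = coeff q j" if "j < k0" for j
    using that not_less_Least unfolding k0_def by blast
  have "(\<exists>k. (\<forall>j<k. coeff p j = coeff q j) \<and> coeff p k > coeff q k) \<longleftrightarrow> coeff p k0 > coeff q k0"
  proof
    assume "\<exists>k. (\<forall>j<k. coeff p j = coeff q j) \<and> coeff p k > coeff q k"
    then obtain k where k: "\<forall>j<k. coeff p j = coeff q j" "coeff p k > coeff q k" by blast
    have "k = k0" using k ne below[of k] by (metis less_irrefl nat_neq_iff)
    with k show "coeff p k0 > coeff q k0" by simp
  qed (use below in blast)
  then show ?thesis using False by (simp add: family_le_def k0_def Let_def)
qed (simp add: family_le_def)

lemma family_le_antisym: "family_le p q \<Longrightarrow> family_le q p \<Longrightarrow> p = q"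
  unfolding family_le_iff by (metis less_asym less_irrefl linorder_neqE_nat)

lemma family_le_trans:
  assumes "family_le p q" "family_le q r" shows "family_le p r"
proof -
  have "\<exists>k. (\<forall>j<k. coeff p j = coeff r j) \<and> coeff p k > coeff r k"
    if "\<forall>j<k1. coeff p j = coeff q j" "coeff p k1 > coeff q k1"
       "\<forall>j<k2. coeff q j = coeff r j" "coeff q k2 > coeff r k2" for k1 k2
  proof (rule exI[of _ "min k1 k2"], intro conjI allI impI)
    show "coeff p (min k1 k2) > coeff r (min k1 k2)"
      using that by (cases k1 k2 rule: linorder_cases) (auto simp: min_def)
  qed (use that in auto)
  with assms show ?thesis unfolding family_le_iff by fastforce
qed

lemma family_le_total: "family_le p q \<or> family_le q p"
proof (cases "p = q")
  case False
  define k0 where "k0 = (LEAST k. coeff p k \<noteq> coeff q k)"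
  have "k0 = (LEAST k. coeff q k \<noteq> coeff p k)" unfolding k0_def by (simp add: eq_commute)
  moreover have "coeff p k0 \<noteq> coeff q k0"
    using False unfolding k0_def poly_eq_iff by (metis (mono_tags, lifting) LeastI)
  ultimately show ?thesis using False by (auto simp: family_le_def k0_def[symmetric] Let_def)
qed (simp add: family_le_def)

section \<open>Norm, degree and index in the family\<close>

lemma degree_family: "degree p \<ge> 1" if "p \<in> poly_family"
proof (rule ccontr)
  assume "\<not> ?thesis"
  then have "degree p = 0" by simp
  then obtain c where "p = [:c:]" by (rule degree_eq_zeroE)
  with that show False by (simp add: poly_family_def)
qed

lemma abs_coeff_le_family_norm:
  assumes "1 \<le> k" "k \<le> degree p" shows "2 ^ k * \<bar>coeff p k\<bar> \<le> family_norm p"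
  unfolding family_norm_def using assms by (intro member_le_sum) auto

lemma family_norm_ge: "2 ^ degree p \<le> family_norm p" if "p \<in> poly_family"
proof -
  have "lead_coeff p \<noteq> 0" using that by (simp add: poly_family_def)
  then have "1 \<le> \<bar>lead_coeff p\<bar>" by linarith
  then have "2 ^ degree p * 1 \<le> 2 ^ degree p * \<bar>lead_coeff p\<bar>" by (intro mult_left_mono) auto
  also have "\<dots> \<le> family_norm p" using degree_family[OF that] by (intro abs_coeff_le_family_norm) auto
  finally show ?thesis by simp
qed

lemma finite_family_norm_le: "finite {p \<in> poly_family. family_norm p \<le> N}"
proof (rule finite_subset)
  show "finite (Poly ` {xs. set xs \<subseteq> {-N..N} \<and> length xs \<le> nat N + 1})"
    by (intro finite_imageI finite_lists_length_le) simp
  show "{p \<in> poly_family. family_norm p \<le> N} \<subseteq> Poly ` {xs. set xs \<subseteq> {-N..N} \<and> length xs \<le> nat N + 1}"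
  proof
    fix p assume p: "p \<in> {p \<in> poly_family. family_norm p \<le> N}"
    have "int (degree p) \<le> 2 ^ degree p" by (metis less_exp less_imp_le of_nat_le_iff of_nat_numeral of_nat_power)
    also have "\<dots> \<le> N" using p family_norm_ge[of p] by simp
    finally have deg: "degree p \<le> nat N" and N0: "N \<ge> 0" by auto
    have "\<bar>coeff p k\<bar> \<le> N" for k
    proof (cases "k = 0 \<or> k > degree p")
      case True
      then show ?thesis using p N0 by (auto simp: poly_family_def poly_0_coeff_0 coeff_eq_0)
    next
      case False
      then have "2 ^ k * \<bar>coeff p k\<bar> \<le> N" using abs_coeff_le_family_norm[of k p] p by simp
      moreover have "1 * \<bar>coeff p k\<bar> \<le> 2 ^ k * \<bar>coeff p k\<bar>" by (intro mult_right_mono) auto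
      ultimately show ?thesis by simp
    qed
    then have "range (coeff p) \<subseteq> {-N..N}" by (auto simp: abs_le_iff minus_le_iff)
    then have "set (coeffs p) \<subseteq> {-N..N}" by (auto simp: range_coeff)
    moreover have "length (coeffs p) \<le> nat N + 1" using deg p by (simp add: length_coeffs_degree poly_family_def)
    ultimately show "p \<in> Poly ` {xs. set xs \<subseteq> {-N..N} \<and> length xs \<le> nat N + 1}"
      by (intro image_eqI[of _ _ "coeffs p"]) auto
  qed
qed

lemma finite_family_segment: "finite {q \<in> poly_family. family_le q p}"
  by (rule finite_subset[OF _ finite_family_norm_le[of "family_norm p"]]) (auto simp: family_le_def)

lemma linear_in_family:
  assumes "c \<noteq> 0" shows "[:0, c:] \<in> poly_family" "family_norm [:0, c:] = 2 * \<bar>c\<bar>"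
  using assms by (auto simp: poly_family_def family_norm_def)

lemma infinite_family: "infinite poly_family"
proof
  assume "finite poly_family"
  then have "finite ((\<lambda>n. [:0, int (Suc n):]) ` UNIV)"
    by (rule finite_subset[rotated]) (auto intro: linear_in_family)
  then have "finite (UNIV :: nat set)" by (rule finite_imageD) (auto simp: inj_on_def)
  then show False by simp
qed

lemma family_enum_props:
  assumes "k \<ge> 1"
  shows "family_enum k \<in> poly_family" "card {q \<in> poly_family. family_le q (family_enum k)} = k"
proof -
  have "\<exists>!p. p \<in> poly_family \<and> card {q \<in> poly_family. family_le q p} = k"
    by (rule rank_enumerates)
      (use assms family_le_antisym family_le_trans family_le_total finite_family_segment infinite_family in
        \<open>auto simp: family_le_def[of p p for p]\<close>)
  from theI'[OF this] show "family_enum k \<in> poly_family" "card {q \<in> poly_family. family_le q (family_enum k)} = k"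
    unfolding family_enum_def by auto
qed

lemma family_enum_surj:
  assumes "p \<in> poly_family" obtains k where "k \<ge> 1" "family_enum k = p"
proof
  let ?k = "card {q \<in> poly_family. family_le q p}"
  have "p \<in> {q \<in> poly_family. family_le q p}" using assms by (simp add: family_le_def)
  then show k: "?k \<ge> 1" using finite_family_segment[of p] by (metis One_nat_def Suc_leI card_gt_0_iff empty_iff)
  show "family_enum ?k = p"
  proof (rule ccontr)
    assume ne: "family_enum ?k \<noteq> p"
    note enum = family_enum_props[OF k]
    have less: "card {y \<in> poly_family. family_le y x} < card {y \<in> poly_family. family_le y z}"
      if "x \<in> poly_family" "z \<in> poly_family" "family_le x z" "x \<noteq> z" for x z
    proof (rule psubset_card_mono[OF finite_family_segment])
      show "{y \<in> poly_family. family_le y x} \<subset> {y \<in> poly_family. family_le y z}"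
        using that family_le_trans[of _ x z] family_le_antisym[of x z] family_le_total[of z z] by blast
    qed
    show False using less[of p "family_enum ?k"] less[of "family_enum ?k" p] family_le_total[of p "family_enum ?k"]
      assms enum ne by auto
  qed
qed

text \<open>The polynomials \<open>c * x\<close> with \<open>0 < c < 2 ^ (d - 1)\<close> precede every polynomial of degree \<open>d\<close>.\<close>
lemma family_enum_index_ge:
  assumes "k \<ge> 1" shows "2 ^ (degree (family_enum k) - 1) \<le> k"
proof -
  let ?p = "family_enum k"
  note enum = family_enum_props[OF assms]
  define d where "d = degree ?p"
  have d: "d \<ge> 1" using degree_family[OF enum(1)] by (simp add: d_def)
  let ?A = "(\<lambda>c. [:0, int c:]) ` {1..<2 ^ (d - 1)}"
  have norm: "2 ^ d \<le> family_norm ?p" using family_norm_ge[OF enum(1)] by (simp add: d_def)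
  have lt: "2 * int c < 2 ^ d" if "c < 2 ^ (d - 1)" for c
  proof -
    have "2 * c < 2 * 2 ^ (d - 1)" using that by simp
    also have "\<dots> = 2 ^ d" using d by (simp flip: power_Suc)
    finally show ?thesis by (metis of_nat_less_iff of_nat_mult of_nat_numeral of_nat_power)
  qed
  have "?p \<notin> ?A"
  proof
    assume "?p \<in> ?A"
    then obtain c where "c \<ge> 1" "c < 2 ^ (d - 1)" "?p = [:0, int c:]" by auto
    with lt[of c] norm linear_in_family(2)[of "int c"] show False by simp
  qed
  moreover have "card ?A = 2 ^ (d - 1) - 1" by (subst card_image) (auto simp: inj_on_def)
  ultimately have "card (insert ?p ?A) = 2 ^ (d - 1)" by simp
  moreover have "card (insert ?p ?A) \<le> card {q \<in> poly_family. family_le q ?p}"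
  proof (intro card_mono finite_family_segment subsetI)
    fix q assume "q \<in> insert ?p ?A"
    then show "q \<in> {q \<in> poly_family. family_le q ?p}"
    proof
      assume "q \<in> ?A"
      then obtain c where "c \<ge> 1" "c < 2 ^ (d - 1)" "q = [:0, int c:]" by auto
      with lt[of c] norm linear_in_family[of "int c"] show ?thesis by (simp add: family_le_def)
    qed (use enum(1) in \<open>auto simp: family_le_def\<close>)
  qed
  ultimately show ?thesis using enum(2) by (simp add: d_def)
qed

section \<open>Measure of one preimage in the family cover\<close>

lemma square_le_exponential: "(Suc e)\<^sup>2 \<le> 3 * 2 ^ e"
proof (induction e)
  case (Suc e)
  show ?case
  proof (cases "e \<ge> 2")
    case True
    then have "2 * 2 \<le> e * e" by (intro mult_mono) auto
    with Suc show ?thesis by (simp add: power2_eq_square algebra_simps)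
  next
    case False
    then have "e = 0 \<or> e = 1" by auto
    then show ?thesis by (auto simp: power2_eq_square)
  qed
qed (simp add: power2_eq_square)

text \<open>Since \<open>K_const d \<ge> (d + 1) ^ d\<close>, one has
  \<open>1 / \<epsilon> \<ge> 2 powr (k / d) * (d + 1)\<close>. The preimage has measure at most
  \<open>4 * d * exp (- 48 / (\<epsilon> * d))\<close>, and \<open>2 ^ (d - 1) \<le> k\<close> gives
  \<open>d\<^sup>2 \<le> 3 * k\<close>, so the exponent grows at least linearly in
  \<open>k\<close>.\<close>

lemma family_vimage_bound:
  assumes k: "k \<ge> 1" and r: "0 < r" "r \<le> 1" and d: "d = degree (family_enum k)"
    and \<epsilon>: "\<epsilon> = (r / 2 ^ k / K_const d) powr (1 / real d)"
  shows "emeasure lborel (int_poly_eval (family_enum k) -` U_plus \<epsilon>) \<le> ennreal (exp (- real k))"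
proof -
  have d1: "d \<ge> 1" using degree_family[OF family_enum_props(1)[OF k]] d by simp
  have K: "K_const d \<ge> (real d + 1) ^ d"
  proof -
    have "1 \<le> real d ^ 4" using d1 by (intro one_le_power) simp
    then have d4: "1 \<le> 4 * real d ^ 4" by linarith
    have "(real d + 1) ^ d * (1 * 1) \<le> (real d + 1) ^ d * ((real d + 1) * (4 * real d ^ 4))"
      using d4 by (intro mult_left_mono mult_mono) auto
    also have "\<dots> = K_const d" by (simp add: K_const_def add.commute[of _ "real d"] mult_ac)
    finally show ?thesis by simp
  qed
  have K1: "(real d + 1) ^ d \<ge> 1" by (intro one_le_power) simp
  have Kpos: "K_const d > 0" using K K1 by linarith
  define y where "y = 2 ^ k * (real d + 1) ^ d"
  have y1: "y \<ge> 1" using mult_mono[of 1 "2 ^ k :: real" 1 "(real d + 1) ^ d"] K1 by (simp add: y_def)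
  have "r / 2 ^ k / K_const d \<le> 1 / y"
    using r K K1 by (simp add: y_def divide_divide_eq_left) (intro frac_le mult_mono, auto)
  moreover have rpos: "0 < r / 2 ^ k / K_const d" using r Kpos by simp
  ultimately have "\<epsilon> \<le> (1 / y) powr (1 / real d)" unfolding \<epsilon> by (intro powr_mono2) auto
  also have "\<dots> = 1 / (y powr (1 / real d))" using y1 by (simp add: powr_divide)
  also have "y powr (1 / real d) = 2 powr (real k / real d) * (real d + 1)"
    using d1 by (simp add: y_def powr_mult powr_powr flip: powr_realpow)
  finally have \<epsilon>le: "\<epsilon> \<le> 1 / (2 powr (real k / real d) * (real d + 1))" .
  have \<epsilon>0: "\<epsilon> > 0" unfolding \<epsilon> using r Kpos by simp
  have two1: "2 powr (real k / real d) \<ge> 1" using ge_one_powr_ge_zero[of 2 "real k / real d"] by simp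
  have "1 * 1 \<le> 2 powr (real k / real d) * (real d + 1)" using two1 by (intro mult_mono) auto
  then have "1 / (2 powr (real k / real d) * (real d + 1)) \<le> 1 / 1" by (intro frac_le) auto
  from order_trans[OF \<epsilon>le this] have \<epsilon>1: "\<epsilon> \<le> 1" by simp
  have sq: "real d ^ 2 \<le> 3 * real k"
  proof -
    have "d\<^sup>2 \<le> 3 * 2 ^ (d - 1)" using square_le_exponential[of "d - 1"] d1 by simp
    also have "\<dots> \<le> 3 * k" using family_enum_index_ge[OF k] d by simp
    finally have "real (d\<^sup>2) \<le> real (3 * k)" by (rule of_nat_mono)
    then show ?thesis by simp
  qed
  \<comment> \<open>From \<open>exp t \<ge> t\<^sup>2 / 2\<close>, \<open>ln 2 \<ge> 2 / 3\<close>
    and \<open>d\<^sup>2 \<le> 3 * k\<close>: half of \<open>(4 / 9) * (k / 3)\<close> is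
    \<open>2 * k / 27\<close>. As \<open>48 * 2 / 27 \<ge> 3\<close>, the exponent reaches
    \<open>3 * k\<close>, of which \<open>2 * k\<close> pays for \<open>4 * d\<close>.\<close>
  have two: "2 * real k / 27 \<le> 2 powr (real k / real d)"
  proof -
    define t where "t = real k / real d * ln 2"
    have t0: "t \<ge> 0" by (simp add: t_def)
    have "real k / real d * (2 / 3) \<le> t" unfolding t_def using ln2_ge_two_thirds by (intro mult_left_mono) auto
    then have "(real k / real d * (2 / 3))\<^sup>2 \<le> t\<^sup>2" by (intro power_mono) auto
    moreover have "real k * real k / (3 * real k) \<le> real k * real k / (real d)\<^sup>2"
      using sq d1 k by (intro divide_left_mono) auto
    then have "real k / 3 \<le> (real k / real d)\<^sup>2" using k by (simp add: power_divide power2_eq_square)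
    ultimately have "2 * real k / 27 \<le> t\<^sup>2 / 2" by (simp add: power_mult_distrib power_divide)
    also have "\<dots> \<le> exp t" using exp_lower_Taylor_quadratic[OF t0] t0 by linarith
    finally show ?thesis by (simp add: t_def powr_def)
  qed
  have "real d * (2 * real k / 27) \<le> (real d + 1) * 2 powr (real k / real d)" using two by (intro mult_mono) auto
  also have "\<dots> = 1 / (1 / (2 powr (real k / real d) * (real d + 1)))" by simp
  also have "\<dots> \<le> 1 / \<epsilon>" using \<epsilon>le \<epsilon>0 by (intro frac_le) auto
  finally have key: "2 * real k / 27 \<le> 1 / \<epsilon> / real d"
    using d1 by (subst pos_le_divide_eq) (simp_all add: mult.commute)
  have "emeasure lborel (int_poly_eval (family_enum k) -` U_plus \<epsilon>) \<le>
      ennreal (4 * real d * exp (- 48 / \<epsilon>) powr (1 / real d))"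
    by (intro emeasure_int_poly_vimage_le open_U_plus emeasure_U_plus_le \<epsilon>0 \<epsilon>1 d1) (simp_all add: d)
  also have "\<dots> \<le> ennreal (exp (- real k))"
  proof (rule ennreal_leI)
    have "exp (- 48 / \<epsilon>) powr (1 / real d) = exp (- 48 * (1 / \<epsilon> / real d))" by (simp add: powr_def)
    also have "\<dots> \<le> exp (- 3 * real k)" using key by simp
    finally have 1: "exp (- 48 / \<epsilon>) powr (1 / real d) \<le> exp (- 3 * real k)" .
    have "d \<le> 2 ^ (d - 1)" by (metis Suc_leI Suc_pred' d1 less_eq_Suc_le less_exp One_nat_def)
    then have "real d \<le> real k" using family_enum_index_ge[OF k] d by simp
    moreover have "4 * real k \<le> exp (2 * real k)"
    proof -
      have "0 \<le> (real k)\<^sup>2 + (real k - 1)\<^sup>2" by simp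
      then have "4 * real k \<le> 1 + 2 * real k + (2 * real k)\<^sup>2 / 2" by (simp add: power2_eq_square algebra_simps)
      also have "\<dots> \<le> exp (2 * real k)" by (rule exp_lower_Taylor_quadratic) simp
      finally show ?thesis .
    qed
    ultimately have "4 * real d \<le> exp (2 * real k)" by linarith
    then have "4 * real d * exp (- 48 / \<epsilon>) powr (1 / real d) \<le> exp (2 * real k) * exp (- 3 * real k)"
      using 1 by (intro mult_mono) auto
    also have "\<dots> = exp (- real k)" by (simp flip: exp_add)
    finally show "4 * real d * exp (- 48 / \<epsilon>) powr (1 / real d) \<le> exp (- real k)" .
  qed
  finally show ?thesis .
qed

section \<open>The whole cover and the numbers outside it\<close>

lemma open_U_family: "open (U_family r)"
  unfolding U_family_def Let_def by (intro open_UN ballI open_int_poly_vimage open_U_plus)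

lemma emeasure_U_family_less_1:
  assumes r: "0 < r" "r \<le> 1" shows "emeasure lborel (U_family r) < 1"
proof -
  define A where "A k = int_poly_eval (family_enum k) -`
    U_plus ((r / 2 ^ k / K_const (degree (family_enum k))) powr (1 / real (degree (family_enum k))))" for k
  have "{1..} = range Suc" by (auto simp: image_iff Suc_le_eq gr0_conv_Suc)
  then have "U_family r = (\<Union>i. A (Suc i))" unfolding U_family_def A_def Let_def by (simp add: image_image)
  also have "emeasure lborel \<dots> \<le> ennreal (exp (- 1) * (1 + 1 / 1))"
  proof (rule emeasure_UN_exp_le)
    fix i
    show "A (Suc i) \<in> sets lborel" unfolding A_def using open_int_poly_vimage[OF open_U_plus] by simp
    have "emeasure lborel (A (Suc i)) \<le> ennreal (exp (- real (Suc i)))"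
      unfolding A_def by (rule family_vimage_bound[OF _ r refl refl]) simp
    then show "emeasure lborel (A (Suc i)) \<le> ennreal (exp (- 1) * exp (- 1 * real i))" by (simp flip: exp_add)
  qed auto
  also have "\<dots> < 1"
  proof -
    have "1 + 1 + 1\<^sup>2 / 2 \<le> exp (1 :: real)" by (rule exp_lower_Taylor_quadratic) simp
    then have "exp (- 1) * (1 + 1 / 1) < (1 :: real)" by (simp add: exp_minus field_simps)
    then show ?thesis by (simp add: ennreal_less_one_iff)
  qed
  finally show ?thesis .
qed

text \<open>The \<open>\<epsilon>\<close> may depend on \<open>p\<close>. This serves both the radii
  prescribed in \<open>U_family\<close> and, for the null set, radii tending to \<open>0\<close> for
  one polynomial.\<close>

lemma transcendentally_normal_if_avoids:
  assumes "\<And>p. p \<in> poly_family \<Longrightarrow> \<exists>\<epsilon>. int_poly_eval p x \<notin> U_plus \<epsilon>"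
  shows "transcendentally_normal x"
proof (rule transcendentally_normal_if_balanced)
  fix p and b m d :: nat assume *: "p \<in> poly_family" "b \<ge> 2" "m \<ge> 1" "d < b"
  from assms[OF *(1)] obtain \<epsilon> where "int_poly_eval p x \<notin> U_plus \<epsilon>" by blast
  from balanced_if_notin_U_plus[OF this *(2-)]
  show "\<forall>\<^sub>F n in sequentially. balanced b m n d (frac (int_poly_eval p x))" .
qed

lemma transcendentally_normal_if_notin_U_family:
  assumes "x \<notin> U_family r" shows "transcendentally_normal x"
proof (rule transcendentally_normal_if_avoids)
  fix p assume "p \<in> poly_family"
  then obtain k where "k \<ge> 1" "family_enum k = p" by (rule family_enum_surj)
  with assms show "\<exists>\<epsilon>. int_poly_eval p x \<notin> U_plus \<epsilon>" by (auto simp: U_family_def Let_def)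
qed

text \<open>The cover is open, so the candidates form a closed set that contains its infimum; a
  measure below \<open>1\<close> cannot cover the unit interval.\<close>

lemma sierpinski_number_transcendentally_normal:
  assumes r: "0 < r" "r \<le> 1"
  shows "sierpinski_candidates r \<noteq> {}" "transcendentally_normal (sierpinski_number r)"
proof -
  have eq: "sierpinski_candidates r = {0..1} \<inter> - U_family r" by (auto simp: sierpinski_candidates_def)
  show ne: "sierpinski_candidates r \<noteq> {}"
  proof
    assume "sierpinski_candidates r = {}"
    then have "{0..1} \<subseteq> U_family r" unfolding eq by blast
    then have "emeasure lborel {0..1::real} \<le> emeasure lborel (U_family r)"
      using open_U_family[of r] by (intro emeasure_mono) auto
    with emeasure_U_family_less_1[OF r] show False by simp
  qed
  have "closed (sierpinski_candidates r)" unfolding eq using open_U_family by (intro closed_Int) auto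
  moreover have "bdd_below (sierpinski_candidates r)" by (rule bdd_belowI[of _ 0]) (auto simp: eq)
  ultimately have "sierpinski_number r \<in> sierpinski_candidates r"
    unfolding sierpinski_number_def using ne by (intro closed_contains_Inf)
  then show "transcendentally_normal (sierpinski_number r)"
    by (intro transcendentally_normal_if_notin_U_family[of _ r]) (simp add: sierpinski_candidates_def)
qed

section \<open>Full measure\<close>

lemma countable_family: "countable poly_family"
proof -
  have "poly_family \<subseteq> range family_enum" by (auto elim: family_enum_surj)
  then show ?thesis by (rule countable_subset) simp
qed

lemma null_not_transcendentally_normal: "UNIV - Omega_infty \<in> null_sets lebesgue"
proof -
  \<comment> \<open>Avoiding one of these covers suffices for \<open>p\<close>, so only points in
    all of them are lost, and their measures tend to \<open>0\<close>.\<close>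
  define N where "N p = (\<Inter>i. int_poly_eval p -` U_plus (1 / real (Suc i)))" for p
  have null: "N p \<in> null_sets lborel" if p: "p \<in> poly_family" for p
  proof -
    define d where "d = degree p"
    have d: "d \<ge> 1" using degree_family[OF p] by (simp add: d_def)
    have op: "int_poly_eval p -` U_plus \<epsilon> \<in> sets lborel" for \<epsilon> using open_int_poly_vimage[OF open_U_plus] by simp
    have meas: "N p \<in> sets lborel" unfolding N_def using op by auto
    have "emeasure lborel (N p) \<le> ennreal (4 * real d * exp (- 48 / real d * real (Suc i)))" for i
    proof -
      have "emeasure lborel (N p) \<le> emeasure lborel (int_poly_eval p -` U_plus (1 / real (Suc i)))"
        unfolding N_def by (intro emeasure_mono op) auto
      also have "\<dots> \<le> ennreal (4 * real d * exp (- 48 / (1 / real (Suc i))) powr (1 / real d))"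
        by (intro emeasure_int_poly_vimage_le open_U_plus emeasure_U_plus_le d) (simp_all add: d_def)
      also have "exp (- 48 / (1 / real (Suc i))) powr (1 / real d) = exp (- 48 / real d * real (Suc i))"
        by (simp add: powr_def algebra_simps add_divide_distrib)
      finally show ?thesis .
    qed
    moreover have "(\<lambda>i. ennreal (4 * real d * exp (- 48 / real d * real (Suc i)))) \<longlonglongrightarrow> ennreal (4 * real d * 0)"
    proof (intro tendsto_ennrealI tendsto_mult tendsto_const)
      have "(\<lambda>i. exp (- 48 / real d) ^ Suc i) \<longlonglongrightarrow> 0"
        using d by (intro LIMSEQ_Suc LIMSEQ_power_zero) auto
      then show "(\<lambda>i. exp (- 48 / real d * real (Suc i))) \<longlonglongrightarrow> 0"
        by (simp only: exp_of_nat_mult[symmetric] mult.commute[of "real (Suc _)"])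
    qed
    ultimately have "emeasure lborel (N p) \<le> ennreal (4 * real d * 0)"
      by (intro LIMSEQ_le_const) auto
    then show ?thesis using meas by (simp add: null_sets_def)
  qed
  have "(\<Union>p\<in>poly_family. N p) \<in> null_sets lborel"
    by (intro null_sets_UN' countable_family null)
  moreover have "UNIV - Omega_infty \<subseteq> (\<Union>p\<in>poly_family. N p)"
  proof (rule subsetI, rule ccontr)
    fix x assume x: "x \<in> UNIV - Omega_infty" "x \<notin> (\<Union>p\<in>poly_family. N p)"
    then have "transcendentally_normal x"
      by (intro transcendentally_normal_if_avoids) (auto simp: N_def)
    with x(1) show False by (simp add: Omega_infty_def)
  qed
  ultimately show ?thesis using null_sets_completion_subset null_sets_completionI by blast
qed

section \<open>A computable transcendentally normal number\<close>

text \<open>An unbounded inverse of \<open>c ^ (20 * c)\<close>: for \<open>c = slow t\<close> and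
  \<open>t \<ge> 1\<close> the number \<open>c ^ c\<close> of coded coefficient lists is at most
  \<open>t\<close>. The \<open>20\<close> extends this to small fixed powers such as
  \<open>c ^ 6\<close>.\<close>

definition slow :: "nat \<Rightarrow> nat" where
  "slow t = (LEAST c. t < Suc c ^ (20 * Suc c))"

text \<open>At least \<open>1 + t + t * (t + 1)\<^sup>2\<close>, so that the grid error scaled by
  \<open>b ^ n\<close> stays below \<open>1 / 2\<close> for all bases and lengths of stage
  \<open>t\<close>.\<close>

definition level :: "nat \<Rightarrow> nat" where
  "level t = (t + 2) ^ 3"

text \<open>A number below \<open>c ^ c\<close> codes a list of \<open>c\<close> coefficients, so
  that bounded quantifiers range over polynomials.\<close>

definition coef :: "nat \<Rightarrow> nat \<Rightarrow> nat \<Rightarrow> nat" where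
  "coef c u j = u div c ^ j mod c"

text \<open>\<open>numer c e u w i / 2 ^ (e * c)\<close> is the value at \<open>i / 2 ^ e\<close>, shifted by \<open>c\<^sup>2 + 1\<close> to keep it positive.\<close>
definition numer :: "nat \<Rightarrow> nat \<Rightarrow> nat \<Rightarrow> nat \<Rightarrow> nat \<Rightarrow> nat" where
  "numer c e u w i = (\<Sum>j<c. coef c u j * (i ^ j * 2 ^ (e * (c - j)))) + (c * c + 1) * 2 ^ (e * c)
     - (\<Sum>j<c. coef c w j * (i ^ j * 2 ^ (e * (c - j))))"

text \<open>\<open>u\<close> and \<open>w\<close> carry positive and negative parts of the
  coefficients, which keeps the tests within the natural numbers.\<close>

definition stage_poly :: "nat \<Rightarrow> nat \<Rightarrow> nat \<Rightarrow> int poly" where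
  "stage_poly c u w = (\<Sum>j<c. monom (int (coef c u j) - int (coef c w j)) j)"

text \<open>The condition \<open>\<bar>cnt / n - 1 / b\<bar> \<ge> 1 / m\<close> multiplied by
  \<open>n * b * m\<close>. At most one of the two truncated differences is nonzero, so their sum is
  an absolute value.\<close>

definition unbalanced_digits :: "nat \<Rightarrow> nat \<Rightarrow> nat \<Rightarrow> nat \<Rightarrow> nat \<Rightarrow> bool" where
  "unbalanced_digits b m n d h \<longleftrightarrow>
     n * b \<le> (b * (\<Sum>j<n. if h div b ^ j mod b = d then 1 else 0) - n) * m +
             (n - b * (\<Sum>j<n. if h div b ^ j mod b = d then 1 else 0)) * m"

text \<open>For \<open>N \<ge> D\<close> this and \<open>round_down\<close> are the floors of
  \<open>N / D * b ^ n + 1 / 2\<close> and \<open>N / D * b ^ n - 1 / 2\<close>. Any number closer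
  than \<open>1 / 2\<close> to \<open>N / D * b ^ n\<close> has one of them as its floor.\<close>

definition round_up :: "nat \<Rightarrow> nat \<Rightarrow> nat \<Rightarrow> nat \<Rightarrow> nat" where
  "round_up N D b n = (2 * N * b ^ n + D) div (2 * D)"

definition round_down :: "nat \<Rightarrow> nat \<Rightarrow> nat \<Rightarrow> nat \<Rightarrow> nat" where
  "round_down N D b n = (2 * N * b ^ n - D) div (2 * D)"

text \<open>\<open>slow t\<close> is at once the bound for degree, coefficients and bases and the
  precision.\<close>

definition stage_test :: "nat \<Rightarrow> nat \<Rightarrow> bool" where
  "stage_test t i \<longleftrightarrow>
     (\<exists>u<slow t ^ slow t. \<exists>w<slow t ^ slow t.
       (\<exists>j<slow t. 1 \<le> j \<and> coef (slow t) u j \<noteq> coef (slow t) w j) \<and>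
       (\<exists>b<Suc (slow t). 2 \<le> b \<and> (\<exists>d<b. \<exists>n<(t + 1) ^ 2. t ^ 2 \<le> n \<and>
         (unbalanced_digits b (slow t) n d (round_up (numer (slow t) (level t) u w i) (2 ^ (level t * slow t)) b n) \<or>
          unbalanced_digits b (slow t) n d (round_down (numer (slow t) (level t) u w i) (2 ^ (level t * slow t)) b n)))))"

section \<open>Computability and growth of the stage parameters\<close>

lemma slow_ex: "\<exists>c. t < Suc c ^ (20 * Suc c)"
proof
  have "t < 2 ^ t" by (rule less_exp)
  also have "\<dots> \<le> (Suc t + 1) ^ t" by (intro power_mono) auto
  also have "\<dots> \<le> (Suc t + 1) ^ (20 * Suc (Suc t))" by (intro power_increasing) auto
  finally show "t < Suc (Suc t) ^ (20 * Suc (Suc t))" by simp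
qed

lemma slow_computable: "computable 1 (\<lambda>v. slow (v 0))"
  unfolding slow_def by (intro computable_intros slow_ex) auto

lemma level_computable: "computable 1 (\<lambda>v. level (v 0))"
  unfolding level_def by (intro computable_intros) auto

lemma stage_test_decidable: "decidable 2 (\<lambda>v. stage_test (v 0) (v 1))"
  unfolding stage_test_def unbalanced_digits_def round_up_def round_down_def numer_def coef_def
  by (intro computable_intros computable_compose1[OF slow_computable] computable_compose1[OF level_computable]) auto

lemma slow_power_le:
  assumes "t \<ge> 1" shows "slow t ^ (20 * slow t) \<le> t"
proof (cases "slow t")
  case (Suc c)
  then have "\<not> t < Suc c ^ (20 * Suc c)"
    using not_less_Least[of c "\<lambda>c. t < Suc c ^ (20 * Suc c)"] unfolding slow_def by simp
  with Suc show ?thesis by simp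
qed (use assms in simp)

lemma slow_ge:
  assumes "C ^ (20 * C) \<le> t" shows "C \<le> slow t"
proof (rule ccontr)
  assume "\<not> C \<le> slow t"
  have "t < Suc (slow t) ^ (20 * Suc (slow t))"
    using LeastI_ex[OF slow_ex[of t]] by (simp only: slow_def)
  also have "\<dots> \<le> C ^ (20 * Suc (slow t))" using \<open>\<not> C \<le> slow t\<close> by (intro power_mono) auto
  also have "\<dots> \<le> C ^ (20 * C)" using \<open>\<not> C \<le> slow t\<close> by (intro power_increasing) auto
  finally show False using assms by simp
qed

lemma slow_bounds:
  assumes "t \<ge> 1"
  shows "slow t \<ge> 1" "slow t ^ slow t \<le> t" "slow t \<le> t" "slow t ^ 3 \<le> t" "slow t ^ 6 \<le> t"
proof -
  show c: "slow t \<ge> 1" using slow_ge[of 1 t] assms by simp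
  have "slow t ^ k \<le> t" if "k \<le> 20 * slow t" for k
  proof -
    have "slow t ^ k \<le> slow t ^ (20 * slow t)" using c that by (intro power_increasing) auto
    also have "\<dots> \<le> t" by (rule slow_power_le[OF assms])
    finally show ?thesis .
  qed
  from this[of "slow t"] this[of 1] this[of 3] this[of 6] c
  show "slow t ^ slow t \<le> t" "slow t \<le> t" "slow t ^ 3 \<le> t" "slow t ^ 6 \<le> t" by auto
qed

section \<open>Coded polynomials at grid points\<close>

lemma coef_sum:
  fixes a :: "nat \<Rightarrow> nat"
  assumes "\<And>j. j < n \<Longrightarrow> a j < c"
  shows "(\<Sum>j<n. a j * c ^ j) < c ^ n" "\<And>j. j < n \<Longrightarrow> coef c (\<Sum>j<n. a j * c ^ j) j = a j"
proof -
  have "(\<Sum>j<n. a j * c ^ j) < c ^ n \<and> (\<forall>j<n. coef c (\<Sum>j<n. a j * c ^ j) j = a j)"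
    using assms
  proof (induction n arbitrary: a)
    case (Suc n)
    let ?S = "\<Sum>j<n. a (Suc j) * c ^ j"
    have split: "(\<Sum>j<Suc n. a j * c ^ j) = a 0 + c * ?S"
      unfolding sum.lessThan_Suc_shift by (simp add: sum_distrib_left mult_ac)
    have IH: "?S < c ^ n" "\<forall>j<n. coef c ?S j = a (Suc j)" using Suc.IH[of "\<lambda>j. a (Suc j)"] Suc.prems by auto
    have a0: "a 0 < c" using Suc.prems by simp
    have "c * (?S + 1) \<le> c * c ^ n" using IH(1) by (intro mult_le_mono2) simp
    then have "a 0 + c * ?S < c ^ Suc n" using a0 by simp
    moreover have "coef c (a 0 + c * ?S) j = a j" if "j < Suc n" for j
    proof (cases j)
      case (Suc i)
      have "(a 0 + c * ?S) div c = ?S" using a0 by simp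
      then show ?thesis using IH(2) that Suc by (simp add: coef_def div_mult2_eq)
    qed (use a0 in \<open>simp add: coef_def\<close>)
    ultimately show ?case unfolding split by blast
  qed simp
  then show "(\<Sum>j<n. a j * c ^ j) < c ^ n" "\<And>j. j < n \<Longrightarrow> coef c (\<Sum>j<n. a j * c ^ j) j = a j" by auto
qed

lemma coeff_stage_poly:
  "coeff (stage_poly c u w) k = (if k < c then int (coef c u k) - int (coef c w k) else 0)"
  by (simp add: stage_poly_def coeff_sum if_distrib[of "\<lambda>x. x = _"] cong: if_cong)

lemma int_poly_eval_stage_poly:
  "int_poly_eval (stage_poly c u w) x = (\<Sum>j<c. (real (coef c u j) - real (coef c w j)) * x ^ j)"
proof -
  have "map_poly real_of_int (stage_poly c u w) = (\<Sum>j<c. monom (real (coef c u j) - real (coef c w j)) j)"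
    by (rule poly_eqI) (simp add: coeff_map_poly coeff_stage_poly coeff_sum)
  then show ?thesis by (simp add: int_poly_eval_def poly_sum poly_monom)
qed

lemma stage_poly_surj:
  assumes "\<And>k. \<bar>coeff p k\<bar> < int c" "degree p < c"
  obtains u w where "u < c ^ c" "w < c ^ c" "stage_poly c u w = p"
proof -
  define u where "u = (\<Sum>j<c. nat (coeff p j) * c ^ j)"
  define w where "w = (\<Sum>j<c. nat (- coeff p j) * c ^ j)"
  have lt: "nat (coeff p j) < c" "nat (- coeff p j) < c" for j using assms(1)[of j] by auto
  have "coeff (stage_poly c u w) k = coeff p k" for k
    using coef_sum(2)[of c "\<lambda>j. nat (coeff p j)" c k] coef_sum(2)[of c "\<lambda>j. nat (- coeff p j)" c k] lt assms(2)
    by (auto simp: coeff_stage_poly u_def w_def coeff_eq_0)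
  then have "stage_poly c u w = p" by (rule poly_eqI)
  moreover have "u < c ^ c" "w < c ^ c" unfolding u_def w_def by (intro coef_sum(1) lt)+
  ultimately show thesis using that by blast
qed

lemma coef_less: "c \<ge> 1 \<Longrightarrow> coef c u j < c"
  by (simp add: coef_def)

lemma abs_coef_diff_le: "c \<ge> 1 \<Longrightarrow> \<bar>real (coef c u j) - real (coef c w j)\<bar> \<le> real c"
  using coef_less[of c u j] coef_less[of c w j] by linarith

lemma stage_poly_abs_le:
  assumes "c \<ge> 1" "0 \<le> x" "x \<le> 1"
  shows "\<bar>int_poly_eval (stage_poly c u w) x\<bar> \<le> real (c * c)"
proof -
  have "\<bar>int_poly_eval (stage_poly c u w) x\<bar> \<le> (\<Sum>j<c. \<bar>(real (coef c u j) - real (coef c w j)) * x ^ j\<bar>)"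
    unfolding int_poly_eval_stage_poly by (rule sum_abs)
  also have "\<dots> \<le> (\<Sum>j<c. real c * 1)"
    unfolding abs_mult using assms abs_coef_diff_le by (intro sum_mono mult_mono) (auto simp: power_le_one)
  finally show ?thesis by simp
qed

text \<open>One factor \<open>c\<close> for the number of terms, one for the coefficients, one for
  the slope of \<open>x ^ j\<close> on the unit interval.\<close>

lemma stage_poly_lipschitz:
  assumes "c \<ge> 1" "0 \<le> x" "x \<le> 1" "0 \<le> y" "y \<le> 1"
  shows "\<bar>int_poly_eval (stage_poly c u w) x - int_poly_eval (stage_poly c u w) y\<bar> \<le> real c ^ 3 * \<bar>x - y\<bar>"
proof -
  have "\<bar>int_poly_eval (stage_poly c u w) x - int_poly_eval (stage_poly c u w) y\<bar> =
      \<bar>\<Sum>j<c. (real (coef c u j) - real (coef c w j)) * (x ^ j - y ^ j)\<bar>"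
    unfolding int_poly_eval_stage_poly by (simp add: sum_subtractf right_diff_distrib)
  also have "\<dots> \<le> (\<Sum>j<c. \<bar>(real (coef c u j) - real (coef c w j)) * (x ^ j - y ^ j)\<bar>)" by (rule sum_abs)
  also have "\<dots> \<le> (\<Sum>j<c. real c * (real c * \<bar>x - y\<bar>))"
    unfolding abs_mult
  proof (intro sum_mono mult_mono)
    fix j assume "j \<in> {..<c}"
    have "\<bar>x ^ j - y ^ j\<bar> \<le> real j * \<bar>x - y\<bar>" using norm_power_diff[of x y j] assms by simp
    also have "\<dots> \<le> real c * \<bar>x - y\<bar>" using \<open>j \<in> {..<c}\<close> by (intro mult_right_mono) auto
    finally show "\<bar>x ^ j - y ^ j\<bar> \<le> real c * \<bar>x - y\<bar>" .
  qed (use assms abs_coef_diff_le in auto)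
  finally show ?thesis by (simp add: power3_eq_cube mult_ac)
qed

lemma numer_eq:
  assumes "c \<ge> 1" "i \<le> 2 ^ e"
  shows "real (numer c e u w i) / 2 ^ (e * c) =
     int_poly_eval (stage_poly c u w) (real i / 2 ^ e) + real (c * c + 1)"
proof -
  let ?T = "\<lambda>j. i ^ j * 2 ^ (e * (c - j))"
  have T: "real (?T j) = (real i / 2 ^ e) ^ j * 2 ^ (e * c)" if "j < c" for j
  proof -
    have "e * c = e * (c - j) + e * j" using that by (simp flip: distrib_left)
    then have "(2::real) ^ (e * c) = 2 ^ (e * (c - j)) * (2 ^ e) ^ j" by (simp add: power_add power_mult)
    then show ?thesis by (simp add: power_divide)
  qed
  \<comment> \<open>The shift by \<open>c * c + 1\<close> exceeds the negative part, so the
    subtraction in \<open>numer\<close> does not truncate.\<close>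
  have "(\<Sum>j<c. coef c w j * ?T j) \<le> (\<Sum>j<c. c * 2 ^ (e * c))"
  proof (intro sum_mono mult_mono)
    fix j assume j: "j \<in> {..<c}"
    show "coef c w j \<le> c" using coef_less[OF assms(1)] by (simp add: less_imp_le)
    have "i ^ j \<le> (2 ^ e) ^ j" using assms by (intro power_mono) auto
    then have "?T j \<le> (2 ^ e) ^ j * 2 ^ (e * (c - j))" by simp
    also have "\<dots> = 2 ^ (e * c)" using j by (simp flip: power_mult power_add distrib_left)
    finally show "?T j \<le> 2 ^ (e * c)" .
  qed auto
  then have le: "(\<Sum>j<c. coef c w j * ?T j) \<le> (c * c + 1) * 2 ^ (e * c)" by simp
  have sums: "real (\<Sum>j<c. coef c a j * ?T j) = (\<Sum>j<c. real (coef c a j) * (real i / 2 ^ e) ^ j) * 2 ^ (e * c)" for a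
    unfolding of_nat_sum sum_distrib_right of_nat_mult[of "coef c a _"]
    by (intro sum.cong refl) (subst T, auto)
  have "real (numer c e u w i) = real (\<Sum>j<c. coef c u j * ?T j) + real ((c * c + 1) * 2 ^ (e * c)) - real (\<Sum>j<c. coef c w j * ?T j)"
    unfolding numer_def using le by (subst of_nat_diff) (auto simp del: of_nat_sum of_nat_mult)
  also have "\<dots> = (int_poly_eval (stage_poly c u w) (real i / 2 ^ e) + real (c * c + 1)) * 2 ^ (e * c)"
    unfolding sums int_poly_eval_stage_poly by (simp add: algebra_simps sum_subtractf)
  finally show ?thesis by simp
qed

section \<open>Integer tests against digits of real values\<close>

lemma unbalanced_digits_iff:
  assumes b: "b \<ge> 2" and m: "m \<ge> 1" and n: "n \<ge> 1" and Y: "Y \<ge> 0"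
  shows "unbalanced_digits b m n d (nat \<lfloor>Y * real b ^ n\<rfloor>) \<longleftrightarrow> \<not> balanced b m n d (frac Y)"
proof -
  define h where "h = nat \<lfloor>Y * real b ^ n\<rfloor>"
  define cnt where "cnt = card {j \<in> {1..n}. digit b (frac Y) j = d}"
  have dig: "digit b (frac Y) j = h div b ^ (n - j) mod b" if "j \<in> {1..n}" for j
    using nat_floor_power_div[of Y b j "n - j"] digit_frac[of Y b j] that b Y by (simp add: h_def digit_def)
  have "(\<Sum>j<n. if h div b ^ j mod b = d then 1 else 0) = card {j. j < n \<and> h div b ^ j mod b = d}"
    by (simp add: sum.If_cases Int_def)
  also have "\<dots> = cnt" unfolding cnt_def
  \<comment> \<open>\<open>unbalanced_digits\<close> reads from the least significant digit,
    \<open>digit\<close> from the radix point.\<close>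
  proof (rule bij_betw_same_card[of "\<lambda>j. n - j"])
    show "bij_betw (\<lambda>j. n - j) {j. j < n \<and> h div b ^ j mod b = d} {j \<in> {1..n}. digit b (frac Y) j = d}"
      by (rule bij_betw_byWitness[where f' = "\<lambda>j. n - j"]) (auto simp: dig)
  qed
  finally have cnt: "(\<Sum>j<n. if h div b ^ j mod b = d then 1 else 0) = cnt" .
  have "unbalanced_digits b m n d h \<longleftrightarrow> real (n * b) \<le> real ((b * cnt - n) * m + (n - b * cnt) * m)"
    unfolding unbalanced_digits_def cnt by (simp only: of_nat_le_iff)
  also have "real ((b * cnt - n) * m + (n - b * cnt) * m) = \<bar>real b * real cnt - real n\<bar> * real m"
  proof -
    have "real ((p - q) * m + (q - p) * m) = \<bar>real p - real q\<bar> * real m" for p q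
      by (cases "p \<le> q") (auto simp: of_nat_diff)
    from this[of "b * cnt" n] show ?thesis by simp
  qed
  also have "real (n * b) \<le> \<bar>real b * real cnt - real n\<bar> * real m \<longleftrightarrow>
      1 / real m \<le> \<bar>real b * real cnt - real n\<bar> / (real n * real b)"
    using b m n by (simp add: field_simps)
  also have "\<bar>real b * real cnt - real n\<bar> / (real n * real b) = \<bar>real cnt / real n - 1 / real b\<bar>"
  proof -
    have "real cnt / real n - 1 / real b = (real b * real cnt - real n) / (real n * real b)"
      using b n by (simp add: field_simps)
    then show ?thesis by (simp add: abs_divide)
  qed
  finally show ?thesis by (simp add: balanced_def h_def cnt_def not_less)
qed

lemma round_eq:
  assumes D: "D > 0" and Y: "Y = real N / real D" and pos: "1 \<le> Y" and b: "b \<ge> 1"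
  shows "round_up N D b n = nat \<lfloor>Y * real b ^ n + 1 / 2\<rfloor>" "round_down N D b n = nat \<lfloor>Y * real b ^ n - 1 / 2\<rfloor>"
proof -
  have "real (2 * N * b ^ n + D) / real (2 * D) = Y * real b ^ n + 1 / 2"
    using D by (simp add: Y field_simps)
  then show "round_up N D b n = nat \<lfloor>Y * real b ^ n + 1 / 2\<rfloor>"
    unfolding round_up_def using floor_divide_of_nat_eq[of "2 * N * b ^ n + D" "2 * D", where 'a = real] by simp
  \<comment> \<open>\<open>Y \<ge> 1\<close> keeps the subtraction in \<open>round_down\<close> from
    truncating.\<close>
  have "D \<le> N" using pos D by (simp add: Y)
  moreover have "1 \<le> b ^ n" using b by simp
  ultimately have le: "D \<le> 2 * N * b ^ n" using mult_le_mono[of D N 1 "b ^ n"] by linarith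
  then have "real (2 * N * b ^ n - D) / real (2 * D) = Y * real b ^ n - 1 / 2"
    using D by (simp add: Y field_simps of_nat_diff)
  then show "round_down N D b n = nat \<lfloor>Y * real b ^ n - 1 / 2\<rfloor>"
    unfolding round_down_def using floor_divide_of_nat_eq[of "2 * N * b ^ n - D" "2 * D", where 'a = real] by simp
qed

lemma level_sufficient:
  assumes t: "t \<ge> 1" and b: "b \<le> slow t" and n: "n < (t + 1) ^ 2"
  shows "real (slow t) ^ 3 * (1 / 2 ^ level t) * real b ^ n < 1 / 2"
proof -
  have bt: "b \<le> 2 ^ t" using b slow_bounds(3)[OF t] less_exp[of t] by linarith
  have "t * n \<le> t * (t + 1) ^ 2" using n by (intro mult_le_mono2) simp
  then have exps: "1 + t + t * n \<le> level t"
    by (simp add: level_def power2_eq_square power3_eq_cube algebra_simps)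
  have "b ^ n \<le> (2 ^ t) ^ n" using bt by (intro power_mono) auto
  then have "2 * slow t ^ 3 * b ^ n \<le> 2 * t * 2 ^ (t * n)"
    using slow_bounds(4)[OF t] by (intro mult_le_mono) (auto simp: power_mult)
  also have "\<dots> < 2 * 2 ^ t * 2 ^ (t * n)" using less_exp[of t] by simp
  also have "\<dots> = 2 ^ (1 + t + t * n)" by (simp add: power_add)
  also have "\<dots> \<le> 2 ^ level t" using exps by (intro power_increasing) auto
  finally have "real (2 * slow t ^ 3 * b ^ n) < real (2 ^ level t)" by (simp only: of_nat_less_iff)
  then show ?thesis by (simp add: field_simps)
qed

lemma frac_add_nat: "frac (a + real k) = frac a"
  by (simp add: frac_def)

text \<open>The scaled grid value differs from the scaled value at \<open>x\<close> by less than
  \<open>1 / 2\<close>, so the digits at \<open>x\<close> are those of one of the two tested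
  roundings. The cell is closed, to match \<open>point_avoids\<close>.\<close>

lemma stage_test_if_unbalanced:
  fixes t u w b d n i :: nat
  defines "c \<equiv> slow t" and "e \<equiv> level t"
  assumes t: "t \<ge> 1" and uw: "u < c ^ c" "w < c ^ c" "\<exists>j<c. 1 \<le> j \<and> coef c u j \<noteq> coef c w j"
    and b: "2 \<le> b" "b \<le> c" and d: "d < b" and n: "t ^ 2 \<le> n" "n < (t + 1) ^ 2"
    and x: "0 \<le> x" "x \<le> 1" "real i / 2 ^ e \<le> x" "x \<le> (real i + 1) / 2 ^ e"
    and unbal: "\<not> balanced b c n d (frac (int_poly_eval (stage_poly c u w) x))"
  shows "stage_test t i"
proof -
  let ?P = "int_poly_eval (stage_poly c u w)"
  have c: "c \<ge> 1" using slow_bounds(1)[OF t] by (simp add: c_def)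
  have n1: "n \<ge> 1" using n t by (metis le_trans one_le_power)
  have i1: "real i / 2 ^ e \<le> 1" using x by linarith
  then have "real i \<le> real (2 ^ e)" by simp
  then have ie: "i \<le> 2 ^ e" by (simp only: of_nat_le_iff)
  define Y where "Y = ?P (real i / 2 ^ e) + real (c * c + 1)"
  define Y' where "Y' = ?P x + real (c * c + 1)"
  have Y1: "Y \<ge> 1" using stage_poly_abs_le[OF c _ i1, of u w] by (simp add: Y_def)
  have Y'0: "Y' \<ge> 0" using stage_poly_abs_le[OF c x(1,2), of u w] by (simp add: Y'_def)
  have near: "\<bar>Y * real b ^ n - Y' * real b ^ n\<bar> < 1 / 2"
  proof -
    have "\<bar>Y - Y'\<bar> \<le> real c ^ 3 * \<bar>real i / 2 ^ e - x\<bar>"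
      using stage_poly_lipschitz[OF c _ i1 x(1,2), of u w] by (simp add: Y_def Y'_def)
    also have "\<dots> \<le> real c ^ 3 * (1 / 2 ^ e)"
      using x by (intro mult_left_mono) (auto simp: add_divide_distrib)
    finally have "\<bar>Y - Y'\<bar> * real b ^ n \<le> real c ^ 3 * (1 / 2 ^ e) * real b ^ n" by (rule mult_right_mono) simp
    also have "\<dots> < 1 / 2" using level_sufficient[OF t _ n(2), of b] b by (simp add: c_def e_def)
    finally show ?thesis by (simp add: abs_mult flip: left_diff_distrib)
  qed
  define h where "h = nat \<lfloor>Y' * real b ^ n\<rfloor>"
  have "unbalanced_digits b c n d h"
    using unbalanced_digits_iff[OF b(1) c n1 Y'0, of d] unbal by (simp only: h_def Y'_def frac_add_nat) simp
  moreover have "\<lfloor>Y' * real b ^ n\<rfloor> = \<lfloor>Y * real b ^ n + 1 / 2\<rfloor> \<or> \<lfloor>Y' * real b ^ n\<rfloor> = \<lfloor>Y * real b ^ n - 1 / 2\<rfloor>"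
    using near by linarith
  moreover have "Y = real (numer c e u w i) / real (2 ^ (e * c))"
    using numer_eq[OF c ie, of u w] by (simp add: Y_def)
  note round_eq[OF _ this Y1, of b n]
  ultimately have "unbalanced_digits b c n d (round_up (numer c e u w i) (2 ^ (e * c)) b n) \<or>
      unbalanced_digits b c n d (round_down (numer c e u w i) (2 ^ (e * c)) b n)"
    using b by (auto simp: h_def)
  note disj = this
  have "b < Suc c" using b by simp
  show ?thesis
    unfolding stage_test_def c_def[symmetric] e_def[symmetric]
    by (rule exI[of _ u], rule conjI[OF uw(1)], rule exI[of _ w], rule conjI[OF uw(2)], rule conjI[OF uw(3)],
        rule exI[of _ b], rule conjI[OF \<open>b < Suc c\<close>], rule conjI[OF b(1)], rule exI[of _ d], rule conjI[OF d],
        rule exI[of _ n], rule conjI[OF n(2)], rule conjI[OF n(1)], rule disj)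
qed

text \<open>Values on the unit interval have modulus at most \<open>c * c\<close>; the range of
  \<open>z\<close> covers their integer parts after the shift by \<open>c * c + 1\<close>, with room
  for a neighbouring cell.\<close>

definition shifted_cells :: "nat \<Rightarrow> nat \<Rightarrow> nat \<Rightarrow> nat \<Rightarrow> real set" where
  "shifted_cells b c n d =
     (\<Union>z\<in>{..2 * c * c + 2}. (\<lambda>y. (real z - real (c * c + 1)) + y) ` U_cell b c n d)"

text \<open>The converse direction, which makes failing cells rare: the interior of a failing cell
  lies in preimages of cover cells, whose measure is known.\<close>

lemma stage_test_cell:
  fixes t i :: nat
  defines "c \<equiv> slow t" and "e \<equiv> level t"
  assumes t: "t \<ge> 1" and i: "i < 2 ^ e" and test: "stage_test t i"
    and x: "real i / 2 ^ e < x" "x < (real i + 1) / 2 ^ e"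
  obtains u w b d n where "u < c ^ c" "w < c ^ c" "\<exists>j<c. 1 \<le> j \<and> coef c u j \<noteq> coef c w j"
    "2 \<le> b" "b \<le> c" "d < b" "t ^ 2 \<le> n" "n < (t + 1) ^ 2"
    "int_poly_eval (stage_poly c u w) x \<in> shifted_cells b c n d"
proof -
  obtain u w b d n where uw: "u < c ^ c" "w < c ^ c" "\<exists>j<c. 1 \<le> j \<and> coef c u j \<noteq> coef c w j"
    and b: "2 \<le> b" "b \<le> c" and d: "d < b" and n: "t ^ 2 \<le> n" "n < (t + 1) ^ 2"
    and bad: "unbalanced_digits b c n d (round_up (numer c e u w i) (2 ^ (e * c)) b n) \<or>
      unbalanced_digits b c n d (round_down (numer c e u w i) (2 ^ (e * c)) b n)"
    using test unfolding stage_test_def c_def[symmetric] e_def[symmetric] less_Suc_eq_le by blast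
  let ?P = "int_poly_eval (stage_poly c u w)"
  have c: "c \<ge> 1" using slow_bounds(1)[OF t] by (simp add: c_def)
  have n1: "n \<ge> 1" using n t by (metis le_trans one_le_power)
  have "real (i + 1) \<le> real (2 ^ e)" using i by (simp only: of_nat_le_iff)
  then have ie1: "(real i + 1) / 2 ^ e \<le> 1" by simp
  then have i1: "real i / 2 ^ e \<le> 1" using x by linarith
  have "0 \<le> real i / 2 ^ e" by simp
  then have x01: "0 \<le> x" "x \<le> 1" using x ie1 by linarith+
  define K where "K = real (c * c + 1)"
  define Y where "Y = ?P (real i / 2 ^ e) + K"
  define Y' where "Y' = ?P x + K"
  have Y1: "Y \<ge> 1" and Yle: "Y \<le> 2 * real (c * c) + 1"
    using stage_poly_abs_le[OF c _ i1, of u w] by (auto simp: Y_def K_def)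
  have near: "\<bar>Y * real b ^ n - Y' * real b ^ n\<bar> < 1 / 2"
  proof -
    have "\<bar>Y - Y'\<bar> \<le> real c ^ 3 * \<bar>real i / 2 ^ e - x\<bar>"
      using stage_poly_lipschitz[OF c _ i1 x01, of u w] by (simp add: Y_def Y'_def)
    also have "\<dots> \<le> real c ^ 3 * (1 / 2 ^ e)"
      using x by (intro mult_left_mono) (auto simp: add_divide_distrib)
    finally have "\<bar>Y - Y'\<bar> * real b ^ n \<le> real c ^ 3 * (1 / 2 ^ e) * real b ^ n" by (rule mult_right_mono) simp
    also have "\<dots> < 1 / 2" using level_sufficient[OF t _ n(2), of b] b by (simp add: c_def e_def)
    finally show ?thesis by (simp add: abs_mult flip: left_diff_distrib)
  qed
  have bn: "real b ^ n \<ge> 1" using b by (intro one_le_power) auto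
  have A1: "Y * real b ^ n \<ge> 1" using mult_mono[OF Y1 bn] Y1 by simp
  have "Y = real (numer c e u w i) / real (2 ^ (e * c))"
    using numer_eq[OF c less_imp_le[OF i], of u w] by (simp add: Y_def K_def)
  note rnd = round_eq[OF _ this Y1, of b n]
  obtain h where h: "unbalanced_digits b c n d h" "real h - 1 / 2 \<le> Y * real b ^ n" "Y * real b ^ n < real h + 3 / 2"
  proof (cases "unbalanced_digits b c n d (round_up (numer c e u w i) (2 ^ (e * c)) b n)")
    case True
    have "real (nat \<lfloor>Y * real b ^ n + 1 / 2\<rfloor>) = of_int \<lfloor>Y * real b ^ n + 1 / 2\<rfloor>" using A1 by simp
    then show thesis using True rnd(1) b by (intro that[OF True]) (auto, linarith+)
  next
    case False
    with bad have dn: "unbalanced_digits b c n d (round_down (numer c e u w i) (2 ^ (e * c)) b n)" by simp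
    have "real (nat \<lfloor>Y * real b ^ n - 1 / 2\<rfloor>) = of_int \<lfloor>Y * real b ^ n - 1 / 2\<rfloor>" using A1 by simp
    then show thesis using rnd(2) b by (intro that[OF dn]) (auto, linarith+)
  qed
  define V where "V = real h / real b ^ n"
  have V0: "V \<ge> 0" by (simp add: V_def)
  have Vb: "V * real b ^ n = real h" using b by (simp add: V_def)
  have unbal: "\<not> balanced b c n d (frac V)"
    using unbalanced_digits_iff[OF b(1) c n1 V0, of d] h(1) by (simp add: Vb)
  define z where "z = nat \<lfloor>V\<rfloor>"
  have Vz: "V = real z + frac V" using V0 by (simp add: z_def frac_def)
  \<comment> \<open>\<open>V\<close> is a multiple of \<open>1 / b ^ n\<close>, so
    \<open>frac V\<close> is the left end of its own \<open>b\<close>-adic cell.\<close>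
  have "frac V * real b ^ n = of_int (int h - int (z * b ^ n))"
    using Vb Vz by (simp add: algebra_simps) (metis add_diff_cancel_left' distrib_right)
  moreover have "0 \<le> frac V * real b ^ n" by simp
  ultimately have "real (nat \<lfloor>frac V * real b ^ n\<rfloor>) = frac V * real b ^ n" by simp
  then have "real (nat \<lfloor>frac V * real b ^ n\<rfloor>) / real b ^ n = frac V * real b ^ n / real b ^ n" by (rule arg_cong)
  then have "real (nat \<lfloor>frac V * real b ^ n\<rfloor>) / real b ^ n = frac V" using b by (simp del: of_nat_nat)
  then have sub: "{frac V - 1 / real b ^ n <..< frac V + 2 / real b ^ n} \<subseteq> U_cell b c n d"
    using unbalanced_cell_subset_U_cell[OF _ _ _ unbal] b by (simp add: frac_lt_1)
  \<comment> \<open>The tested \<open>h\<close> lies within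
    \<open>h - 1 / 2 \<le> Y * b ^ n < h + 3 / 2\<close>; another \<open>1 / 2\<close> for moving
    from the grid point to \<open>x\<close> gives exactly the enlarged cell.\<close>
  have "real h - 1 < Y' * real b ^ n" "Y' * real b ^ n < real h + 2" using near h by linarith+
  then have "V - 1 / real b ^ n < Y'" "Y' < V + 2 / real b ^ n" using b by (auto simp: V_def field_simps)
  then have "Y' - real z \<in> U_cell b c n d" using sub Vz by auto
  moreover have "z \<le> 2 * c * c + 2"
  proof -
    have "real h \<le> Y * real b ^ n + 1 * real b ^ n" using h(2) bn by linarith
    then have "V \<le> Y + 1" using b by (simp add: V_def field_simps)
    moreover have "real (2 * c * c + 2) = 2 * real (c * c) + 2" by simp
    ultimately have "real z \<le> real (2 * c * c + 2)" using Yle Vz frac_ge_0[of V] by linarith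
    then show ?thesis by (simp only: of_nat_le_iff)
  qed
  moreover have "?P x = (real z - K) + (Y' - real z)" by (simp add: Y'_def)
  ultimately have "?P x \<in> shifted_cells b c n d" unfolding shifted_cells_def K_def by blast
  with uw b d n show thesis by (intro that)
qed

section \<open>Measure of the failing cells\<close>

lemma open_shifted_cells: "open (shifted_cells b c n d)"
  unfolding shifted_cells_def by (intro open_UN ballI open_translation open_U_cell)

lemma emeasure_shifted_cells_le:
  assumes M: "interval_bounded M k" and b: "b \<ge> 2" and c: "c \<ge> 1" and d: "d < b"
  shows "emeasure M (shifted_cells b c n d) \<le> ennreal (k * (30 * real c ^ 2 * exp (- real n / (2 * (real c)\<^sup>2))))"
proof -
  let ?E = "exp (- real n / (2 * (real c)\<^sup>2))"
  have sets: "sets M = sets borel" and k: "k \<ge> 0" using M by (auto simp: interval_bounded_def)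
  have "emeasure M (shifted_cells b c n d) \<le>
      (\<Sum>z\<in>{..2 * c * c + 2}. emeasure M ((\<lambda>y. (real z - real (c * c + 1)) + y) ` U_cell b c n d))"
    unfolding shifted_cells_def
    using open_translation[OF open_U_cell] sets by (intro emeasure_subadditive_finite) auto
  also have "\<dots> \<le> (\<Sum>z\<in>{..2 * c * c + 2}. ennreal (6 * k * ?E))"
    unfolding emeasure_translation[OF sets open_U_cell]
    by (intro sum_mono emeasure_U_cell_le interval_bounded_shift M b c d)
  also have "\<dots> = ennreal (real (2 * c * c + 3) * (6 * k * ?E))"
    unfolding sum_constant ennreal_of_nat_eq_real_of_nat card_atMost using k
    by (subst ennreal_mult[symmetric]) (auto simp: algebra_simps)
  also have "\<dots> \<le> ennreal (real (5 * c * c) * (6 * k * ?E))"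
    using k c by (intro ennreal_leI mult_right_mono) (auto simp: Suc_le_eq simp flip: of_nat_mult of_nat_add)
  finally show ?thesis by (simp add: power2_eq_square mult_ac)
qed

text \<open>Disjoint cells of equal length turn the count into a measure, at most the number of
  parameter tuples times the largest preimage bound. Degrees up to \<open>c\<close> cost a
  \<open>c\<close>-th root, which leaves the exponent \<open>t\<^sup>2 / (2 * c ^ 3)\<close>; by
  \<open>c ^ 6 \<le> t\<close> this is at least \<open>t powr (3 / 2) / 2\<close>.\<close>

lemma card_stage_test_le:
  assumes t: "t \<ge> 1"
  shows "real (card {i. i < 2 ^ level t \<and> stage_test t i}) \<le>
     2 ^ level t * (240 * real t ^ 5 * (2 * real t + 1) * exp (- (real t powr (3 / 2)) / 2))"
proof -
  define c e where "c = slow t" and "e = level t"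
  note cb = slow_bounds[OF t, folded c_def]
  define T where "T = {i. i < 2 ^ e \<and> stage_test t i}"
  define valid where "valid = (\<lambda>(u, w, b :: nat, d, n :: nat). (\<exists>j<c. 1 \<le> j \<and> coef c u j \<noteq> coef c w j) \<and> 2 \<le> b \<and> d < b)"
  \<comment> \<open>Invalid tuples get the empty set, so that the sum may run over the full box
    \<open>I\<close>.\<close>
  define Pre where "Pre = (\<lambda>(u, w, b :: nat, d, n :: nat). if valid (u, w, b, d, n)
     then int_poly_eval (stage_poly c u w) -` shifted_cells b c n d else {})"
  define I where "I = {..<c ^ c} \<times> {..<c ^ c} \<times> {..c} \<times> {..<c} \<times> {t ^ 2..<(t + 1) ^ 2}"
  define B where "B = 120 * real c ^ 3 * exp (- (real t ^ 2) / (2 * real c ^ 3))"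
  define cell where "cell i = {real i / 2 ^ e <..< (real i + 1) / 2 ^ e}" for i :: nat
  have finI: "finite I" by (simp add: I_def)
  have openPre: "open (Pre q)" for q
    unfolding Pre_def by (auto split: prod.split intro: open_int_poly_vimage open_shifted_cells)
  have Pre_le: "emeasure lborel (Pre q) \<le> ennreal B" if "q \<in> I" for q
  proof -
    obtain u w b d n where q: "q = (u, w, b, d, n)" by (cases q) auto
    show ?thesis
    proof (cases "valid q")
      case True
      then have v: "\<exists>j<c. 1 \<le> j \<and> coef c u j \<noteq> coef c w j" "2 \<le> b" "d < b" by (auto simp: valid_def q)
      have n: "t ^ 2 \<le> n" using that by (auto simp: I_def q)
      define D where "D = degree (stage_poly c u w)"
      have D1: "D \<ge> 1"
      proof -
        from v(1) obtain j where "j < c" "1 \<le> j" "coeff (stage_poly c u w) j \<noteq> 0" by (auto simp: coeff_stage_poly)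
        then show ?thesis using le_degree[of "stage_poly c u w" j] by (simp add: D_def)
      qed
      have Dc: "D \<le> c" unfolding D_def by (rule degree_le) (auto simp: coeff_stage_poly)
      let ?L = "30 * real c ^ 2 * exp (- real n / (2 * (real c)\<^sup>2))"
      have "emeasure lborel (Pre q) \<le> ennreal (4 * real D * ?L powr (1 / real D))"
      proof -
        have "emeasure lborel (int_poly_eval (stage_poly c u w) -` shifted_cells b c n d) \<le>
            ennreal (4 * real D * ?L powr (1 / real D))"
          by (rule emeasure_int_poly_vimage_le[OF D_def[symmetric] D1 open_shifted_cells _
                emeasure_shifted_cells_le[OF _ v(2) cb(1) v(3)]]) (use cb(1) in auto)
        then show ?thesis using True by (simp add: Pre_def q)
      qed
      also have "\<dots> \<le> ennreal B"
      proof (rule ennreal_leI)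
        have "real c ^ 2 \<ge> 1" using cb(1) by (intro one_le_power) simp
        then have L30: "30 * real c ^ 2 \<ge> 1" by linarith
        have "?L powr (1 / real D) = (30 * real c ^ 2) powr (1 / real D) * exp (- real n / (2 * (real c)\<^sup>2)) powr (1 / real D)"
          by (rule powr_mult)
        also have "\<dots> \<le> (30 * real c ^ 2) * exp (- (real t ^ 2) / (2 * real c ^ 3))"
        proof (intro mult_mono)
          show "(30 * real c ^ 2) powr (1 / real D) \<le> 30 * real c ^ 2"
            using powr_mono[of "1 / real D" 1 "30 * real c ^ 2"] L30 D1 by simp
          have "real (t ^ 2) \<le> real n" using n by (simp only: of_nat_le_iff)
          then have "real t ^ 2 / (2 * real c ^ 3) \<le> real n / (2 * (real c)\<^sup>2 * real D)"
            using Dc D1 cb(1) by (intro frac_le) (auto simp: power3_eq_cube power2_eq_square)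
          then show "exp (- real n / (2 * (real c)\<^sup>2)) powr (1 / real D) \<le> exp (- (real t ^ 2) / (2 * real c ^ 3))"
            by (simp add: powr_def mult.commute)
        qed auto
        finally have "4 * real D * ?L powr (1 / real D) \<le> 4 * real c * ((30 * real c ^ 2) * exp (- (real t ^ 2) / (2 * real c ^ 3)))"
          using Dc by (intro mult_mono) auto
        then show "4 * real D * ?L powr (1 / real D) \<le> B" by (simp add: B_def power3_eq_cube power2_eq_square)
      qed
      finally show ?thesis .
    next
      case False
      then show ?thesis by (simp add: Pre_def q)
    qed
  qed
  have cover: "(\<Union>i\<in>T. cell i) \<subseteq> (\<Union>q\<in>I. Pre q)"
  proof
    fix x assume "x \<in> (\<Union>i\<in>T. cell i)"
    then obtain i where i: "i < 2 ^ e" "stage_test t i" "real i / 2 ^ e < x" "x < (real i + 1) / 2 ^ e"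
      by (auto simp: T_def cell_def)
    obtain u w b d n where q: "u < c ^ c" "w < c ^ c" "\<exists>j<c. 1 \<le> j \<and> coef c u j \<noteq> coef c w j"
      "2 \<le> b" "b \<le> c" "d < b" "t ^ 2 \<le> n" "n < (t + 1) ^ 2"
      "int_poly_eval (stage_poly c u w) x \<in> shifted_cells b c n d"
      using stage_test_cell[OF t, folded c_def e_def, OF i] by blast
    then have "(u, w, b, d, n) \<in> I" "x \<in> Pre (u, w, b, d, n)" by (auto simp: I_def Pre_def valid_def)
    then show "x \<in> (\<Union>q\<in>I. Pre q)" by blast
  qed
  have "ennreal (real (card T) * (1 / 2 ^ e)) = (\<Sum>i\<in>T. ennreal (1 / 2 ^ e))"
    unfolding sum_constant ennreal_of_nat_eq_real_of_nat by (intro ennreal_mult) auto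
  also have "\<dots> = (\<Sum>i\<in>T. emeasure lborel (cell i))"
    by (intro sum.cong refl) (simp add: cell_def divide_right_mono add_divide_distrib)
  also have "\<dots> = emeasure lborel (\<Union>i\<in>T. cell i)"
  proof (rule sum_emeasure)
    show "disjoint_family_on cell T"
      unfolding disjoint_family_on_def
    proof (intro ballI impI equals0I)
      fix i j x assume "i \<noteq> j" and x: "x \<in> cell i \<inter> cell j"
      then have "real i < x * 2 ^ e" "x * 2 ^ e < real i + 1" "real j < x * 2 ^ e" "x * 2 ^ e < real j + 1"
        by (auto simp: cell_def field_simps)
      then have "i < Suc j" "j < Suc i" by linarith+
      with \<open>i \<noteq> j\<close> show False by simp
    qed
  qed (auto simp: cell_def T_def)
  also have "\<dots> \<le> emeasure lborel (\<Union>q\<in>I. Pre q)"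
    using cover openPre by (intro emeasure_mono) (auto intro!: borel_open)
  also have "\<dots> \<le> (\<Sum>q\<in>I. emeasure lborel (Pre q))"
    using finI openPre by (intro emeasure_subadditive_finite) auto
  also have "\<dots> \<le> (\<Sum>q\<in>I. ennreal B)" by (intro sum_mono Pre_le)
  also have "\<dots> = ennreal (real (card I) * B)"
    unfolding sum_constant ennreal_of_nat_eq_real_of_nat by (intro ennreal_mult[symmetric]) (auto simp: B_def)
  finally have "real (card T) * (1 / 2 ^ e) \<le> real (card I) * B"
    by (subst (asm) ennreal_le_iff) (auto simp: B_def)
  also have "\<dots> \<le> real (t * t * (2 * t) * t * (2 * t + 1)) * (120 * real t * exp (- (real t powr (3 / 2)) / 2))"
  proof (rule mult_mono)
    have "card I = c ^ c * (c ^ c * ((c + 1) * (c * ((t + 1) ^ 2 - t ^ 2))))"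
      by (simp add: I_def)
    also have "(t + 1) ^ 2 - t ^ 2 = 2 * t + 1" by (simp add: power2_eq_square)
    also have "c ^ c * (c ^ c * ((c + 1) * (c * (2 * t + 1)))) \<le> t * (t * ((2 * t) * (t * (2 * t + 1))))"
      using cb by (intro mult_le_mono) auto
    finally show "real (card I) \<le> real (t * t * (2 * t) * t * (2 * t + 1))"
      by (simp only: of_nat_le_iff mult.assoc)
    have "real (c ^ 3) \<le> real t" using cb(4) by (simp only: of_nat_le_iff)
    moreover have "exp (- (real t ^ 2) / (2 * real c ^ 3)) \<le> exp (- (real t powr (3 / 2)) / 2)"
    proof -
      have "real (c ^ 6) \<le> real t" using cb(5) by (simp only: of_nat_le_iff)
      then have "(real c ^ 3) ^ 2 \<le> real t" by (simp flip: power_mult)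
      then have "real c ^ 3 \<le> sqrt (real t)" by (rule real_le_rsqrt)
      moreover have "real t powr (3 / 2) * sqrt (real t) = real t ^ 2"
      proof -
        have "real t powr (3 / 2) * sqrt (real t) = real t powr (3 / 2) * real t powr (1 / 2)"
          by (simp add: powr_half_sqrt)
        also have "\<dots> = real t powr (3 / 2 + 1 / 2)" by (rule powr_add[symmetric])
        finally show ?thesis by simp
      qed
      moreover have "real t powr (3 / 2) * real c ^ 3 \<le> real t powr (3 / 2) * sqrt (real t)"
        using calculation(1) by (intro mult_left_mono) auto
      ultimately have "real t powr (3 / 2) * real c ^ 3 \<le> real t ^ 2" by simp
      then show ?thesis using cb(1) by (simp add: field_simps)
    qed
    ultimately show "B \<le> 120 * real t * exp (- (real t powr (3 / 2)) / 2)"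
      unfolding B_def by (intro mult_mono) auto
  qed (auto simp: B_def)
  also have "\<dots> = 240 * real t ^ 5 * (2 * real t + 1) * exp (- (real t powr (3 / 2)) / 2)"
    by (simp add: power_numeral_reduce algebra_simps)
  finally show ?thesis by (simp add: T_def e_def field_simps)
qed

lemma card_stage_test_eventually:
  "\<forall>\<^sub>F t in sequentially. real (card {i. i < 2 ^ level t \<and> stage_test t i}) \<le> 2 ^ level t / 8 ^ Suc t"
proof -
  have "\<forall>\<^sub>F x :: real in at_top. 240 * x ^ 5 * (2 * x + 1) * exp (- (x powr (3 / 2)) / 2) \<le> exp (- (x + 1) * ln 8)"
    by real_asymp
  then have "\<forall>\<^sub>F t in sequentially. 240 * real t ^ 5 * (2 * real t + 1) * exp (- (real t powr (3 / 2)) / 2)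
      \<le> exp (- (real t + 1) * ln 8)"
    by (rule eventually_compose_filterlim[OF _ filterlim_real_sequentially])
  then show ?thesis using eventually_ge_at_top[of 1]
  proof eventually_elim
    case (elim t)
    have "exp (- (real t + 1) * ln 8) = 1 / 8 ^ Suc t"
    proof -
      have "exp (- (real t + 1) * ln 8) = inverse (exp (real (Suc t) * ln 8))"
        by (simp add: exp_minus[symmetric] algebra_simps)
      also have "exp (real (Suc t) * ln 8) = exp (ln 8) ^ Suc t" by (rule exp_of_nat_mult)
      finally show ?thesis by (simp add: inverse_eq_divide)
    qed
    with elim(1) have "2 ^ level t * (240 * real t ^ 5 * (2 * real t + 1) * exp (- (real t powr (3 / 2)) / 2))
        \<le> 2 ^ level t * (1 / 8 ^ Suc t)" by (intro mult_left_mono) auto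
    with card_stage_test_le[OF elim(2)] show ?case by simp
  qed
qed

section \<open>The number that passes all tests\<close>

lemma exists_between_squares:
  fixes n :: nat obtains t where "t ^ 2 \<le> n" "n < (t + 1) ^ 2"
proof -
  have ex: "\<exists>t. n < (t + 1) ^ 2" by (rule exI[of _ n]) (simp add: power2_eq_square)
  define t where "t = (LEAST t. n < (t + 1) ^ 2)"
  have "n < (t + 1) ^ 2" unfolding t_def by (rule LeastI_ex[OF ex])
  moreover have "t ^ 2 \<le> n"
  proof (cases t)
    case (Suc s)
    then have "\<not> n < (s + 1) ^ 2" using not_less_Least[of s "\<lambda>t. n < (t + 1) ^ 2"] by (simp add: t_def)
    with Suc show ?thesis by simp
  qed simp
  ultimately show thesis using that by blast
qed

text \<open>If \<open>b * x\<close> is an integer, its binary digits after the radix point are all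
  \<open>0\<close> and the word \<open>[1]\<close> never occurs. Irrationality is what makes the
  digit search for \<open>point\<close> terminate.\<close>

lemma transcendentally_normal_irrational:
  assumes "transcendentally_normal x" shows "x \<notin> \<rat>"
proof
  assume "x \<in> \<rat>"
  then obtain a b :: int where ab: "b > 0" "x = of_int a / of_int b" by (auto elim: Rats_cases')
  have "int_poly_eval [:0, b:] x = of_int a" using ab by (simp add: int_poly_eval_def map_poly_pCons)
  moreover have "degree [:0, b:] > 0" using ab by simp
  ultimately have norm: "normal_number (of_int a)"
    using assms unfolding transcendentally_normal_def by metis
  have "digit 2 (of_int a) k = 0" if "k \<ge> 1" for k
  proof -
    have "\<bar>real_of_int a\<bar> * 2 ^ k = of_int (\<bar>a\<bar> * 2 ^ k)" by simp
    then have "nat \<lfloor>\<bar>real_of_int a\<bar> * 2 ^ k\<rfloor> = nat \<bar>a\<bar> * 2 ^ k" by (simp only: floor_of_int) (simp add: nat_mult_distrib nat_power_eq)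
    with that show ?thesis by (simp add: digit_def)
  qed
  then have "occurrences 2 (of_int a) [1] n = 0" for n by (auto simp: occurrences_def)
  moreover have "(\<lambda>n. real (occurrences 2 (of_int a) [1] n) / real n) \<longlonglongrightarrow> 1 / real 2 ^ length [1]"
    using norm[unfolded normal_number_def, rule_format, of 2 "[1]"] by simp
  ultimately have "(\<lambda>n. 0 :: real) \<longlonglongrightarrow> 1 / 2" by simp
  then show False by (simp add: LIMSEQ_const_iff)
qed

lemma computable_transcendentally_normal_number:
  obtains \<nu> where "\<nu> \<in> {0<..<1}" "transcendentally_normal \<nu>" "\<exists>p. computes_all_expansions p \<nu>" "computable_real \<nu>"
proof -
  \<comment> \<open>The estimate holds only from some stage on, so earlier stages are switched off.
    \<open>s0\<close> enters the program as a constant, and only finitely many lengths go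
    untested.\<close>
  obtain s0 where s0: "\<And>t. t \<ge> s0 \<Longrightarrow> real (card {i. i < 2 ^ level t \<and> stage_test t i}) \<le> 2 ^ level t / 8 ^ Suc t"
    using card_stage_test_eventually unfolding eventually_sequentially by blast
  interpret dyadic_tests level "\<lambda>s i. s0 \<le> s \<and> stage_test s i"
  proof
    show "computable 1 (\<lambda>v. level (v 0))" by (rule level_computable)
    show "decidable 2 (\<lambda>v. s0 \<le> v 0 \<and> stage_test (v 0) (v 1))"
      by (intro computable_intros stage_test_decidable) auto
    show "real (card {i. i < 2 ^ level s \<and> s0 \<le> s \<and> stage_test s i}) \<le> 2 ^ level s / 8 ^ Suc s" for s
      using s0[of s] by (cases "s0 \<le> s") auto
  qed
  have "transcendentally_normal point"
  proof (rule transcendentally_normal_if_balanced)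
    fix p and b m d :: nat assume p: "p \<in> poly_family" and b: "b \<ge> 2" and m: "m \<ge> 1" and d: "d < b"
    have deg: "degree p \<ge> 1" by (rule degree_family[OF p])
    \<comment> \<open>Bounds degree, coefficients, base and precision together, so
      \<open>slow t \<ge> C\<close> brings \<open>p\<close>, \<open>b\<close> and \<open>m\<close>
      within the reach of stage \<open>t\<close>.\<close>
    define C where "C = Suc (degree p + b + m + (\<Sum>k\<le>degree p. nat \<bar>coeff p k\<bar>))"
    have C0: "C > 0" by (simp add: C_def)
    have coeffC: "\<bar>coeff p k\<bar> < int C" for k
    proof (cases "k \<le> degree p")
      case True
      then have "nat \<bar>coeff p k\<bar> \<le> (\<Sum>k\<le>degree p. nat \<bar>coeff p k\<bar>)" by (intro member_le_sum) auto
      then have "nat \<bar>coeff p k\<bar> < C" by (simp add: C_def)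
      then show ?thesis by (simp add: nat_less_iff)
    qed (use C0 in \<open>simp add: coeff_eq_0\<close>)
    define N where "N = max 1 (max s0 (C ^ (20 * C)))"
    have "balanced b m n d (frac (int_poly_eval p point))" if n: "n \<ge> N ^ 2" for n
    proof -
      obtain t where t: "t ^ 2 \<le> n" "n < (t + 1) ^ 2" by (rule exists_between_squares)
      have "N ^ 2 < (t + 1) ^ 2" using n t by linarith
      then have "N < t + 1" by (rule power_less_imp_less_base) simp
      then have "N \<le> t" by simp
      then have t1: "t \<ge> 1" and ts: "t \<ge> s0" and tC: "C ^ (20 * C) \<le> t" by (auto simp: N_def)
      define c where "c = slow t"
      have cC: "C \<le> c" unfolding c_def by (rule slow_ge[OF tC])
      obtain u w where uw: "u < c ^ c" "w < c ^ c" "stage_poly c u w = p"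
      proof (rule stage_poly_surj)
        show "\<bar>coeff p k\<bar> < int c" for k using coeffC[of k] cC by linarith
        show "degree p < c" using cC by (simp add: C_def)
      qed
      have "coeff (stage_poly c u w) (degree p) \<noteq> 0" using deg uw(3) by auto
      then have nonconst: "\<exists>j<c. 1 \<le> j \<and> coef c u j \<noteq> coef c w j"
        using deg by (auto simp: coeff_stage_poly split: if_splits intro!: exI[of _ "degree p"])
      obtain i where i: "\<not> (s0 \<le> t \<and> stage_test t i)" "real i / 2 ^ level t \<le> point" "point \<le> (real i + 1) / 2 ^ level t"
        by (rule point_avoids)
      have bc: "b \<le> c" "m \<le> c" using cC by (auto simp: C_def)
      have "balanced b c n d (frac (int_poly_eval p point))"
      proof (rule ccontr)
        assume "\<not> ?thesis"
        then have "stage_test t i"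
          using stage_test_if_unbalanced[OF t1, folded c_def, of u w b d n point i] uw nonconst b bc d t i(2,3) point_in_unit
          by auto
        with i(1) ts show False by simp
      qed
      moreover have "1 / real c \<le> 1 / real m" using m bc by (intro divide_left_mono) auto
      ultimately show ?thesis unfolding balanced_def by linarith
    qed
    then show "\<forall>\<^sub>F n in sequentially. balanced b m n d (frac (int_poly_eval p point))"
      unfolding eventually_sequentially by blast
  qed
  moreover from this have irr: "point \<notin> \<rat>" by (rule transcendentally_normal_irrational)
  moreover have "point \<in> {0<..<1}"
  proof -
    have "point \<noteq> 0" "point \<noteq> 1" using irr by auto
    then show ?thesis using point_in_unit by auto
  qed
  ultimately show thesis using that point_expansions_computable point_computable by blast
qed

theorem theorem1p1:
  shows "UNIV - Omega_infty \<in> null_sets lebesgue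
    \<and> (\<forall>r \<in> {0<..1}. sierpinski_candidates r \<noteq> {}
          \<and> transcendentally_normal (sierpinski_number r))
    \<and> (\<exists>\<nu> \<in> {0<..<1}. transcendentally_normal \<nu> \<and> (\<exists>e. computes_all_expansions e \<nu>))
    \<and> (\<exists>\<nu> \<in> {0<..<1}. transcendentally_normal \<nu> \<and> computable_real \<nu>)"
proof (intro conjI ballI)
  show "UNIV - Omega_infty \<in> null_sets lebesgue" by (rule null_not_transcendentally_normal)
  show "sierpinski_candidates r \<noteq> {}" "transcendentally_normal (sierpinski_number r)" if "r \<in> {0<..1}" for r
    using sierpinski_number_transcendentally_normal that by auto
  obtain \<nu> where \<nu>: "\<nu> \<in> {0<..<1}" "transcendentally_normal \<nu>" "\<exists>p. computes_all_expansions p \<nu>" "computable_real \<nu>"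
    by (rule computable_transcendentally_normal_number)
  from \<nu> show "\<exists>\<nu>\<in>{0<..<1}. transcendentally_normal \<nu> \<and> (\<exists>e. computes_all_expansions e \<nu>)" by blast
  from \<nu> show "\<exists>\<nu>\<in>{0<..<1}. transcendentally_normal \<nu> \<and> computable_real \<nu>" by blast
qed

end
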